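(* Let $\rho$ be a density operator of a single optical mode with photon number operator $N$. Suppose a phase shift $\Theta$, uniformly random on the unit circle (prior density $\frac1{2\pi}$), is applied to the probe state $\rho$, giving $\rho_\theta=e^{-iN\theta}\rho e^{iN\theta}$, and let $\Theta_{\rm est}$ be any estimate of $\Theta$ obtained from a measurement (POVM on the unit circle) on $\rho_\theta$. Then the root-mean-square error ${\rm RMSE}=\langle(\Theta_{\rm est}-\Theta)^2\rangle^{1/2}$ satisfies the three lower bounds $${\rm RMSE}\ge\frac{\pi}{\sqrt3\,L_{1/2}(N|\rho)},\qquad {\rm RMSE}\ge\max_n p(n|\rho),\qquad {\rm RMSE}\ge\frac{f_{\max}}{\langle N\rangle+\frac12},$$ where $L_{1/2}(N|\rho)=\big[\sum_n\sqrt{p(n|\rho)}\,\big]^2$, $\langle N\rangle=\mathrm{tr}[\rho N]$, and $f_{\max}\approx0.5823$ is the maximum value of the function $$f(\alpha):=\begin{cases}\dfrac{2}{\alpha}\left(\dfrac{\pi}{3\alpha-1}\right)^{1/2}\left(\dfrac{3\alpha-1}{2}\right)^{\frac1{1-\alpha}}\dfrac{(1-\alpha)^{1/2}\,\Gamma(\frac1{1-\alpha})}{\Gamma(\frac1{1-\alpha}-\frac12)}, & \frac12\le\alpha\le1,\\[3mm]\dfrac{2}{\alpha}\left(\dfrac{\pi}{3\alpha-1}\right)^{1/2}\left(\dfrac{3\alpha-1}{2}\right)^{\frac1{1-\alpha}}\dfrac{(\alpha-1)^{1/2}\,\Gamma(\frac{\alpha}{\alpha-1}+\frac12)}{\Gamma(\frac{\alpha}{\alpha-1})},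 & \alpha\ge1,\end{cases}$$ which is achieved for $\alpha\approx0.7471$.
   Context: $N=\sum_{n\ge0} n|n\rangle\langle n|$ with $\{|n\rangle\}_{n=0,1,2,\dots}$ an orthonormal basis, and $p(n|\rho)=\langle n|\rho|n\rangle$. The estimate is described by a POVM $\{M_{\theta_{\rm est}}\}$ on the circle ($M_{\theta_{\rm est}}\ge0$, $\oint d\theta_{\rm est}M_{\theta_{\rm est}}=1$); the joint density of $\theta,\theta_{\rm est}$ is $\frac1{2\pi}\mathrm{tr}[\rho_\theta M_{\theta_{\rm est}}]$. In the RMSE, the error $\theta_{\rm err}=\theta_{\rm est}-\theta$ is reduced modulo $2\pi$ to the reference interval $[-\pi,\pi)$, so ${\rm RMSE}^2=\int_{-\pi}^{\pi}d\theta_{\rm err}\,\theta_{\rm err}^2\,p(\theta_{\rm err})$ with $p(\theta_{\rm err})$ the density of the error. $\Gamma$ is the Gamma function; $f(1)$ is defined by the limit $\alpha\to1$, with $f(1)=\sqrt{2\pi/e^3}$. If $L_{1/2}(N|\rho)$ or $\langle N\rangle$ is infinite the corresponding bound is read as $0$. *)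

theory Defs
  imports "HOL-Probability.Probability" "HOL-Real_Asymp.Real_Asymp" "HOL-Library.Real_Mod"
begin

section \<open>The Hilbert space of a single mode\<close>

text \<open>
  The state space of a single mode is realised as the space of square-summable complex sequences;
  entry \<open>n\<close> of a sequence is its coefficient with respect to the number state \<open>|n\<rangle>\<close>.
\<close>

typedef fock = "{x :: nat \<Rightarrow> complex. summable (\<lambda>n. (cmod (x n))\<^sup>2)}"
  morphisms coeff Abs_fock
  by (rule exI[of _ "\<lambda>_. 0"]) simp

setup_lifting type_definition_fock

lemma summable_coeff: "summable (\<lambda>n. (cmod (coeff x n))\<^sup>2)"
  using coeff[of x] by simp

lemma square_summable_add:
  fixes x y :: "nat \<Rightarrow> complex"
  assumes "summable (\<lambda>n. (cmod (x n))\<^sup>2)" "summable (\<lambda>n. (cmod (y n))\<^sup>2)"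
  shows "summable (\<lambda>n. (cmod (x n + y n))\<^sup>2)"
proof (rule summable_comparison_test')
  show "summable (\<lambda>n. 2 * (cmod (x n))\<^sup>2 + 2 * (cmod (y n))\<^sup>2)"
    using assms by (intro summable_add summable_mult)
  fix n
  have "(cmod (x n + y n))\<^sup>2 \<le> (cmod (x n) + cmod (y n))\<^sup>2"
    by (intro power_mono norm_triangle_ineq norm_ge_zero)
  also have "\<dots> \<le> 2 * (cmod (x n))\<^sup>2 + 2 * (cmod (y n))\<^sup>2"
    using zero_le_power2[of "cmod (x n) - cmod (y n)"]
    by (simp add: power2_eq_square algebra_simps)
  finally show "norm ((cmod (x n + y n))\<^sup>2) \<le> 2 * (cmod (x n))\<^sup>2 + 2 * (cmod (y n))\<^sup>2"
    by simp
qed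

lemma square_summable_scale:
  fixes x :: "nat \<Rightarrow> complex"
  assumes "summable (\<lambda>n. (cmod (x n))\<^sup>2)"
  shows "summable (\<lambda>n. (cmod (c * x n))\<^sup>2)"
  using summable_mult[OF assms, of "(cmod c)\<^sup>2"] by (simp add: norm_mult power_mult_distrib)

lift_definition scaleC :: "complex \<Rightarrow> fock \<Rightarrow> fock" is "\<lambda>c x n. c * x n"
  by (rule square_summable_scale)

text \<open>The inner product \<open>\<langle>x|y\<rangle>\<close> is antilinear in the first argument.\<close>

definition cinner :: "fock \<Rightarrow> fock \<Rightarrow> complex" where
  "cinner x y = (\<Sum>n. cnj (coeff x n) * coeff y n)"

lemma summable_cinner: "summable (\<lambda>n. cnj (coeff x n) * coeff y n)"
proof (rule summable_comparison_test')
  show "summable (\<lambda>n. (cmod (coeff x n))\<^sup>2 + (cmod (coeff y n))\<^sup>2)"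
    by (intro summable_add summable_coeff)
  fix n
  have "2 * (cmod (coeff x n) * cmod (coeff y n)) \<le> (cmod (coeff x n))\<^sup>2 + (cmod (coeff y n))\<^sup>2"
    using zero_le_power2[of "cmod (coeff x n) - cmod (coeff y n)"]
    by (simp add: power2_eq_square algebra_simps)
  moreover have "0 \<le> cmod (coeff x n) * cmod (coeff y n)"
    by simp
  ultimately show "norm (cnj (coeff x n) * coeff y n) \<le> (cmod (coeff x n))\<^sup>2 + (cmod (coeff y n))\<^sup>2"
    unfolding norm_mult complex_mod_cnj by linarith
qed

instantiation fock :: real_inner
begin

lift_definition zero_fock :: fock is "\<lambda>_. 0" by simp

lift_definition plus_fock :: "fock \<Rightarrow> fock \<Rightarrow> fock" is "\<lambda>x y n. x n + y n"
  by (rule square_summable_add)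

lift_definition uminus_fock :: "fock \<Rightarrow> fock" is "\<lambda>x n. - x n" by simp

lift_definition minus_fock :: "fock \<Rightarrow> fock \<Rightarrow> fock" is "\<lambda>x y n. x n - y n"
proof -
  fix x y :: "nat \<Rightarrow> complex"
  assume "summable (\<lambda>n. (cmod (x n))\<^sup>2)" "summable (\<lambda>n. (cmod (y n))\<^sup>2)"
  then show "summable (\<lambda>n. (cmod (x n - y n))\<^sup>2)"
    using square_summable_add[of x "\<lambda>n. - y n"] by simp
qed

definition scaleR_fock :: "real \<Rightarrow> fock \<Rightarrow> fock" where
  "scaleR r x = scaleC (complex_of_real r) x"

definition inner_fock :: "fock \<Rightarrow> fock \<Rightarrow> real" where
  "inner x y = Re (cinner x y)"

definition norm_fock :: "fock \<Rightarrow> real" where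
  "norm x = sqrt (Re (cinner x x))"

definition sgn_fock :: "fock \<Rightarrow> fock" where
  "sgn x = inverse (norm x) *\<^sub>R x" for x :: fock

definition dist_fock :: "fock \<Rightarrow> fock \<Rightarrow> real" where
  "dist x y = norm (x - y)" for x y :: fock

definition uniformity_fock :: "(fock \<times> fock) filter" where
  "uniformity = (INF e\<in>{0<..}. principal {(x :: fock, y). dist x y < e})"

definition open_fock :: "fock set \<Rightarrow> bool" where
  "open U \<longleftrightarrow> (\<forall>x\<in>U. eventually (\<lambda>(x', y). x' = x \<longrightarrow> y \<in> U) uniformity)" for U :: "fock set"

instance
proof
  fix x y z :: fock and a b r :: real
  show "x + y + z = x + (y + z)" "x + y = y + x" "0 + x = x" "- x + x = 0" "x - y = x + - y"
    by (transfer; simp add: algebra_simps)+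
  show "a *\<^sub>R (x + y) = a *\<^sub>R x + a *\<^sub>R y" "(a + b) *\<^sub>R x = a *\<^sub>R x + b *\<^sub>R x"
       "a *\<^sub>R b *\<^sub>R x = (a * b) *\<^sub>R x" "1 *\<^sub>R x = x"
    unfolding scaleR_fock_def by (transfer; simp add: algebra_simps)+
  show "sgn x = inverse (norm x) *\<^sub>R x" by (rule sgn_fock_def)
  show "dist x y = norm (x - y)" by (rule dist_fock_def)
  show "uniformity = (INF e\<in>{0<..}. principal {(x :: fock, y). dist x y < e})"
    by (rule uniformity_fock_def)
  show "open U \<longleftrightarrow> (\<forall>x\<in>U. eventually (\<lambda>(x', y). x' = x \<longrightarrow> y \<in> U) uniformity)"
    for U :: "fock set"
    by (rule open_fock_def)
  have inner_suminf: "inner u v = (\<Sum>n. Re (cnj (coeff u n) * coeff v n))" for u v :: fock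
    unfolding inner_fock_def cinner_def by (rule Re_suminf[OF summable_cinner])
  have summable_inner: "summable (\<lambda>n. Re (cnj (coeff u n) * coeff v n))" for u v
    by (rule summable_Re[OF summable_cinner])
  show "inner x y = inner y x"
    unfolding inner_suminf by (simp add: algebra_simps)
  show "inner (x + y) z = inner x z + inner y z"
    unfolding inner_suminf
    by (subst suminf_add[OF summable_inner summable_inner])
       (simp add: plus_fock.rep_eq algebra_simps)
  show "inner (r *\<^sub>R x) y = r * inner x y"
    unfolding inner_suminf
    by (subst suminf_mult[OF summable_inner, symmetric])
       (simp add: scaleR_fock_def scaleC.rep_eq algebra_simps)
  have inner_self: "inner x x = (\<Sum>n. (cmod (coeff x n))\<^sup>2)"
    unfolding inner_suminf cmod_power2 cmod_power2 by (simp add: power2_eq_square)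
  show "0 \<le> inner x x"
    unfolding inner_self by (intro suminf_nonneg summable_coeff) simp
  show "inner x x = 0 \<longleftrightarrow> x = 0"
    unfolding inner_self
    by (subst suminf_eq_zero_iff[OF summable_coeff])
       (auto simp: zero_fock.rep_eq coeff_inject[symmetric])
  show "norm x = sqrt (inner x x)" by (simp add: norm_fock_def inner_fock_def)
qed

end

lift_definition ket :: "nat \<Rightarrow> fock" is "\<lambda>n m. if m = n then 1 else 0"
proof -
  fix n :: nat
  show "summable (\<lambda>m. (cmod (if m = n then 1 else 0))\<^sup>2)"
    by (rule summable_finite[of "{n}"]) auto
qed

lemma coeff_ket: "coeff (ket n) m = (if m = n then 1 else 0)"
  by (simp add: ket.rep_eq)

lemma cinner_ket: "cinner (ket n) x = coeff x n"
proof -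
  have "cinner (ket n) x = (\<Sum>m. if m = n then coeff x m else 0)"
    unfolding cinner_def by (intro arg_cong[where f = suminf]) (auto simp: coeff_ket)
  also have "\<dots> = coeff x n"
    using suminf_finite[of "{n}" "\<lambda>m. if m = n then coeff x m else 0"] by simp
  finally show ?thesis .
qed


section \<open>Operators\<close>

definition bounded_operator :: "(fock \<Rightarrow> fock) \<Rightarrow> bool" where
  "bounded_operator A \<longleftrightarrow> bounded_linear A \<and> (\<forall>c x. A (scaleC c x) = scaleC c (A x))"

definition positive_operator :: "(fock \<Rightarrow> fock) \<Rightarrow> bool" where
  "positive_operator A \<longleftrightarrow> bounded_operator A \<and>
     (\<forall>x. Im (cinner x (A x)) = 0 \<and> 0 \<le> Re (cinner x (A x)))"

definition op_trace :: "(fock \<Rightarrow> fock) \<Rightarrow> complex" where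
  "op_trace A = (\<Sum>\<^sub>\<infinity>n. cinner (ket n) (A (ket n)))"

text \<open>
  For a positive operator, summability of the diagonal is the trace-class condition. An
  \<open>infsum\<close> that does not converge is \<open>0\<close>, so trace \<open>1\<close> includes that condition.
\<close>

definition density_operator :: "(fock \<Rightarrow> fock) \<Rightarrow> bool" where
  "density_operator \<rho> \<longleftrightarrow> positive_operator \<rho> \<and> op_trace \<rho> = 1"

text \<open>
  \<open>number_fun g\<close> is the function \<open>g(N) = \<Sum>n. g(n) |n\<rangle>\<langle>n|\<close> of the photon number operator, on its
  maximal domain. Outside of this domain the value is the junk value \<open>0\<close>.
\<close>

definition number_fun :: "(nat \<Rightarrow> complex) \<Rightarrow> fock \<Rightarrow> fock" where
  "number_fun g x =
     (if summable (\<lambda>n. (cmod (g n * coeff x n))\<^sup>2) then Abs_fock (\<lambda>n. g n * coeff x n) else 0)"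

lemma number_fun_ket: "number_fun g (ket n) = scaleC (g n) (ket n)"
proof -
  have "summable (\<lambda>m. (cmod (g m * coeff (ket n) m))\<^sup>2)"
    by (rule summable_finite[of "{n}"]) (auto simp: coeff_ket)
  then show ?thesis
    unfolding number_fun_def
    by (simp add: coeff_inject[symmetric] Abs_fock_inverse scaleC.rep_eq coeff_ket fun_eq_iff)
qed

definition number_operator :: "fock \<Rightarrow> fock" where
  "number_operator = number_fun of_nat"

definition phase_shift :: "real \<Rightarrow> fock \<Rightarrow> fock" where
  "phase_shift \<theta> = number_fun (\<lambda>n. exp (- (\<i> * of_nat n * of_real \<theta>)))"

text \<open>The shifted probe state \<open>\<rho>\<^sub>\<theta> = exp (-iN\<theta>) \<rho> exp (iN\<theta>)\<close>.\<close>

definition shifted_state :: "(fock \<Rightarrow> fock) \<Rightarrow> real \<Rightarrow> fock \<Rightarrow> fock" where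
  "shifted_state \<rho> \<theta> = phase_shift \<theta> \<circ> \<rho> \<circ> phase_shift (- \<theta>)"


section \<open>Photon number statistics\<close>

definition photon_prob :: "(fock \<Rightarrow> fock) \<Rightarrow> nat \<Rightarrow> real" where
  "photon_prob \<rho> n = Re (cinner (ket n) (\<rho> (ket n)))"

definition L_half :: "(fock \<Rightarrow> fock) \<Rightarrow> ennreal" where
  "L_half \<rho> = (\<Sum>n. ennreal (sqrt (photon_prob \<rho> n)))\<^sup>2"

text \<open>
  The expectation \<open>tr[\<rho> N]\<close> is the sum of the diagonal entries of \<open>\<rho> N\<close>, which are nonnegative,
  with the value \<open>\<infinity>\<close> if the sum diverges.
\<close>

definition mean_photon_number :: "(fock \<Rightarrow> fock) \<Rightarrow> ennreal" where
  "mean_photon_number \<rho> = (\<Sum>n. ennreal (Re (cinner (ket n) (\<rho> (number_operator (ket n))))))"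


section \<open>Phase estimation\<close>

text \<open>Points of the unit circle are represented by their angle in \<open>[-\<pi>, \<pi>)\<close>.\<close>

definition circle :: "real measure" where
  "circle = restrict_space lborel {-pi..<pi}"

text \<open>
  A POVM on the unit circle, as a positive-operator-valued measure that is countably additive in
  the weak sense. A family of densities \<open>M\<^sub>t\<close> with \<open>\<integral>M\<^sub>t dt = 1\<close> corresponds to the POVM with
  \<open>M B = \<integral>\<^sub>B M\<^sub>t dt\<close>; the canonical phase measurement, the densities of which are not bounded
  operators, is covered as well.
\<close>

definition circle_povm :: "(real set \<Rightarrow> fock \<Rightarrow> fock) \<Rightarrow> bool" where
  "circle_povm M \<longleftrightarrow>
     (\<forall>B\<in>sets circle. positive_operator (M B)) \<and>
     M (space circle) = id \<and>
     (\<forall>B :: nat \<Rightarrow> real set. range B \<subseteq> sets circle \<and> disjoint_family B \<longrightarrow>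
        (\<forall>x y. (\<lambda>i. cinner x (M (B i) y)) sums cinner x (M (\<Union>i. B i) y)))"

definition uniform_prior :: "real measure" where
  "uniform_prior = density circle (\<lambda>\<theta>. ennreal (1 / (2 * pi)))"

text \<open>The distribution of the estimate for a given phase shift (Born rule).\<close>

definition outcome_dist ::
    "(fock \<Rightarrow> fock) \<Rightarrow> (real set \<Rightarrow> fock \<Rightarrow> fock) \<Rightarrow> real \<Rightarrow> real measure" where
  "outcome_dist \<rho> M \<theta> = measure_of (space circle) (sets circle)
     (\<lambda>B. ennreal (Re (op_trace (shifted_state \<rho> \<theta> \<circ> M B))))"

definition joint_dist ::
    "(fock \<Rightarrow> fock) \<Rightarrow> (real set \<Rightarrow> fock \<Rightarrow> fock) \<Rightarrow> (real \<times> real) measure" where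
  "joint_dist \<rho> M = Giry_Monad.bind uniform_prior
     (\<lambda>\<theta>. distr (outcome_dist \<rho> M \<theta>) (circle \<Otimes>\<^sub>M circle) (Pair \<theta>))"

text \<open>Reduction of an angle modulo \<open>2\<pi>\<close> to the reference interval \<open>[-\<pi>, \<pi>)\<close>.\<close>

definition wrap_angle :: "real \<Rightarrow> real" where
  "wrap_angle t = (t + pi) rmod (2 * pi) - pi"

definition error_dist ::
    "(fock \<Rightarrow> fock) \<Rightarrow> (real set \<Rightarrow> fock \<Rightarrow> fock) \<Rightarrow> real measure" where
  "error_dist \<rho> M = distr (joint_dist \<rho> M) borel (\<lambda>(\<theta>, \<theta>_est). wrap_angle (\<theta>_est - \<theta>))"

definition RMSE :: "(fock \<Rightarrow> fock) \<Rightarrow> (real set \<Rightarrow> fock \<Rightarrow> fock) \<Rightarrow> real" where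
  "RMSE \<rho> M = sqrt (\<integral>e. e\<^sup>2 \<partial>error_dist \<rho> M)"


section \<open>The constant in the photon number bound\<close>

definition bound_fun :: "real \<Rightarrow> real" where
  "bound_fun \<alpha> =
     (if \<alpha> = 1 then sqrt (2 * pi / exp 3)
      else 2 / \<alpha> * sqrt (pi / (3 * \<alpha> - 1)) * ((3 * \<alpha> - 1) / 2) powr (1 / (1 - \<alpha>)) *
        (if \<alpha> < 1
         then sqrt (1 - \<alpha>) * Gamma (1 / (1 - \<alpha>)) / Gamma (1 / (1 - \<alpha>) - 1 / 2)
         else sqrt (\<alpha> - 1) * Gamma (\<alpha> / (\<alpha> - 1) + 1 / 2) / Gamma (\<alpha> / (\<alpha> - 1))))"

definition f_max :: real where
  "f_max = (GREATEST y. y \<in> bound_fun ` {1/2..})"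

text \<open>The value of \<^const>\<open>bound_fun\<close> at \<open>1\<close> is its limit there.\<close>

lemma Gamma_ratio_tendsto:
  "((\<lambda>x::real. Gamma x / (Gamma (x - 1 / 2) * sqrt x)) \<longlongrightarrow> 1) at_top"
proof (rule tendsto_sandwich)
  have log_convex: "Gamma x ^ 2 \<le> Gamma (x - 1 / 2) * Gamma (x + 1 / 2)" if "x > 1 / 2" for x :: real
  proof -
    have pos: "Gamma x > 0" "Gamma (x - 1 / 2) > 0" "Gamma (x + 1 / 2) > 0"
      using that by (auto intro!: Gamma_real_pos)
    have "(ln \<circ> Gamma) ((1 - 1 / 2) *\<^sub>R (x - 1 / 2) + (1 / 2) *\<^sub>R (x + 1 / 2))
        \<le> (1 - 1 / 2) * (ln \<circ> Gamma) (x - 1 / 2) + (1 / 2) * (ln \<circ> Gamma) (x + 1 / 2)"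
      using that by (intro convex_onD[OF log_convex_Gamma_real]) auto
    moreover have "(1 - 1 / 2) *\<^sub>R (x - 1 / 2) + (1 / 2) *\<^sub>R (x + 1 / 2) = x"
      by (simp add: field_simps)
    ultimately have "2 * ln (Gamma x) \<le> ln (Gamma (x - 1 / 2)) + ln (Gamma (x + 1 / 2))"
      by simp
    also have "\<dots> = ln (Gamma (x - 1 / 2) * Gamma (x + 1 / 2))"
      using pos by (simp add: ln_mult)
    also have "2 * ln (Gamma x) = ln (Gamma x ^ 2)"
      using pos by (simp add: ln_realpow)
    finally show ?thesis
      using pos by (subst (asm) ln_le_cancel_iff) auto
  qed
  have upper: "Gamma x / (Gamma (x - 1 / 2) * sqrt x) \<le> 1"
    and lower: "sqrt (x - 1) / sqrt x \<le> Gamma x / (Gamma (x - 1 / 2) * sqrt x)"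
    if x: "x > 2" for x :: real
  proof -
    have pos: "Gamma x > 0" "Gamma (x - 1 / 2) > 0" "Gamma (x - 1) > 0"
      using x by (auto intro!: Gamma_real_pos)
    have "Gamma (x + 1 / 2) = (x - 1 / 2) * Gamma (x - 1 / 2)"
      using Gamma_plus1[of "x - 1 / 2"] nonpos_Ints_nonpos[of "x - 1 / 2"] x
      by (auto simp: add.commute)
    with log_convex[of x] x have "Gamma x ^ 2 \<le> (x - 1 / 2) * Gamma (x - 1 / 2) ^ 2"
      by (simp add: power2_eq_square mult_ac)
    also have "\<dots> \<le> x * Gamma (x - 1 / 2) ^ 2"
      by (intro mult_right_mono) auto
    also have "\<dots> = (Gamma (x - 1 / 2) * sqrt x) ^ 2"
      using x by (simp add: power_mult_distrib)
    finally have "Gamma x \<le> Gamma (x - 1 / 2) * sqrt x"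
      by (rule power2_le_imp_le) (use pos x in simp)
    then show "Gamma x / (Gamma (x - 1 / 2) * sqrt x) \<le> 1"
      using pos x by (simp add: divide_le_eq)
    have Gx: "Gamma x = (x - 1) * Gamma (x - 1)"
      using Gamma_plus1[of "x - 1"] nonpos_Ints_nonpos[of "x - 1"] x by auto
    have "(sqrt (x - 1) * Gamma (x - 1 / 2)) ^ 2 = (x - 1) * Gamma (x - 1 / 2) ^ 2"
      using x by (simp add: power_mult_distrib)
    also have "\<dots> \<le> (x - 1) * (Gamma (x - 1) * Gamma x)"
      using log_convex[of "x - 1 / 2"] x by (intro mult_left_mono) auto
    also have "\<dots> = Gamma x ^ 2"
      by (simp add: Gx power2_eq_square mult_ac)
    finally have "sqrt (x - 1) * Gamma (x - 1 / 2) \<le> Gamma x"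
      by (rule power2_le_imp_le) (use pos in simp)
    then show "sqrt (x - 1) / sqrt x \<le> Gamma x / (Gamma (x - 1 / 2) * sqrt x)"
      using pos x by (simp add: field_simps)
  qed
  show "\<forall>\<^sub>F x :: real in at_top. sqrt (x - 1) / sqrt x \<le> Gamma x / (Gamma (x - 1 / 2) * sqrt x)"
    using eventually_gt_at_top[of 2] by eventually_elim (rule lower)
  show "\<forall>\<^sub>F x :: real in at_top. Gamma x / (Gamma (x - 1 / 2) * sqrt x) \<le> 1"
    using eventually_gt_at_top[of 2] by eventually_elim (rule upper)
  show "((\<lambda>x :: real. sqrt (x - 1) / sqrt x) \<longlongrightarrow> 1) at_top"
    by real_asymp
qed simp

lemma bound_fun_tendsto: "(bound_fun \<longlongrightarrow> bound_fun 1) (at 1)"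
proof -
  define pre :: "real \<Rightarrow> real" where
    "pre \<alpha> = 2 / \<alpha> * sqrt (pi / (3 * \<alpha> - 1)) * ((3 * \<alpha> - 1) / 2) powr (1 / (1 - \<alpha>))" for \<alpha>
  define R :: "real \<Rightarrow> real" where "R x = Gamma x / (Gamma (x - 1 / 2) * sqrt x)" for x
  have R: "(R \<longlongrightarrow> 1) at_top"
    unfolding R_def[abs_def] by (rule Gamma_ratio_tendsto)
  have "sqrt (2 * pi / exp 3) = 2 * sqrt (pi / 2) / exp (3 / 2)"
  proof (rule real_sqrt_unique)
    have "(exp (3 / 2 :: real))\<^sup>2 = exp 3"
      by (simp add: power2_eq_square exp_add[symmetric])
    then show "(2 * sqrt (pi / 2) / exp (3 / 2))\<^sup>2 = 2 * pi / exp 3"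
      by (simp add: power_mult_distrib power_divide)
  qed simp
  then have val: "bound_fun 1 = 2 * sqrt (pi / 2) / exp (3 / 2)"
    by (simp add: bound_fun_def)
  have "(pre \<longlongrightarrow> 2 * sqrt (pi / 2) / exp (3 / 2)) (at_left 1)"
    "(pre \<longlongrightarrow> 2 * sqrt (pi / 2) / exp (3 / 2)) (at_right 1)"
    unfolding pre_def by (real_asymp simp: powr_half_sqrt exp_minus field_simps)+
  note pre = this[folded val]
  have "((\<lambda>\<alpha>. pre \<alpha> * R (1 / (1 - \<alpha>))) \<longlongrightarrow> bound_fun 1 * 1) (at_left 1)"
    by (intro tendsto_mult pre filterlim_compose[OF R]) real_asymp
  moreover have "\<forall>\<^sub>F \<alpha> in at_left 1. pre \<alpha> * R (1 / (1 - \<alpha>)) = bound_fun \<alpha>"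
    using eventually_at_left_real[of "1/2" "1 :: real"]
    by (auto elim!: eventually_mono simp: bound_fun_def pre_def R_def real_sqrt_divide mult_ac)
  ultimately have left: "(bound_fun \<longlongrightarrow> bound_fun 1) (at_left 1)"
    using tendsto_cong by force
  have "((\<lambda>\<alpha>. pre \<alpha> * (R (\<alpha> / (\<alpha> - 1) + 1 / 2) *
            (sqrt (\<alpha> - 1) * sqrt (\<alpha> / (\<alpha> - 1) + 1 / 2)))) \<longlongrightarrow> bound_fun 1 * (1 * 1)) (at_right 1)"
  proof (intro tendsto_mult[OF pre(2)] tendsto_mult[OF filterlim_compose[OF R]])
    show "filterlim (\<lambda>\<alpha> :: real. \<alpha> / (\<alpha> - 1) + 1 / 2) at_top (at_right 1)"
      by real_asymp
    show "((\<lambda>\<alpha> :: real. sqrt (\<alpha> - 1) * sqrt (\<alpha> / (\<alpha> - 1) + 1 / 2)) \<longlongrightarrow> 1) (at_right 1)"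
      by real_asymp
  qed
  moreover have "\<forall>\<^sub>F \<alpha> in at_right 1. pre \<alpha> * (R (\<alpha> / (\<alpha> - 1) + 1 / 2) *
      (sqrt (\<alpha> - 1) * sqrt (\<alpha> / (\<alpha> - 1) + 1 / 2))) = bound_fun \<alpha>"
  proof (rule eventually_mono[OF eventually_at_right_real[of "1 :: real" 2]])
    fix \<alpha> :: real
    assume \<alpha>: "\<alpha> \<in> {1<..<2}"
    then have "\<alpha> / (\<alpha> - 1) + 1 / 2 > 0"
      by (intro add_pos_pos divide_pos_pos) auto
    then have "sqrt (\<alpha> / (\<alpha> - 1) + 1 / 2) \<noteq> 0"
      by simp
    with \<alpha> show "pre \<alpha> * (R (\<alpha> / (\<alpha> - 1) + 1 / 2) *
        (sqrt (\<alpha> - 1) * sqrt (\<alpha> / (\<alpha> - 1) + 1 / 2))) = bound_fun \<alpha>"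
      by (simp add: bound_fun_def pre_def R_def)
  qed simp
  ultimately have right: "(bound_fun \<longlongrightarrow> bound_fun 1) (at_right 1)"
    using tendsto_cong by force
  show ?thesis
    using left right by (simp add: filterlim_split_at)
qed

end

theory Submission
  imports Defs
begin

text \<open>
  Iterated Schur complements write the probe state as \<open>\<rho> = \<Sum>k |l\<^sub>k\<rangle>\<langle>l\<^sub>k|\<close>, so that the outcome
  distribution at phase \<open>\<theta>\<close> is the sum of the positive measures \<open>B \<mapsto> \<langle>a|M(B)|a\<rangle>\<close> over the vectors
  \<open>a = exp (-iN\<theta>) l\<^sub>k\<close>. Each bound then follows from the positivity of \<open>M(B)\<close>.

  The Cauchy-Schwarz inequality for \<open>M(B)\<close> dominates the outcome distribution by
  \<open>(\<Sum>n \<surd>p\<^sub>n) (\<Sum>n \<surd>p\<^sub>n \<langle>n|M(B)|n\<rangle>)\<close>, and averaging over \<open>\<theta>\<close> bounds the density of the error by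
  \<open>L / 2\<pi>\<close>. Positivity at the vectors \<open>a - c \<langle>n|a\<rangle> |n\<rangle>\<close>, with \<open>c\<close> depending on the error, gives
  \<open>p\<^sub>n \<le> \<langle>w\<rangle> \<cdot> (1 / 2\<pi>) \<integral> 1 / w\<close> for positive functions \<open>w\<close> of the error; \<open>w = 1 + (e / p\<^sub>n)\<^sup>2\<close> gives the second
  bound. For the third bound, \<open>e\<^sup>2 \<ge> 2 - 2 cos e\<close> and \<open>2 \<langle>cos e\<rangle> \<le> \<Sum>n 2 \<surd>(p\<^sub>n p\<^sub>n\<^sub>+\<^sub>1)\<close>, which weighted
  arithmetic-geometric means bound by expectations of \<open>1 / (n + 1)\<close>. The resulting lower bound is stronger
  than \<open>f\<^sub>m\<^sub>a\<^sub>x / (\<langle>N\<rangle> + 1/2)\<close>, so only the numerical value of \<open>f\<^sub>m\<^sub>a\<^sub>x\<close> matters there.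

  In the variable \<open>s = 1 / (1 - \<alpha>)\<close> the derivative of \<open>ln f\<close> is elementary up to
  \<open>\<psi>(s) - \<psi>(s - 1/2)\<close>; rational bounds of this difference determine its sign on both sides of the maximum.
\<close>

section \<open>The maximum of the bound function\<close>

text \<open>A POVM is given by its values on sets, without densities, so every estimate is first an
  inequality between set functions and is integrated afterwards. This is why the estimates stay
  linear in the measures \<open>B \<mapsto> \<langle>n|M(B)|n\<rangle>\<close>: arithmetic means
  replace geometric ones, and the parameters \<open>c\<close>, \<open>\<kappa>\<close> and
  \<open>s\<close> remain free until the end.

  Nothing is reduced to covariant measurements. For a fixed outcome t, a uniform \<theta> already
  makes the wrapped error t - \<theta> uniform, so Fubini replaces a dominating measure by its mass
  times the uniform distribution.

  The decomposition of the state is triangular: l_k has no coefficients below k. Each matrix entry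
  is therefore a finite sum over k, and only the trace formula interchanges two infinite sums of
  complex terms.

  The place and the value of the maximum are found separately: f has a closed form at 3/4, and a
  bound on the slope carries this value over to the maximum.\<close>

definition log_bound :: "real \<Rightarrow> real" where
  "log_bound s = ln (2 * pi) / 2 + (s - 1 / 2) * ln (s - 3 / 2) - (s - 1) * ln s - ln (s - 1)
     + ln_Gamma s - ln_Gamma (s - 1 / 2)"

text \<open>The substitution maps [1/2, 1) onto [2, \<infinity>). The Gamma quotient gets the
  arguments s and s - 1/2, and all other factors become powers of s, s - 1 and s - 3/2.\<close>

lemma bound_fun_less_one:
  assumes "s \<ge> 2"
  shows "bound_fun (1 - 1 / s) = exp (log_bound s)"
proof -
  have s: "s > 0" "s - 1 > 0" "s - 3 / 2 > 0" "s - 1 / 2 > 0" using assms by auto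
  have pos: "Gamma s > 0" "Gamma (s - 1 / 2) > 0" using s by (auto intro!: Gamma_real_pos)
  have eqs: "1 / (1 - (1 - 1 / s)) = s" "3 * (1 - 1 / s) - 1 = (2 * (s - 3 / 2)) / s"
    "(3 * (1 - 1 / s) - 1) / 2 = (s - 3 / 2) / s" "1 - 1 / s = (s - 1) / s"
    "1 - (1 - 1 / s) = 1 / s"
    using s by (auto simp: field_simps)
  have lt: "1 - 1 / s < 1" using s by simp
  have "bound_fun (1 - 1 / s) = 2 / (1 - 1 / s) * sqrt (pi / (3 * (1 - 1 / s) - 1)) *
      ((3 * (1 - 1 / s) - 1) / 2) powr s * (sqrt (1 - (1 - 1 / s)) * Gamma s / Gamma (s - 1 / 2))"
    using s unfolding bound_fun_def by (simp add: eqs(1))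
  also have "\<dots> = 2 / ((s - 1) / s) * sqrt (pi / ((2 * (s - 3 / 2)) / s)) *
      ((s - 3 / 2) / s) powr s * (sqrt (1 / s) * Gamma s / Gamma (s - 1 / 2))"
    by (subst eqs(3), subst eqs(2), subst eqs(5), subst eqs(4)) (rule refl)
  also have "\<dots> = exp (ln (2 / ((s - 1) / s) * sqrt (pi / ((2 * (s - 3 / 2)) / s)) *
      ((s - 3 / 2) / s) powr s * (sqrt (1 / s) * Gamma s / Gamma (s - 1 / 2))))"
    using s pos by (subst exp_ln) auto
  also have "ln (2 / ((s - 1) / s) * sqrt (pi / ((2 * (s - 3 / 2)) / s)) *
      ((s - 3 / 2) / s) powr s * (sqrt (1 / s) * Gamma s / Gamma (s - 1 / 2)))
    = ln (2 / ((s - 1) / s)) + ln (sqrt (pi / ((2 * (s - 3 / 2)) / s))) +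
      ln (((s - 3 / 2) / s) powr s) + ln (sqrt (1 / s)) + ln (Gamma s) - ln (Gamma (s - 1 / 2))"
    using s pos pos[THEN less_imp_neq] by (simp add: ln_mult ln_div)
  also have "\<dots> = log_bound s"
  proof -
    have "ln (s * 2 - 3) = ln 2 + ln ((s * 2 - 3) / 2)" using s by (simp add: ln_div)
    note l = this
    show ?thesis
      unfolding log_bound_def using s
      by (simp add: ln_mult ln_div ln_sqrt ln_powr Gamma_real_pos_exp; simp add: field_simps; use l in linarith)
  qed
  finally show ?thesis .
qed

text \<open>The difference of the two sides has the derivative \<open>- (y ^ 4 / (1 - y))\<close>.
  Four terms are kept for the range s \<ge> 9/2: at s = 9/2, where x = 1/3, three terms would not
  give a negative bound. For \<alpha> \<ge> 1 two terms suffice.\<close>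

lemma ln_one_minus_le:
  fixes x :: real
  assumes "0 \<le> x" "x < 1"
  shows "ln (1 - x) \<le> - x - x\<^sup>2 / 2 - x ^ 3 / 3 - x ^ 4 / 4"
proof -
  define g where "g x = ln (1 - x) + x + x\<^sup>2 / 2 + x ^ 3 / 3 + x ^ 4 / 4" for x :: real
  have "g x \<le> g 0"
  proof (rule DERIV_nonpos_imp_nonincreasing[OF assms(1)])
    fix y assume y: "0 \<le> y" "y \<le> x"
    with assms have "y < 1" by simp
    then have "(g has_real_derivative - (y ^ 4 / (1 - y))) (at y)"
      unfolding g_def
      by (auto intro!: derivative_eq_intros simp: divide_simps power2_eq_square power3_eq_cube)
         algebra
    moreover have "- (y ^ 4 / (1 - y)) \<le> 0" using \<open>y < 1\<close> by simp
    ultimately show "\<exists>d. (g has_real_derivative d) (at y) \<and> d \<le> 0" by blast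
  qed
  then show ?thesis by (simp add: g_def)
qed

lemma ln_one_plus_ge:
  fixes x :: real
  assumes "0 \<le> x"
  shows "x - x\<^sup>2 / 2 \<le> ln (1 + x)"
proof -
  define g where "g x = ln (1 + x) - x + x\<^sup>2 / 2" for x :: real
  have "g 0 \<le> g x"
  proof (rule DERIV_nonneg_imp_nondecreasing[OF assms(1)])
    fix y assume y: "0 \<le> y" "y \<le> x"
    then have "(g has_real_derivative y\<^sup>2 / (1 + y)) (at y)"
      unfolding g_def
      by (auto intro!: derivative_eq_intros simp: divide_simps power2_eq_square) algebra
    moreover have "y\<^sup>2 / (1 + y) \<ge> 0" using y by simp
    ultimately show "\<exists>d. (g has_real_derivative d) (at y) \<and> 0 \<le> d" by blast
  qed
  then show ?thesis by (simp add: g_def)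
qed

text \<open>With u = \<alpha> / (\<alpha> - 1), log-convexity gives Gamma (u + 1/2) \<le> Gamma u *
  sqrt u. The Taylor bounds then put ln f at least 1 / (8 u) + 1 / (16 u^2) below ln f(1), so the
  limit value at 1 dominates this whole branch.\<close>

lemma bound_fun_ge_one:
  assumes "\<alpha> \<ge> 1"
  shows "bound_fun \<alpha> \<le> sqrt (2 * pi / exp 3)"
proof (cases "\<alpha> = 1")
  case True
  then show ?thesis by (simp add: bound_fun_def)
next
  case False
  with assms have \<alpha>: "\<alpha> > 1" by simp
  define u where "u = \<alpha> / (\<alpha> - 1)"
  have u: "u > 1" using \<alpha> by (simp add: u_def field_simps)
  have um: "u - 1 = 1 / (\<alpha> - 1)" using \<alpha> by (simp add: u_def field_simps)
  have alpha: "\<alpha> = u / (u - 1)" using \<alpha> by (simp add: um) (simp add: u_def)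
  have pos: "Gamma u > 0" "Gamma (u + 1 / 2) > 0" "Gamma (u + 1) > 0"
    using u by (auto intro!: Gamma_real_pos)
  have mid: "(1 - 1 / 2) *\<^sub>R u + (1 / 2) *\<^sub>R (u + 1) = u + 1 / 2"
    by (simp add: field_simps)
  have "(ln \<circ> Gamma) ((1 - 1 / 2) *\<^sub>R u + (1 / 2) *\<^sub>R (u + 1))
      \<le> (1 - 1 / 2) * (ln \<circ> Gamma) u + (1 / 2) * (ln \<circ> Gamma) (u + 1)"
    using u by (intro convex_onD[OF log_convex_Gamma_real]) auto
  then have "ln (Gamma (u + 1 / 2)) \<le> (1 - 1 / 2) * ln (Gamma u) + 1 / 2 * ln (Gamma (u + 1))"
    by (simp only: mid comp_def)
  moreover have "Gamma (u + 1) = u * Gamma u"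
    using u by (intro Gamma_plus1) (auto dest: nonpos_Ints_nonpos)
  then have "ln (Gamma (u + 1)) = ln u + ln (Gamma u)"
    using u pos by (simp add: ln_mult_pos)
  ultimately have gam: "ln (Gamma (u + 1 / 2)) \<le> ln (Gamma u) + ln u / 2"
    by argo
  have eqs: "1 / (1 - \<alpha>) = - (u - 1)" "3 * \<alpha> - 1 = 2 * (u + 1 / 2) / (u - 1)"
      "(3 * \<alpha> - 1) / 2 = (u + 1 / 2) / (u - 1)" "\<alpha> - 1 = 1 / (u - 1)"
    using u unfolding alpha by (auto simp: field_simps)
  have "bound_fun \<alpha> = 2 / \<alpha> * sqrt (pi / (3 * \<alpha> - 1)) *
      ((3 * \<alpha> - 1) / 2) powr (1 / (1 - \<alpha>)) * (sqrt (\<alpha> - 1) * Gamma (u + 1 / 2) / Gamma u)"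
    using \<alpha> unfolding bound_fun_def u_def by simp
  also have "\<dots> = 2 / (u / (u - 1)) * sqrt (pi / (2 * (u + 1 / 2) / (u - 1))) *
      ((u + 1 / 2) / (u - 1)) powr (- (u - 1)) * (sqrt (1 / (u - 1)) * Gamma (u + 1 / 2) / Gamma u)"
    by (subst eqs(3), subst eqs(2), subst eqs(4), subst eqs(1)) (simp only: alpha)
  finally have eq: "bound_fun \<alpha> = \<dots>" .
  have bpos: "bound_fun \<alpha> > 0"
    unfolding eq using u pos by auto
  have "ln (bound_fun \<alpha>) = ln (2 / (u / (u - 1))) + ln (sqrt (pi / (2 * (u + 1 / 2) / (u - 1)))) +
      ln (((u + 1 / 2) / (u - 1)) powr (- (u - 1))) + ln (sqrt (1 / (u - 1))) +
      ln (Gamma (u + 1 / 2)) - ln (Gamma u)"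
    unfolding eq using u pos pos[THEN less_imp_neq] by (simp add: ln_mult ln_div)
  also have "\<dots> = ln (2 * pi) / 2 + u * ln (u - 1) - (u - 1 / 2) * ln (u + 1 / 2) - ln u
      + ln (Gamma (u + 1 / 2)) - ln (Gamma u)"
  proof -
    have "ln (u * 2 - 2) = ln 2 + ln (u - 1)" "ln ((1 + u * 2) / 2) = ln (1 + u * 2) - ln 2"
      using u ln_mult_pos[of 2 "u - 1"] by (simp_all add: ln_div algebra_simps)
    note l = this
    show ?thesis
      using u by (simp add: ln_mult ln_div ln_sqrt ln_powr; simp add: field_simps; use l in linarith)
  qed
  also have "\<dots> \<le> ln (2 * pi) / 2 + u * ln (u - 1) - (u - 1 / 2) * ln (u + 1 / 2) - ln u / 2"
    using gam by simp
  also have "\<dots> = ln (2 * pi) / 2 + u * ln (1 - 1 / u) - (u - 1 / 2) * ln (1 + 1 / (2 * u))"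
  proof -
    have "u - 1 = u * (1 - 1 / u)" "u + 1 / 2 = u * (1 + 1 / (2 * u))"
      using u by (auto simp: field_simps)
    moreover have "ln (u * (1 - 1 / u)) = ln u + ln (1 - 1 / u)"
      "ln (u * (1 + 1 / (2 * u))) = ln u + ln (1 + 1 / (2 * u))"
      using u by (intro ln_mult_pos; simp add: add_pos_pos)+
    ultimately have "ln (u - 1) = ln u + ln (1 - 1 / u)" "ln (u + 1 / 2) = ln u + ln (1 + 1 / (2 * u))"
      by simp_all
    then show ?thesis by (simp only:) (simp add: algebra_simps)
  qed
  also have "\<dots> \<le> ln (2 * pi) / 2 + u * (- 1 / u - 1 / (2 * u\<^sup>2))
      - (u - 1 / 2) * (1 / (2 * u) - 1 / (8 * u\<^sup>2))"
  proof -
    have "ln (1 - 1 / u) \<le> - (1 / u) - (1 / u)\<^sup>2 / 2"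
      using ln_one_minus_le[of "1 / u"] u by (simp add: add_nonneg_nonneg power2_eq_square) (smt (verit) divide_nonneg_nonneg zero_le_power)
    then have "u * ln (1 - 1 / u) \<le> u * (- 1 / u - 1 / (2 * u\<^sup>2))"
      using u by (intro mult_left_mono) (auto simp: power_divide)
    moreover have "ln (1 + 1 / (2 * u)) \<ge> 1 / (2 * u) - (1 / (2 * u))\<^sup>2 / 2"
      using u by (intro ln_one_plus_ge) auto
    then have "(u - 1 / 2) * ln (1 + 1 / (2 * u)) \<ge> (u - 1 / 2) * (1 / (2 * u) - 1 / (8 * u\<^sup>2))"
      using u by (intro mult_left_mono) (auto simp: power_divide power_mult_distrib)
    ultimately show ?thesis by (intro diff_mono add_left_mono)
  qed
  also have "\<dots> = ln (2 * pi) / 2 - 3 / 2 - 1 / (8 * u) - 1 / (16 * u\<^sup>2)"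
    using u by (simp add: field_simps power2_eq_square)
  also have "\<dots> \<le> ln (2 * pi) / 2 - 3 / 2"
  proof -
    have "0 \<le> 1 / (8 * u)" "0 \<le> 1 / (16 * u\<^sup>2)" using u by simp_all
    then show ?thesis by linarith
  qed
  also have "\<dots> = ln (sqrt (2 * pi / exp 3))"
    by (simp add: ln_sqrt ln_div)
  finally show ?thesis
    using bpos by (subst (asm) ln_le_cancel_iff) auto
qed

section \<open>Rational bounds for differences of Digamma values\<close>

text \<open>A function that tends to 0 along a + n is the sum of its decrements over unit steps, so
  a comparison of decrements is a comparison of the functions. For the Digamma difference the
  decrement is rational.\<close>

lemma telescope_le:
  fixes f g :: "real \<Rightarrow> real"
  assumes step: "\<And>x. x \<ge> a \<Longrightarrow> f x - f (x + 1) \<le> g x - g (x + 1)"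
    and f: "(\<lambda>n. f (a + real n)) \<longlonglongrightarrow> 0" and g: "(\<lambda>n. g (a + real n)) \<longlonglongrightarrow> 0"
  shows "f a \<le> g a"
proof -
  have le: "f a - g a \<le> f (a + real n) - g (a + real n)" for n
  proof (induction n)
    case (Suc n)
    with step[of "a + real n"] show ?case by (simp add: add_ac)
  qed simp
  have "(\<lambda>n. f (a + real n) - g (a + real n)) \<longlonglongrightarrow> 0 - 0"
    using f g by (intro tendsto_diff)
  from LIMSEQ_le_const[OF this, of "f a - g a"] le show ?thesis by auto
qed

text \<open>By monotonicity the half step lies between 0 and the full step, which equals 1 / (s + n
  - 1).\<close>

lemma Digamma_half_step_tendsto:
  assumes "s > (1 :: real)"
  shows "(\<lambda>n. Digamma (s + real n) - Digamma (s + real n - 1 / 2)) \<longlonglongrightarrow> 0"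
proof (rule tendsto_sandwich)
  show "\<forall>\<^sub>F n in sequentially. 0 \<le> Digamma (s + real n) - Digamma (s + real n - 1 / 2)"
    using assms by (intro always_eventually allI) (auto intro!: Digamma_real_mono)
  have "Digamma (s + real n) - Digamma (s + real n - 1 / 2) \<le> 1 / (s + real n - 1)" for n
  proof -
    have "Digamma (s + real n) = Digamma (s + real n - 1) + 1 / (s + real n - 1)"
      using Digamma_plus1[of "s + real n - 1"] assms by simp
    moreover have "Digamma (s + real n - 1) \<le> Digamma (s + real n - 1 / 2)"
      using assms by (intro Digamma_real_mono) auto
    ultimately show ?thesis by simp
  qed
  then show "\<forall>\<^sub>F n in sequentially. Digamma (s + real n) - Digamma (s + real n - 1 / 2)
      \<le> 1 / (s + real n - 1)"
    by simp
  show "(\<lambda>n. 1 / (s + real n - 1)) \<longlonglongrightarrow> 0" by real_asymp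
qed simp

lemma Digamma_half_step:
  assumes "s > (1 / 2 :: real)"
  shows "(Digamma s - Digamma (s - 1 / 2)) - (Digamma (s + 1) - Digamma (s + 1 - 1 / 2))
    = 1 / (2 * s * (s - 1 / 2))"
proof -
  have "Digamma (s + 1) = Digamma s + 1 / s"
    using assms by (intro Digamma_plus1) auto
  moreover have "Digamma (s - 1 / 2 + 1) = Digamma (s - 1 / 2) + 1 / (s - 1 / 2)"
    using assms by (intro Digamma_plus1) auto
  moreover have "s - 1 / 2 + 1 = s + 1 - 1 / 2" by simp
  moreover have "1 / (s - 1 / 2) - 1 / s = 1 / (2 * s * (s - 1 / 2))"
    using assms by (simp add: divide_simps)
  ultimately show ?thesis by simp
qed

text \<open>
  The bounds are convergents of the continued fraction of the Laplace transform
  \<open>\<integral>\<^sub>0\<^sup>\<infinity> exp (-c t) / (2 cosh (t / 4)) dt\<close>, which is the difference of the Digamma values for \<open>c = s - 3/4\<close>.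
\<close>

lemma Digamma_half_upper:
  fixes s :: real
  assumes "s > 1"
  defines "c \<equiv> s - 3 / 4"
  shows "Digamma s - Digamma (s - 1 / 2) \<le> (8 * c\<^sup>2 + 2) / (c * (16 * c\<^sup>2 + 5))"
proof -
  define R :: "real \<Rightarrow> real" where "R c = (8 * c\<^sup>2 + 2) / (c * (16 * c\<^sup>2 + 5))" for c
  have "Digamma s - Digamma (s - 1 / 2) \<le> R (s - 3 / 4)"
  proof (rule telescope_le[where f = "\<lambda>s. Digamma s - Digamma (s - 1 / 2)" and g = "\<lambda>s. R (s - 3 / 4)"])
    fix x assume "x \<ge> s"
    define y where "y = x - 3 / 4"
    have y: "y > 0" "x = y + 3 / 4" using \<open>x \<ge> s\<close> assms by (auto simp: y_def)
    have "16 * y\<^sup>2 + 5 > 0" "16 * (y + 1)\<^sup>2 + 5 > 0"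
      by (auto intro: add_nonneg_pos)
    \<comment> \<open>Centred at y = x - 3/4, the Digamma decrement has the denominator 2 (y + 3/4)
      (y + 1/4). All powers of y cancel from the numerator of the comparison, and its sign is that
      of a constant.\<close>
    then have "R y - R (y + 1) - 1 / (2 * (y + 3 / 4) * (y + 1 / 4))
      = 126 / (y * (y + 1) * (16 * y\<^sup>2 + 5) * (16 * (y + 1)\<^sup>2 + 5) * ((4 * y + 3) * (4 * y + 1)))"
      using y(1) unfolding R_def
      by (simp add: divide_simps add_pos_pos less_imp_neq[THEN not_sym]) algebra
    also have "\<dots> \<ge> 0"
      using y(1) by (auto intro!: divide_nonneg_nonneg mult_nonneg_nonneg)
    finally have "1 / (2 * (y + 3 / 4) * (y + 1 / 4)) \<le> R y - R (y + 1)"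
      by simp
    then show "Digamma x - Digamma (x - 1 / 2) - (Digamma (x + 1) - Digamma (x + 1 - 1 / 2))
        \<le> R (x - 3 / 4) - R (x + 1 - 3 / 4)"
      using Digamma_half_step[of x] y by (simp add: algebra_simps)
  next
    show "(\<lambda>n. R (s + real n - 3 / 4)) \<longlonglongrightarrow> 0"
      unfolding R_def by real_asymp
  qed (rule Digamma_half_step_tendsto[OF assms(1)])
  then show ?thesis by (simp add: R_def c_def)
qed

text \<open>This is the fourth convergent, the upper bound being the third; they lie on opposite
  sides of the limit. The comparison of decrements again leaves a constant numerator, now
  negative.\<close>

lemma Digamma_half_lower:
  fixes s :: real
  assumes "s > 1"
  defines "c \<equiv> s - 3 / 4"
  shows "(128 * c ^ 3 + 104 * c) / (256 * c ^ 4 + 224 * c\<^sup>2 + 9) \<le> Digamma s - Digamma (s - 1 / 2)"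
proof -
  define R :: "real \<Rightarrow> real" where "R c = (128 * c ^ 3 + 104 * c) / (256 * c ^ 4 + 224 * c\<^sup>2 + 9)" for c
  have "R (s - 3 / 4) \<le> Digamma s - Digamma (s - 1 / 2)"
  proof (rule telescope_le[where g = "\<lambda>s. Digamma s - Digamma (s - 1 / 2)" and f = "\<lambda>s. R (s - 3 / 4)"])
    fix x assume "x \<ge> s"
    define y where "y = x - 3 / 4"
    have y: "y > 0" "x = y + 3 / 4" using \<open>x \<ge> s\<close> assms by (auto simp: y_def)
    have pos: "256 * z ^ 4 + 224 * z\<^sup>2 + 9 > 0" for z :: real
      by (intro add_nonneg_pos add_nonneg_nonneg) auto
    have "R y - R (y + 1) - 1 / (2 * (y + 3 / 4) * (y + 1 / 4))
      = - 41472 / ((256 * y ^ 4 + 224 * y\<^sup>2 + 9) * (256 * (y + 1) ^ 4 + 224 * (y + 1)\<^sup>2 + 9) * ((4 * y + 3) * (4 * y + 1)))"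
      using y(1) pos[of y] pos[of "y + 1"] unfolding R_def
      by (simp add: divide_simps add_pos_pos less_imp_neq[THEN not_sym]) algebra
    also have "\<dots> \<le> 0"
      using y(1) pos[of y] pos[of "y + 1"]
      by (intro divide_nonpos_nonneg mult_nonneg_nonneg) auto
    finally have "R y - R (y + 1) \<le> 1 / (2 * (y + 3 / 4) * (y + 1 / 4))"
      by simp
    then show "R (x - 3 / 4) - R (x + 1 - 3 / 4)
        \<le> Digamma x - Digamma (x - 1 / 2) - (Digamma (x + 1) - Digamma (x + 1 - 1 / 2))"
      using Digamma_half_step[of x] y by (simp add: algebra_simps)
  next
    show "(\<lambda>n. R (s + real n - 3 / 4)) \<longlonglongrightarrow> 0"
      unfolding R_def by real_asymp
  qed (rule Digamma_half_step_tendsto[OF assms(1)])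
  then show ?thesis by (simp add: R_def c_def)
qed


section \<open>The sign of the derivative on both sides of the maximum\<close>

definition log_bound_deriv :: "real \<Rightarrow> real" where
  "log_bound_deriv s = ln (1 - 3 / (2 * s)) + (s - 1 / 2) / (s - 3 / 2) - (s - 1) / s - 1 / (s - 1)
     + (Digamma s - Digamma (s - 1 / 2))"

lemma log_bound_has_deriv:
  assumes "s > 3 / 2"
  shows "(log_bound has_real_derivative log_bound_deriv s) (at s)"
proof -
  have "1 - 3 / (2 * s) = (s - 3 / 2) / s" using assms by (simp add: field_simps)
  then have ln: "ln (1 - 3 / (2 * s)) = ln (s - 3 / 2) - ln s" using assms by (simp add: ln_div)
  show ?thesis
    unfolding log_bound_def log_bound_deriv_def ln using assms
    by (auto intro!: derivative_eq_intros) 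
qed

text \<open>Either convergent of the continued fraction keeps the derivative decreasing on \<open>[2, 9/2]\<close>.\<close>

lemma rational_part_deriv_neg:
  fixes s :: real
  assumes "2 \<le> s" "s \<le> 9 / 2"
  defines "c \<equiv> s - 3 / 4"
  shows "3 / (2 * s * (s - 3 / 2)) - 1 / (s - 3 / 2)\<^sup>2 - 1 / s\<^sup>2 + 1 / (s - 1)\<^sup>2
    - 1 / (2 * c\<^sup>2) + 3 / (32 * c ^ 4) < 0" (is "?h < 0")
proof -
  define t where "t = s - 2"
  have t: "0 \<le> t" "t \<le> 5 / 2" and s: "s = t + 2" and c: "c = t + 5 / 4"
    using assms by (auto simp: t_def)
  \<comment> \<open>Expansion at s = 2 leaves negative coefficients in degrees 6 and 7 only. For t
    \<le> 5/2 these two terms are absorbed by those of degree 4 and 5.\<close>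
  define p where "p = 5079 + 24583 * t + 47574 * t\<^sup>2 + 45765 * t ^ 3 + 20830 * t ^ 4 + 1728 * t ^ 5
    - 1920 * t ^ 6 - 512 * t ^ 7"
  have "?h = - p / (1024 * (t + 2)\<^sup>2 * (t + 1 / 2)\<^sup>2 * (t + 1)\<^sup>2 * (t + 5 / 4) ^ 4)"
    using t(1) unfolding s c p_def
    by (simp add: divide_simps add_pos_pos less_imp_neq[THEN not_sym]) algebra
  moreover have "p > 0"
  proof -
    have sq: "t\<^sup>2 \<le> 25 / 4" using power_mono[OF t(2,1), of 2] by (simp add: power2_eq_square)
    have "t ^ 6 \<le> 25 / 4 * t ^ 4" "t ^ 7 \<le> 25 / 4 * t ^ 5"
      using mult_right_mono[OF sq, of "t ^ 4"] mult_right_mono[OF sq, of "t ^ 5"] t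
      by (simp_all flip: power_add)
    moreover have "t ^ 5 \<le> 5 / 2 * t ^ 4"
      using mult_right_mono[OF t(2), of "t ^ 4"] t by (simp flip: power_Suc)
    moreover have "t\<^sup>2 \<ge> 0" "t ^ 3 \<ge> 0" "t ^ 4 \<ge> 0" using t by auto
    ultimately show ?thesis unfolding p_def using t by linarith
  qed
  ultimately show ?thesis using t(1) by (simp add: divide_neg_pos)
qed


definition log_bound_upper :: "real \<Rightarrow> real" where
  "log_bound_upper s = ln (1 - 3 / (2 * s)) + (s - 1 / 2) / (s - 3 / 2) - (s - 1) / s - 1 / (s - 1)
     + (8 * (s - 3 / 4)\<^sup>2 + 2) / ((s - 3 / 4) * (16 * (s - 3 / 4)\<^sup>2 + 5))"

definition log_bound_lower :: "real \<Rightarrow> real" where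
  "log_bound_lower s = ln (1 - 3 / (2 * s)) + (s - 1 / 2) / (s - 3 / 2) - (s - 1) / s - 1 / (s - 1)
     + (128 * (s - 3 / 4) ^ 3 + 104 * (s - 3 / 4)) / (256 * (s - 3 / 4) ^ 4 + 224 * (s - 3 / 4)\<^sup>2 + 9)"

lemma log_bound_deriv_bounds:
  assumes "s \<ge> 2"
  shows "log_bound_lower s \<le> log_bound_deriv s" "log_bound_deriv s \<le> log_bound_upper s"
  using Digamma_half_upper[of s] Digamma_half_lower[of s] assms
  by (simp_all add: log_bound_lower_def log_bound_upper_def log_bound_deriv_def)

lemma rational_part_has_deriv:
  assumes "s > 3 / 2"
  shows "((\<lambda>s. ln (1 - 3 / (2 * s)) + (s - 1 / 2) / (s - 3 / 2) - (s - 1) / s - 1 / (s - 1))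
    has_real_derivative 3 / (2 * s * (s - 3 / 2)) - 1 / (s - 3 / 2)\<^sup>2 - 1 / s\<^sup>2 + 1 / (s - 1)\<^sup>2) (at s)"
proof -
  have "1 - 3 / (2 * s) > 0" using assms by (simp add: field_simps)
  moreover have "s * s * (1 - 3 / (2 * s)) = s * (s - 3 / 2)" using assms by (simp add: field_simps)
  ultimately show ?thesis
    using assms
    by (auto intro!: derivative_eq_intros simp: power2_eq_square) (simp add: divide_simps)
qed

text \<open>The derivative of the convergent lies below
  \<open>- 1 / (2 * c\<^sup>2) + 3 / (32 * c ^ 4)\<close>, the derivative of the first two terms 1 /
  (2 c) - 1 / (32 c^3) of its expansion at infinity. With this simpler majorant
  \<open>rational_part_deriv_neg\<close> gives the sign.\<close>

lemma log_bound_upper_strict_antimono: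
  assumes "2 \<le> s" "s < t" "t \<le> 9 / 2"
  shows "log_bound_upper t < log_bound_upper s"
proof (rule DERIV_neg_imp_decreasing[OF assms(2)])
  fix x assume "s \<le> x" "x \<le> t"
  then have x: "2 \<le> x" "x \<le> 9 / 2" using assms by auto
  define c where "c = x - 3 / 4"
  have c: "c > 0" using x by (simp add: c_def)
  define R :: "real \<Rightarrow> real" where "R c = (8 * c\<^sup>2 + 2) / (c * (16 * c\<^sup>2 + 5))" for c
  have shift: "((\<lambda>x. x - 3 / 4) has_real_derivative 1) (at x)"
    by (auto intro!: derivative_eq_intros)
  define d where "d = - (10 + 56 * c\<^sup>2 + 128 * c ^ 4) / (c * (16 * c\<^sup>2 + 5))\<^sup>2"
  have pos: "16 * c\<^sup>2 + 5 > 0" by (intro add_nonneg_pos) auto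
  have "(R has_real_derivative d) (at c)"
    unfolding R_def d_def using c pos
    by (auto intro!: derivative_eq_intros) (simp add: divide_simps power2_eq_square; algebra)
  then have "((\<lambda>x. R (x - 3 / 4)) has_real_derivative d) (at x)"
    using DERIV_chain2[of R d "\<lambda>x. x - 3 / 4" x 1 UNIV] shift unfolding c_def by simp
  from DERIV_add[OF rational_part_has_deriv this, of]
  have "(log_bound_upper has_real_derivative
     3 / (2 * x * (x - 3 / 2)) - 1 / (x - 3 / 2)\<^sup>2 - 1 / x\<^sup>2 + 1 / (x - 1)\<^sup>2 + d) (at x)"
    using x unfolding log_bound_upper_def R_def by simp
  moreover have "d - (- 1 / (2 * c\<^sup>2) + 3 / (32 * c ^ 4))
      = - (75 * c\<^sup>2 + 400 * c ^ 4) / (32 * c ^ 4 * (c * (16 * c\<^sup>2 + 5))\<^sup>2)"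
    unfolding d_def using c pos
    by (simp add: divide_simps) algebra
  moreover have "\<dots> \<le> 0"
  proof (intro divide_nonpos_nonneg)
    have "75 * c\<^sup>2 + 400 * c ^ 4 \<ge> 0"
      using c by (intro add_nonneg_nonneg mult_nonneg_nonneg zero_le_power) auto
    then show "- (75 * c\<^sup>2 + 400 * c ^ 4) \<le> 0"
      by linarith
  qed (use c in auto)
  ultimately show "\<exists>y. (log_bound_upper has_real_derivative y) (at x) \<and> y < 0"
    using rational_part_deriv_neg[OF x] unfolding c_def by (intro exI conjI) (assumption, simp)
qed

text \<open>The derivative of the fourth convergent has the same majorant as that of the third, so
  \<open>rational_part_deriv_neg\<close> serves both.\<close>

lemma log_bound_lower_strict_antimono:
  assumes "2 \<le> s" "s < t" "t \<le> 9 / 2"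
  shows "log_bound_lower t < log_bound_lower s"
proof (rule DERIV_neg_imp_decreasing[OF assms(2)])
  fix x assume "s \<le> x" "x \<le> t"
  then have x: "2 \<le> x" "x \<le> 9 / 2" using assms by auto
  define c where "c = x - 3 / 4"
  have c: "c > 0" using x by (simp add: c_def)
  define R :: "real \<Rightarrow> real" where "R c = (128 * c ^ 3 + 104 * c) / (256 * c ^ 4 + 224 * c\<^sup>2 + 9)" for c
  have shift: "((\<lambda>x. x - 3 / 4) has_real_derivative 1) (at x)"
    by (auto intro!: derivative_eq_intros)
  define d where "d = (936 - 19840 * c\<^sup>2 - 51200 * c ^ 4 - 32768 * c ^ 6) / (256 * c ^ 4 + 224 * c\<^sup>2 + 9)\<^sup>2"
  have pos: "256 * c ^ 4 + 224 * c\<^sup>2 + 9 > 0" by (intro add_nonneg_pos add_nonneg_nonneg) auto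
  have "(R has_real_derivative d) (at c)"
    unfolding R_def d_def using c pos
    by (auto intro!: derivative_eq_intros) (simp add: divide_simps power2_eq_square; algebra)
  then have "((\<lambda>x. R (x - 3 / 4)) has_real_derivative d) (at x)"
    using DERIV_chain2[of R d "\<lambda>x. x - 3 / 4" x 1 UNIV] shift unfolding c_def by simp
  from DERIV_add[OF rational_part_has_deriv this, of]
  have "(log_bound_lower has_real_derivative
     3 / (2 * x * (x - 3 / 2)) - 1 / (x - 3 / 2)\<^sup>2 - 1 / x\<^sup>2 + 1 / (x - 1)\<^sup>2 + d) (at x)"
    using x unfolding log_bound_lower_def R_def by simp
  moreover have "d - (- 1 / (2 * c\<^sup>2) + 3 / (32 * c ^ 4))
      = - (243 + 10800 * c\<^sup>2 + 69888 * c ^ 4 + 102400 * c ^ 6) / (32 * c ^ 4 * (256 * c ^ 4 + 224 * c\<^sup>2 + 9)\<^sup>2)"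
    unfolding d_def using c pos
    by (simp add: divide_simps) algebra
  moreover have "\<dots> \<le> 0"
  proof (intro divide_nonpos_nonneg)
    have "243 + 10800 * c\<^sup>2 + 69888 * c ^ 4 + 102400 * c ^ 6 \<ge> 0"
      using c by (intro add_nonneg_nonneg mult_nonneg_nonneg zero_le_power) auto
    then show "- (243 + 10800 * c\<^sup>2 + 69888 * c ^ 4 + 102400 * c ^ 6) \<le> 0"
      by linarith
  qed (use c in auto)
  ultimately show "\<exists>y. (log_bound_lower has_real_derivative y) (at x) \<and> y < 0"
    using rational_part_deriv_neg[OF x] unfolding c_def by (intro exI conjI) (assumption, simp)
qed

text \<open>Far out the first convergent 1 / (2 (s - 3/4)) and four Taylor terms of the logarithm
  are sharp enough. Expanded at s = 9/2, the numerator has coefficients of one sign.\<close>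

lemma log_bound_deriv_neg_far:
  assumes "s \<ge> 9 / 2"
  shows "log_bound_deriv s < 0"
proof -
  define t where "t = s - 9 / 2"
  have t: "t \<ge> 0" "s = t + 9 / 2" using assms by (auto simp: t_def)
  have "Digamma s - Digamma (s - 1 / 2) \<le> (8 * (s - 3 / 4)\<^sup>2 + 2) / ((s - 3 / 4) * (16 * (s - 3 / 4)\<^sup>2 + 5))"
    using assms by (intro Digamma_half_upper) auto
  also have "\<dots> \<le> 1 / (2 * s - 3 / 2)"
  proof -
    have "16 * (s - 3 / 4)\<^sup>2 + 5 > 0" by (intro add_nonneg_pos) auto
    with assms show ?thesis by (simp add: divide_simps) (simp add: algebra_simps power2_eq_square)
  qed
  finally have "log_bound_deriv s \<le> - (3 / (2 * s)) - (3 / (2 * s))\<^sup>2 / 2 - (3 / (2 * s)) ^ 3 / 3 - (3 / (2 * s)) ^ 4 / 4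
     + (s - 1 / 2) / (s - 3 / 2) - (s - 1) / s - 1 / (s - 1) + 1 / (2 * s - 3 / 2)"
    using ln_one_minus_le[of "3 / (2 * s)"] assms unfolding log_bound_deriv_def by simp
  also have "\<dots> = - (18954 + 110970 * t + 91692 * t\<^sup>2 + 30240 * t ^ 3 + 4512 * t ^ 4 + 256 * t ^ 5)
      / (512 * (s ^ 4 * (s - 3 / 2) * (s - 1) * (2 * s - 3 / 2)))"
    using t(1) unfolding t(2)
    by (simp add: divide_simps add_pos_pos less_imp_neq[THEN not_sym]) algebra
  also have "\<dots> < 0"
  proof (intro divide_neg_pos mult_pos_pos)
    have "18954 + 110970 * t + 91692 * t\<^sup>2 + 30240 * t ^ 3 + 4512 * t ^ 4 + 256 * t ^ 5 > 0"
      using t(1) by (intro add_pos_nonneg mult_nonneg_nonneg zero_le_power) auto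
    then show "- (18954 + 110970 * t + 91692 * t\<^sup>2 + 30240 * t ^ 3 + 4512 * t ^ 4 + 256 * t ^ 5) < 0"
      by linarith
  qed (use assms in auto)
  finally show ?thesis .
qed


section \<open>Numerical values near the maximum\<close>

text \<open>The arguments are 1 - 3 / (2 s) at s = 20000/5059, 20000/5057 and 4, which correspond to
  \<alpha> = 0.74705, 0.74715 and 3/4. They are inverted so that the approximated logarithm has an
  argument above 1.\<close>

lemma ln_24823: "ln (24823 / 40000 :: real) > -0.477110"
  and ln_24829: "ln (24829 / 40000 :: real) < -0.4768664"
  and ln_5_8: "ln (5 / 8 :: real) > -0.47001"
proof -
  have inv: "ln (x :: real) = - ln (1 / x)" if "x > 0" for x
    using that by (simp add: ln_div)
  show "ln (24823 / 40000 :: real) > -0.477110"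
    using ln_approx_bounds[of "40000 / 24823" 5] inv[of "24823 / 40000"]
    by (simp add: eval_nat_numeral)
  show "ln (24829 / 40000 :: real) < -0.4768664"
    using ln_approx_bounds[of "40000 / 24829" 5] inv[of "24829 / 40000"]
    by (simp add: eval_nat_numeral)
  show "ln (5 / 8 :: real) > -0.47001"
    using ln_approx_bounds[of "8 / 5" 4] inv[of "5 / 8"]
    by (simp add: eval_nat_numeral)
qed

lemma log_bound_lower_left: "log_bound_lower (20000 / 5059) > 0"
  using ln_24823 by (simp add: log_bound_lower_def field_simps eval_nat_numeral)

lemma log_bound_upper_right: "log_bound_upper (20000 / 5057) < 0"
  using ln_24829 by (simp add: log_bound_upper_def field_simps eval_nat_numeral)

text \<open>Since \<open>log_bound_lower\<close> decreases, its value at 4 bounds the slope of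
  \<open>log_bound\<close> from below all the way from the maximum to s = 4.\<close>

lemma log_bound_lower_four: "log_bound_lower 4 > - 7 / 10000"
  using ln_5_8 by (simp add: log_bound_lower_def field_simps eval_nat_numeral)


text \<open>At \<alpha> = 3/4 the Gamma quotient is Gamma 4 / Gamma (7/2) and \<pi> cancels, which
  leaves sqrt (4/5) * 125/192. The maximum is close enough for this value to fix four digits of
  it.\<close>

lemma bound_fun_three_quarters: "0.5823 \<le> bound_fun (3 / 4)" "bound_fun (3 / 4) \<le> 0.58231"
proof -
  have "Gamma (1 / 2 + 1 :: real) = 1 / 2 * Gamma (1 / 2)"
    by (intro Gamma_plus1) (auto dest: nonpos_Ints_nonpos)
  moreover have "Gamma (3 / 2 + 1 :: real) = 3 / 2 * Gamma (3 / 2)"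
    by (intro Gamma_plus1) (auto dest: nonpos_Ints_nonpos)
  moreover have "Gamma (5 / 2 + 1 :: real) = 5 / 2 * Gamma (5 / 2)"
    by (intro Gamma_plus1) (auto dest: nonpos_Ints_nonpos)
  ultimately have half: "Gamma (7 / 2 :: real) = 15 / 8 * sqrt pi"
    by (simp add: Gamma_one_half_real)
  have "Gamma (4 :: real) = 6"
    using Gamma_fact[of 3, where ?'a = real] by (simp add: eval_nat_numeral)
  then have "bound_fun (3 / 4) = 8 / 3 * sqrt (4 / 5) * (5 / 8) ^ 4 * (1 / 2 * 6 / (15 / 8))"
    by (simp add: bound_fun_def real_sqrt_divide real_sqrt_mult powr_numeral half)
  then have eq: "bound_fun (3 / 4) = sqrt (4 / 5) * (125 / 192)"
    by (simp add: eval_nat_numeral)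
  have "0.5823 * 192 / 125 \<le> sqrt (4 / 5)"
    by (rule real_le_rsqrt) (simp add: power2_eq_square)
  then show "0.5823 \<le> bound_fun (3 / 4)" unfolding eq by simp
  have "sqrt (4 / 5) \<le> 0.58231 * 192 / 125"
    by (rule real_le_lsqrt) (simp_all add: power2_eq_square)
  then show "bound_fun (3 / 4) \<le> 0.58231" unfolding eq by simp
qed

text \<open>The monotone bounds of the derivative need to be evaluated only at a and b: the
  derivative is positive from 2 to a and negative from b on. Compactness of [a, b] supplies the
  maximiser, and the value comes from the closed form at s = 4.\<close>

lemma bound_fun_maximum:
  obtains \<alpha> where "0.74705 \<le> \<alpha>" "\<alpha> \<le> 0.74715" "\<And>\<beta>. \<beta> \<ge> 1 / 2 \<Longrightarrow> bound_fun \<beta> \<le> bound_fun \<alpha>"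
    "0.5823 \<le> bound_fun \<alpha>" "bound_fun \<alpha> \<le> 0.58235"
proof -
  define a b :: real where "a = 20000 / 5059" and "b = 20000 / 5057"
  have ab: "2 \<le> a" "a \<le> b" "b \<le> 4" "4 - a \<le> 0.047" by (auto simp: a_def b_def)
  have "continuous_on {a..b} log_bound"
    using ab by (intro DERIV_continuous_on[where D = log_bound_deriv] log_bound_has_deriv[THEN has_field_derivative_at_within]) auto
  then obtain s0 where s0: "s0 \<in> {a..b}" "\<And>s. s \<in> {a..b} \<Longrightarrow> log_bound s \<le> log_bound s0"
    using continuous_attains_sup[of "{a..b}" log_bound] ab by auto
  have left: "log_bound s \<le> log_bound a" if "2 \<le> s" "s \<le> a" for s
  proof (rule DERIV_nonneg_imp_nondecreasing[OF that(2)])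
    fix x assume x: "s \<le> x" "x \<le> a"
    have "0 < log_bound_lower a" unfolding a_def by (rule log_bound_lower_left)
    also have "\<dots> \<le> log_bound_lower x"
      using log_bound_lower_strict_antimono[of x a] x that ab by (cases "x = a") auto
    also have "\<dots> \<le> log_bound_deriv x" using x that by (intro log_bound_deriv_bounds) auto
    finally show "\<exists>y. (log_bound has_real_derivative y) (at x) \<and> 0 \<le> y"
      using log_bound_has_deriv[of x] x that by (intro exI conjI) auto
  qed
  have right: "log_bound s \<le> log_bound b" if "b \<le> s" for s
  proof (rule DERIV_nonpos_imp_nonincreasing[OF that])
    fix x assume x: "b \<le> x" "x \<le> s"
    have "log_bound_deriv x < 0"
    proof (cases "x \<le> 9 / 2")
      case True
      have "log_bound_deriv x \<le> log_bound_upper x" using x ab by (intro log_bound_deriv_bounds) auto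
      also have "\<dots> \<le> log_bound_upper b"
        using log_bound_upper_strict_antimono[of b x] x ab True by (cases "x = b") auto
      also have "\<dots> < 0" unfolding b_def by (rule log_bound_upper_right)
      finally show ?thesis .
    qed (use log_bound_deriv_neg_far in auto)
    then show "\<exists>y. (log_bound has_real_derivative y) (at x) \<and> y \<le> 0"
      using log_bound_has_deriv[of x] x ab by (intro exI conjI) auto
  qed
  have le_s0: "log_bound s \<le> log_bound s0" if "2 \<le> s" for s
    using left[of s] right[of s] s0(2)[of s] s0(2)[of a] s0(2)[of b] ab that by force
  \<comment> \<open>The slope is above -7/10000 between s0 and 4, and this interval has length at
    most 0.047, so ln f loses at most 0.000033 between the maximum and \<alpha> = 3/4.\<close>
  have "log_bound s0 + 7 / 10000 * s0 \<le> log_bound 4 + 7 / 10000 * 4"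
  proof (rule DERIV_nonneg_imp_nondecreasing[of s0 4])
    fix x assume x: "s0 \<le> x" "x \<le> 4"
    then have "2 \<le> x" using s0 ab by auto
    have "- 7 / 10000 < log_bound_lower 4" by (rule log_bound_lower_four)
    also have "\<dots> \<le> log_bound_lower x"
      using log_bound_lower_strict_antimono[of x 4] x \<open>2 \<le> x\<close> by (cases "x = 4") auto
    also have "\<dots> \<le> log_bound_deriv x" using \<open>2 \<le> x\<close> by (intro log_bound_deriv_bounds) auto
    finally show "\<exists>y. ((\<lambda>x. log_bound x + 7 / 10000 * x) has_real_derivative y) (at x) \<and> 0 \<le> y"
      using log_bound_has_deriv[of x] \<open>2 \<le> x\<close>
      by (intro exI[of _ "log_bound_deriv x + 7 / 10000"] conjI) (auto intro!: derivative_eq_intros)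
  qed (use s0 ab in auto)
  then have le4: "log_bound s0 \<le> log_bound 4 + 0.000033"
    using s0 ab by auto
  define \<alpha> where "\<alpha> = 1 - 1 / s0"
  have s0_pos: "s0 \<ge> 2" using s0 ab by auto
  have f_alpha: "bound_fun \<alpha> = exp (log_bound s0)"
    unfolding \<alpha>_def using s0_pos by (rule bound_fun_less_one)
  have f34: "bound_fun (3 / 4) = exp (log_bound 4)"
    using bound_fun_less_one[of 4] by simp
  have lt1: "bound_fun \<beta> \<le> bound_fun \<alpha>" if "1 / 2 \<le> \<beta>" "\<beta> < 1" for \<beta>
  proof -
    have "bound_fun (1 - 1 / (1 / (1 - \<beta>))) = exp (log_bound (1 / (1 - \<beta>)))"
      using that by (intro bound_fun_less_one) (simp add: field_simps)
    then have "bound_fun \<beta> = exp (log_bound (1 / (1 - \<beta>)))" by simp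
    with le_s0[of "1 / (1 - \<beta>)"] that show ?thesis by (simp add: f_alpha field_simps)
  qed
  \<comment> \<open>No s corresponds to \<alpha> = 1. The inequality passes to the limit from the
    left, and the value at 1 in turn dominates all \<alpha> \<ge> 1.\<close>
  have "bound_fun 1 \<le> bound_fun \<alpha>"
  proof (rule tendsto_upperbound)
    show "(bound_fun \<longlongrightarrow> bound_fun 1) (at_left 1)"
      using bound_fun_tendsto by (simp add: filterlim_at_split)
    show "\<forall>\<^sub>F \<beta> in at_left 1. bound_fun \<beta> \<le> bound_fun \<alpha>"
      using eventually_at_left_real[of "1 / 2" "1 :: real"]
      by (auto elim!: eventually_mono intro: lt1)
  qed simp
  moreover have "bound_fun 1 = sqrt (2 * pi / exp 3)" by (simp add: bound_fun_def)
  ultimately have ge1: "bound_fun \<beta> \<le> bound_fun \<alpha>" if "\<beta> \<ge> 1" for \<beta>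
    using bound_fun_ge_one[OF that] by simp
  show thesis
  proof (rule that[of \<alpha>])
    have "1 / b \<le> 1 / s0" "1 / s0 \<le> 1 / a" using s0 ab by (auto intro!: divide_left_mono)
    then show "0.74705 \<le> \<alpha>" "\<alpha> \<le> 0.74715" by (auto simp: \<alpha>_def a_def b_def)
    show "bound_fun \<beta> \<le> bound_fun \<alpha>" if "\<beta> \<ge> 1 / 2" for \<beta>
      using lt1[of \<beta>] ge1[of \<beta>] that by force
    show "0.5823 \<le> bound_fun \<alpha>"
      using bound_fun_three_quarters(1) lt1[of "3 / 4"] by simp
    have "exp (- 0.000033 :: real) \<ge> 1 + (- 0.000033)" by (rule exp_ge_add_one_self)
    then have "bound_fun \<alpha> * 0.999967 \<le> bound_fun \<alpha> * exp (- 0.000033)"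
      unfolding f_alpha by (intro mult_left_mono) auto
    also have "\<dots> \<le> bound_fun (3 / 4)"
      unfolding f_alpha f34 exp_add[symmetric] using le4 by simp
    finally show "bound_fun \<alpha> \<le> 0.58235" using bound_fun_three_quarters(2) by simp
  qed
qed

lemma f_max_facts:
  obtains \<alpha> where "0.74705 \<le> \<alpha>" "\<alpha> \<le> 0.74715" "bound_fun \<alpha> = f_max"
    "\<And>\<beta>. \<beta> \<ge> 1 / 2 \<Longrightarrow> bound_fun \<beta> \<le> f_max" "0.5823 \<le> f_max" "f_max \<le> 0.58235"
proof -
  obtain \<alpha> where \<alpha>: "0.74705 \<le> \<alpha>" "\<alpha> \<le> 0.74715" "\<And>\<beta>. \<beta> \<ge> 1 / 2 \<Longrightarrow> bound_fun \<beta> \<le> bound_fun \<alpha>"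
    "0.5823 \<le> bound_fun \<alpha>" "bound_fun \<alpha> \<le> 0.58235"
    using bound_fun_maximum by metis
  moreover have "f_max = bound_fun \<alpha>"
    unfolding f_max_def using \<alpha> by (intro Greatest_equality) auto
  ultimately show thesis using that by metis
qed

section \<open>Sesquilinear forms\<close>

lemma coeff_add [simp]: "coeff (x + y) n = coeff x n + coeff y n"
  by (simp add: plus_fock.rep_eq)

lemma coeff_scaleC [simp]: "coeff (scaleC c x) n = c * coeff x n"
  by (simp add: scaleC.rep_eq)

lemma cinner_add_right: "cinner x (y + z) = cinner x y + cinner x z"
  unfolding cinner_def
  by (subst suminf_add[OF summable_cinner summable_cinner]) (simp add: algebra_simps)

lemma cinner_scaleC_right: "cinner x (scaleC c y) = c * cinner x y"
  unfolding cinner_def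
  by (subst suminf_mult[OF summable_cinner, symmetric]) (simp add: algebra_simps)

lemma cinner_commute: "cinner y x = cnj (cinner x y)"
proof -
  have "(\<lambda>n. cnj (cnj (coeff x n) * coeff y n)) sums cnj (cinner x y)"
    unfolding cinner_def sums_cnj by (rule summable_sums[OF summable_cinner])
  then show ?thesis
    by (auto simp: cinner_def sums_iff mult.commute)
qed

lemma cinner_add_left: "cinner (x + y) z = cinner x z + cinner y z"
  by (metis cinner_add_right cinner_commute complex_cnj_add)

lemma cinner_scaleC_left: "cinner (scaleC c x) z = cnj c * cinner x z"
  by (metis cinner_scaleC_right cinner_commute complex_cnj_mult)

lemma cinner_self: "cinner x x = of_real ((norm x)\<^sup>2)"
proof -
  have "Im (cinner x x) = 0" using cinner_commute[of x x] by (metis complex_cnj_cancel_iff cnj.simps(2) neg_equal_zero)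
  moreover have "Re (cinner x x) = (norm x)\<^sup>2"
    using power2_norm_eq_inner[of x] by (simp add: inner_fock_def)
  ultimately show ?thesis by (simp add: complex_eq_iff)
qed

lemma norm_sums: "(\<lambda>n. (cmod (coeff x n))\<^sup>2) sums (norm x)\<^sup>2"
proof -
  have "(\<lambda>n. cnj (coeff x n) * coeff x n) sums cinner x x"
    unfolding cinner_def by (rule summable_sums[OF summable_cinner])
  from sums_Re[OF this] show ?thesis
    unfolding cmod_power2 by (simp add: cinner_self power2_eq_square)
qed

text \<open>Schur complements are produced as forms rather than as operators, hence the abstraction.
  Linearity is required in the second argument; antilinearity in the first follows from Hermitian
  symmetry.\<close>

definition positive_form :: "(fock \<Rightarrow> fock \<Rightarrow> complex) \<Rightarrow> bool" where
  "positive_form f \<longleftrightarrow> (\<forall>x y z. f x (y + z) = f x y + f x z) \<and> (\<forall>x c y. f x (scaleC c y) = c * f x y) \<and>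
     (\<forall>x y. f y x = cnj (f x y)) \<and> (\<forall>x. 0 \<le> Re (f x x))"

lemma positive_formD:
  assumes "positive_form f"
  shows "f x (y + z) = f x y + f x z" "f x (scaleC c y) = c * f x y" "f y x = cnj (f x y)"
    "0 \<le> Re (f x x)" "Im (f x x) = 0" "f (y + z) x = f y x + f z x" "f (scaleC c y) x = cnj c * f y x"
proof -
  have D: "\<And>x y z. f x (y + z) = f x y + f x z" "\<And>x c y. f x (scaleC c y) = c * f x y"
    "\<And>x y. f y x = cnj (f x y)" "\<And>x. 0 \<le> Re (f x x)"
    using assms unfolding positive_form_def by blast+
  show "f x (y + z) = f x y + f x z" "f x (scaleC c y) = c * f x y" "f y x = cnj (f x y)"
    "0 \<le> Re (f x x)" by (fact D)+
  show "Im (f x x) = 0" using D(3)[of x x] by (metis cnj.simps(2) neg_equal_zero)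
  show "f (y + z) x = f y x + f z x" "f (scaleC c y) x = cnj c * f y x"
    unfolding D(3)[of "y + z" x] D(3)[of "scaleC c y" x] D(3)[of y x] D(3)[of z x] D(1,2) by simp_all
qed

lemma positive_form_expand:
  assumes "positive_form f"
  shows "Re (f (x + scaleC c y) (x + scaleC c y))
    = Re (f x x) + 2 * Re (c * f x y) + (cmod c)\<^sup>2 * Re (f y y)"
proof -
  note D = positive_formD[OF assms]
  have "f (x + scaleC c y) (x + scaleC c y)
    = f x x + c * f x y + cnj (c * f x y) + (c * cnj c) * f y y"
  proof -
    have sym: "f y x = cnj (f x y)" by (rule D(3))
    show ?thesis unfolding D(1,2,6,7) sym by (simp add: algebra_simps)
  qed
  then show ?thesis
    by (simp add: complex_norm_square[symmetric] D(5))
qed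

lemma positive_form_cauchy_schwarz:
  assumes "positive_form f"
  shows "(cmod (f x y))\<^sup>2 \<le> Re (f x x) * Re (f y y)"
proof -
  note D = positive_formD[OF assms]
  define w where "w = f x y"
  have quad: "0 \<le> Re (f x x) - 2 * t * (cmod w)\<^sup>2 + t\<^sup>2 * (cmod w)\<^sup>2 * Re (f y y)" for t :: real
  proof -
    have "Re (of_real (- t) * cnj w * w) = - t * (cmod w)\<^sup>2"
      unfolding cmod_power2 by (simp add: power2_eq_square algebra_simps)
    moreover have "(cmod (of_real (- t) * cnj w))\<^sup>2 = t\<^sup>2 * (cmod w)\<^sup>2"
      by (simp add: norm_mult power_mult_distrib)
    moreover have "0 \<le> Re (f (x + scaleC (of_real (- t) * cnj w) y) (x + scaleC (of_real (- t) * cnj w) y))"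
      by (rule D(4))
    ultimately show ?thesis
      unfolding positive_form_expand[OF assms] w_def[symmetric] by (simp add: algebra_simps)
  qed
  show ?thesis
  proof (cases "Re (f y y) = 0")
    case True
    have "w = 0"
    proof (rule ccontr)
      assume "w \<noteq> 0"
      \<comment> \<open>If \<open>f y y\<close> vanishes, the quadratic polynomial is affine in t
        and equals -1 at this t.\<close>
      then have "2 * ((Re (f x x) + 1) / (2 * (cmod w)\<^sup>2)) * (cmod w)\<^sup>2 = Re (f x x) + 1"
        by simp
      with quad[of "(Re (f x x) + 1) / (2 * (cmod w)\<^sup>2)"] True show False by simp
    qed
    then show ?thesis using D(4)[of x] D(4)[of y] by (simp add: w_def)
  next
    case False
    with D(4)[of y] have pos: "Re (f y y) > 0" by simp
    then show ?thesis
      using quad[of "1 / Re (f y y)"] by (simp add: w_def[symmetric] power2_eq_square field_simps)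
  qed
qed

text \<open>Unlike the Cauchy-Schwarz inequality, this form is linear in the diagonal values and can
  be integrated over outcomes. The parameter s later becomes the ratio of neighbouring
  weights.\<close>

lemma positive_form_young:
  assumes "positive_form f" "s > 0"
  shows "2 * cmod (f x y) \<le> s * Re (f x x) + Re (f y y) / s"
proof -
  note D = positive_formD[OF assms(1)]
  have "cmod (f x y) \<le> sqrt (s * Re (f x x)) * sqrt (Re (f y y) / s)"
    using real_sqrt_le_mono[OF positive_form_cauchy_schwarz[OF assms(1), of x y]] assms(2)
    by (simp add: real_sqrt_mult real_sqrt_divide)
  also have "2 * \<dots> \<le> (sqrt (s * Re (f x x)))\<^sup>2 + (sqrt (Re (f y y) / s))\<^sup>2"
    using sum_squares_bound[of "sqrt (s * Re (f x x))" "sqrt (Re (f y y) / s)"] by simp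
  finally show ?thesis using assms(2) D(4)[of x] D(4)[of y] by simp
qed

text \<open>Hermitian symmetry follows by polarisation: a real quadratic form at x + y settles the
  imaginary parts, and at x + \<i> y the real parts.\<close>

lemma positive_operator_form:
  assumes "positive_operator A"
  shows "positive_form (\<lambda>x y. cinner x (A y))"
proof -
  have lin: "bounded_linear A" "\<And>c x. A (scaleC c x) = scaleC c (A x)"
    and pos: "\<And>x. Im (cinner x (A x)) = 0" "\<And>x. 0 \<le> Re (cinner x (A x))"
    using assms unfolding positive_operator_def bounded_operator_def by auto
  note add = linear_add[OF bounded_linear.linear[OF lin(1)]]
  note cadd = cinner_add_left cinner_scaleC_left
  have "cinner y (A x) = cnj (cinner x (A y))" for x y
  proof -
    have "Im (cinner x (A y)) + Im (cinner y (A x)) = 0"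
      using pos(1)[of "x + y"] pos(1)[of x] pos(1)[of y]
      by (simp add: add cinner_add_right cadd)
    moreover have "Re (cinner x (A y)) - Re (cinner y (A x)) = 0"
      using pos(1)[of "x + scaleC \<i> y"] pos(1)[of x] pos(1)[of y]
      by (simp add: add lin cinner_add_right cinner_scaleC_right cadd)
    ultimately show ?thesis by (simp add: complex_eq_iff)
  qed
  moreover have "cinner x (A (y + z)) = cinner x (A y) + cinner x (A z)"
    "cinner x (A (scaleC c y)) = c * cinner x (A y)" for x y z c
    by (simp_all add: add lin cinner_add_right cinner_scaleC_right)
  ultimately show ?thesis
    unfolding positive_form_def using pos(2) by blast
qed

lemma positive_operator_id: "positive_operator (id :: fock \<Rightarrow> fock)"
  unfolding positive_operator_def bounded_operator_def
  by (simp add: cinner_self bounded_linear_ident id_def)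

text \<open>Symmetry moves the operator to the number state. The action of A is then expressed by
  its matrix entries without exchanging A with an infinite sum.\<close>

lemma coeff_positive_operator:
  assumes "positive_operator A"
  shows "coeff (A y) m = cnj (\<Sum>n. cnj (coeff y n) * coeff (A (ket m)) n)"
proof -
  have "coeff (A y) m = cnj (cinner y (A (ket m)))"
    using positive_formD(3)[OF positive_operator_form[OF assms], of "ket m" y] by (simp only: cinner_ket)
  then show ?thesis by (simp only: cinner_def)
qed

section \<open>Decomposition of the state\<close>

text \<open>The Schur complement; for \<open>f e e = 0\<close> the correction vanishes by Cauchy-Schwarz, in accordance with \<open>x / 0 = 0\<close>.\<close>

definition schur :: "fock \<Rightarrow> (fock \<Rightarrow> fock \<Rightarrow> complex) \<Rightarrow> fock \<Rightarrow> fock \<Rightarrow> complex" where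
  "schur e f x y = f x y - f x e * f e y / f e e"

lemma positive_form_schur:
  assumes "positive_form f"
  shows "positive_form (schur e f)"
proof -
  note D = positive_formD[OF assms]
  have real: "f e e = of_real (Re (f e e))" by (rule complex_eqI) (simp_all add: D(5))
  have "0 \<le> Re (schur e f x x)" for x
  proof -
    have "f x e * f e x = of_real ((cmod (f x e))\<^sup>2)"
    proof -
      have sym: "f e x = cnj (f x e)" by (rule D(3))
      show ?thesis unfolding sym by (simp add: complex_norm_square[symmetric])
    qed
    then have "Re (f x e * f e x / f e e) = (cmod (f x e))\<^sup>2 / Re (f e e)"
      by (subst real) simp
    also have "\<dots> \<le> Re (f x x)"
      using positive_form_cauchy_schwarz[OF assms, of x e] D(4)[of e] D(4)[of x]
      by (cases "Re (f e e) = 0") (auto simp: divide_le_eq)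
    finally show ?thesis by (simp add: schur_def)
  qed
  moreover have "schur e f y x = cnj (schur e f x y)" for x y
  proof -
    have sym: "f y x = cnj (f x y)" "f y e = cnj (f e y)" "f e x = cnj (f x e)" by (rule D(3))+
    have "cnj (f e e) = f e e" by (subst (1 2) real) simp
    then show ?thesis unfolding schur_def sym by (simp add: mult.commute)
  qed
  moreover have "schur e f x (y + z) = schur e f x y + schur e f x z"
    "schur e f x (scaleC c y) = c * schur e f x y" for x y z c
    by (simp_all add: schur_def D(1,2) algebra_simps add_divide_distrib)
  ultimately show ?thesis
    unfolding positive_form_def by blast
qed

lemma schur_same:
  assumes "positive_form f"
  shows "schur e f e y = 0"
proof (cases "f e e = 0")
  case True
  then have "f e y = 0" using positive_form_cauchy_schwarz[OF assms, of e y] by simp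
  then show ?thesis using True by (simp add: schur_def)
qed (simp add: schur_def)

fun schur_iter :: "(fock \<Rightarrow> fock \<Rightarrow> complex) \<Rightarrow> nat \<Rightarrow> fock \<Rightarrow> fock \<Rightarrow> complex" where
  "schur_iter f 0 = f"
| "schur_iter f (Suc k) = schur (ket k) (schur_iter f k)"

lemma positive_form_schur_iter: "positive_form f \<Longrightarrow> positive_form (schur_iter f k)"
  by (induction k) (auto intro: positive_form_schur)

lemma schur_iter_ket:
  assumes "positive_form f" "m < k"
  shows "schur_iter f k (ket m) y = 0"
  using assms(2)
proof (induction k arbitrary: y)
  case (Suc k)
  show ?case
  proof (cases "m = k")
    case True
    then show ?thesis using schur_same[OF positive_form_schur_iter[OF assms(1)]] by simp
  next
    case False
    with Suc.prems have "m < k" by simp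
    with Suc.IH show ?thesis by (simp add: schur_def)
  qed
qed simp

definition cholesky :: "(fock \<Rightarrow> fock \<Rightarrow> complex) \<Rightarrow> nat \<Rightarrow> fock \<Rightarrow> complex" where
  "cholesky f k x = schur_iter f k x (ket k) / of_real (sqrt (Re (schur_iter f k (ket k) (ket k))))"

text \<open>Each Schur complement splits off one rank-one term, so the identity is exact for every
  K; for a zero pivot both quotients are 0. At number states below K the remainder vanishes and no
  limit is involved.\<close>

lemma cholesky_sum:
  assumes "positive_form f"
  shows "f x y = (\<Sum>k<K. cholesky f k x * cnj (cholesky f k y)) + schur_iter f K x y"
proof (induction K)
  case (Suc K)
  define g where "g = schur_iter f K"
  have g: "positive_form g" unfolding g_def by (rule positive_form_schur_iter[OF assms])
  note D = positive_formD[OF g]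
  have real: "g (ket K) (ket K) = of_real (Re (g (ket K) (ket K)))"
    by (rule complex_eqI) (simp_all add: D(5))
  define r where "r = Re (g (ket K) (ket K))"
  have r: "g (ket K) (ket K) = of_real r" "r \<ge> 0"
    using real D(4) unfolding r_def by blast+
  have sym: "cnj (g y (ket K)) = g (ket K) y" by (rule D(3)[symmetric])
  have "cholesky f K x * cnj (cholesky f K y) = g x (ket K) * cnj (g y (ket K)) / of_real ((sqrt r)\<^sup>2)"
    unfolding cholesky_def g_def[symmetric] r_def[symmetric] power2_eq_square of_real_mult
      complex_cnj_divide complex_cnj_complex_of_real by (simp only: times_divide_times_eq)
  also have "\<dots> = g x (ket K) * g (ket K) y / g (ket K) (ket K)"
    using r(2) by (simp add: sym r(1))
  finally have "schur_iter f K x y = cholesky f K x * cnj (cholesky f K y) + schur_iter f (Suc K) x y"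
    by (simp add: schur_def g_def)
  with Suc.IH show ?case by (simp del: schur_iter.simps add: add.assoc)
qed simp

text \<open>This triangularity keeps every sum over k at a fixed matrix entry finite, which a
  spectral decomposition would not do.\<close>

lemma cholesky_ket:
  assumes "positive_form f" "m < k"
  shows "cholesky f k (ket m) = 0"
  using schur_iter_ket[OF assms] by (simp add: cholesky_def)

lemma photon_prob_sums:
  assumes "density_operator \<rho>"
  shows "photon_prob \<rho> sums 1" "0 \<le> photon_prob \<rho> n" "coeff (\<rho> (ket n)) n = of_real (photon_prob \<rho> n)"
proof -
  have pos: "positive_operator \<rho>" and tr: "op_trace \<rho> = 1"
    using assms unfolding density_operator_def by auto
  note D = positive_formD[OF positive_operator_form[OF pos]]
  show nn: "0 \<le> photon_prob \<rho> n" for n unfolding photon_prob_def by (rule D(4))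
  have eq: "cinner (ket n) (\<rho> (ket n)) = of_real (photon_prob \<rho> n)" for n
    using D(5)[of "ket n"] by (simp add: photon_prob_def complex_eq_iff)
  then show "coeff (\<rho> (ket n)) n = of_real (photon_prob \<rho> n)" by (simp add: cinner_ket)
  have "(\<lambda>n. complex_of_real (photon_prob \<rho> n)) summable_on UNIV"
    using tr unfolding op_trace_def eq by (metis infsum_not_exists zero_neq_one)
  then have "((\<lambda>n. complex_of_real (photon_prob \<rho> n)) has_sum 1) UNIV"
    using tr unfolding op_trace_def eq by (metis has_sum_infsum)
  from has_sum_imp_sums[OF this] have "(\<lambda>n. complex_of_real (photon_prob \<rho> n)) sums of_real 1" by simp
  then show "photon_prob \<rho> sums 1" unfolding sums_of_real_iff .
qed

text \<open>The rank-one decomposition is stated entrywise. Since l_k vanishes below k, the sum for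
  row m stops at k = m, and the definition involves no convergence.\<close>

definition state_decomp :: "(fock \<Rightarrow> fock) \<Rightarrow> (nat \<Rightarrow> fock) \<Rightarrow> bool" where
  "state_decomp \<rho> l \<longleftrightarrow> (\<forall>k n. n < k \<longrightarrow> coeff (l k) n = 0) \<and>
     (\<forall>m n. coeff (\<rho> (ket n)) m = (\<Sum>k\<le>m. coeff (l k) m * cnj (coeff (l k) n)))"

text \<open>The factors are vectors of the space because each squared entry is one nonnegative
  summand of the corresponding photon probability, and these are summable.\<close>

lemma state_decomp_exists:
  assumes "density_operator \<rho>"
  obtains l where "state_decomp \<rho> l"
proof -
  define f where "f = (\<lambda>x y. cinner x (\<rho> y))"
  have f: "positive_form f"
    using assms unfolding f_def density_operator_def by (intro positive_operator_form) auto
  have le: "(cmod (cholesky f k (ket n)))\<^sup>2 \<le> photon_prob \<rho> n" for k n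
  proof -
    have "photon_prob \<rho> n = Re (f (ket n) (ket n))"
      by (simp add: f_def photon_prob_def)
    also have "\<dots> = (\<Sum>j<Suc k. (cmod (cholesky f j (ket n)))\<^sup>2) + Re (schur_iter f (Suc k) (ket n) (ket n))"
      by (subst cholesky_sum[OF f, of _ _ "Suc k"]) (simp add: complex_norm_square[symmetric])
    also have "\<dots> \<ge> (cmod (cholesky f k (ket n)))\<^sup>2 + 0"
      by (intro add_mono positive_formD[OF positive_form_schur_iter[OF f]])
         (auto intro!: sum_nonneg)
    finally show ?thesis by simp
  qed
  have "summable (\<lambda>n. (cmod (cholesky f k (ket n)))\<^sup>2)" for k
    by (rule summable_comparison_test'[OF sums_summable[OF photon_prob_sums(1)[OF assms]], of 0]) (use le in auto)
  then have coeff: "coeff (Abs_fock (\<lambda>n. cholesky f k (ket n))) n = cholesky f k (ket n)" for k n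
    by (simp add: Abs_fock_inverse)
  have "coeff (\<rho> (ket n)) m = (\<Sum>k\<le>m. cholesky f k (ket m) * cnj (cholesky f k (ket n)))" for m n
  proof -
    have "coeff (\<rho> (ket n)) m = f (ket m) (ket n)" by (simp add: f_def cinner_ket)
    then show ?thesis
      using cholesky_sum[OF f, of "ket m" "ket n" "Suc m"] schur_iter_ket[OF f, of m "Suc m" "ket n"]
      by (simp add: lessThan_Suc_atMost)
  qed
  then have "state_decomp \<rho> (\<lambda>k. Abs_fock (\<lambda>n. cholesky f k (ket n)))"
    unfolding state_decomp_def coeff using cholesky_ket[OF f] by auto
  then show thesis by (rule that)
qed


section \<open>Phase shifts and the trace formula\<close>

lemma summable_phase: "summable (\<lambda>n. (cmod (exp (- (\<i> * of_nat n * of_real \<theta>)) * coeff x n))\<^sup>2)"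
  using summable_coeff[of x] by (simp add: norm_mult)

lemma coeff_phase_shift: "coeff (phase_shift \<theta> x) n = cis (- (real n * \<theta>)) * coeff x n"
proof -
  have "coeff (phase_shift \<theta> x) n = exp (- (\<i> * of_nat n * of_real \<theta>)) * coeff x n"
    using summable_phase[of \<theta> x] by (simp add: phase_shift_def number_fun_def Abs_fock_inverse)
  then show ?thesis by (simp add: cis_conv_exp mult.assoc)
qed

lemma norm_phase_shift [simp]: "norm (phase_shift \<theta> x) = norm x"
proof -
  have "(\<lambda>n. (cmod (coeff (phase_shift \<theta> x) n))\<^sup>2) = (\<lambda>n. (cmod (coeff x n))\<^sup>2)"
    by (simp add: coeff_phase_shift norm_mult)
  with norm_sums[of "phase_shift \<theta> x"] norm_sums[of x] have "(norm (phase_shift \<theta> x))\<^sup>2 = (norm x)\<^sup>2"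
    by (metis sums_unique2)
  then show ?thesis by simp
qed

lemma cinner_phase_shift: "cinner x (phase_shift (- \<theta>) y) = cinner (phase_shift \<theta> x) y"
  unfolding cinner_def by (simp add: coeff_phase_shift cis_cnj mult_ac)

lemma state_decompD:
  assumes "state_decomp \<rho> l" "density_operator \<rho>"
  shows "n < k \<Longrightarrow> coeff (l k) n = 0"
    and "coeff (\<rho> y) n = (\<Sum>k\<le>n. coeff (l k) n * cinner (l k) y)"
    and "(\<lambda>k. (cmod (coeff (l k) n))\<^sup>2) sums photon_prob \<rho> n"
    and "(\<lambda>k. coeff (l k) n * cnj (coeff (l k) m)) sums coeff (\<rho> (ket m)) n"
proof -
  show z: "n < k \<Longrightarrow> coeff (l k) n = 0" for n k
    using assms(1) unfolding state_decomp_def by auto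
  have entry: "coeff (\<rho> (ket n)) m = (\<Sum>k\<le>m. coeff (l k) m * cnj (coeff (l k) n))" for m n
    using assms(1) unfolding state_decomp_def by auto
  show sums: "(\<lambda>k. coeff (l k) n * cnj (coeff (l k) m)) sums coeff (\<rho> (ket m)) n" for m n
    unfolding entry by (rule sums_finite) (auto simp: z)
  show "(\<lambda>k. (cmod (coeff (l k) n))\<^sup>2) sums photon_prob \<rho> n"
  proof -
    have "(\<lambda>k. complex_of_real ((cmod (coeff (l k) n))\<^sup>2)) sums complex_of_real (photon_prob \<rho> n)"
      using sums[of n n] unfolding photon_prob_sums(3)[OF assms(2)] complex_norm_square .
    then show ?thesis unfolding sums_of_real_iff .
  qed
  have pos: "positive_operator \<rho>" using assms(2) by (simp add: density_operator_def)
  have adj: "cinner (\<rho> x) y = cinner x (\<rho> y)" for x y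
    using positive_formD(3)[OF positive_operator_form[OF pos], of x y] cinner_commute[of y "\<rho> x"] by simp
  have "coeff (\<rho> y) n = cinner (\<rho> (ket n)) y"
    unfolding adj by (simp add: cinner_ket)
  also have "\<dots> = (\<Sum>m. \<Sum>k\<le>n. coeff (l k) n * (cnj (coeff (l k) m) * coeff y m))"
  proof -
    have "cnj (coeff (\<rho> (ket n)) m) = coeff (\<rho> (ket m)) n" for m
      using adj[of "ket n" "ket m"] cinner_commute[of "ket m" "\<rho> (ket n)"]
      by (simp add: cinner_ket)
    then show ?thesis unfolding cinner_def by (simp add: entry sum_distrib_right mult.assoc)
  qed
  also have "\<dots> = (\<Sum>k\<le>n. \<Sum>m. coeff (l k) n * (cnj (coeff (l k) m) * coeff y m))"
    by (intro suminf_sum summable_mult summable_cinner)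
  also have "\<dots> = (\<Sum>k\<le>n. coeff (l k) n * cinner (l k) y)"
    by (simp add: suminf_mult summable_cinner cinner_def)
  finally show "coeff (\<rho> y) n = (\<Sum>k\<le>n. coeff (l k) n * cinner (l k) y)" .
qed

lemma suminf_commute_ennreal:
  fixes f :: "nat \<Rightarrow> nat \<Rightarrow> ennreal"
  shows "(\<Sum>i. \<Sum>j. f i j) = (\<Sum>j. \<Sum>i. f i j)"
proof -
  have "(\<integral>\<^sup>+j. (\<Sum>i. f i j) \<partial>count_space UNIV) = (\<Sum>i. \<integral>\<^sup>+j. f i j \<partial>count_space UNIV)"
    by (intro nn_integral_suminf) simp
  then show ?thesis unfolding nn_integral_count_space_nat by (rule sym)
qed

text \<open>The array of squared moduli is summed in both orders: one gives the squared norms, the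
  other the photon probabilities, whose sum is the trace.\<close>

lemma state_decomp_norm_sums:
  assumes "state_decomp \<rho> l" "density_operator \<rho>"
  shows "(\<lambda>k. (norm (l k))\<^sup>2) sums 1"
proof -
  note D = state_decompD[OF assms]
  have "(\<Sum>k. ennreal ((norm (l k))\<^sup>2)) = (\<Sum>k. \<Sum>n. ennreal ((cmod (coeff (l k) n))\<^sup>2))"
  proof -
    have "(\<Sum>n. ennreal ((cmod (coeff (l k) n))\<^sup>2)) = ennreal ((norm (l k))\<^sup>2)" for k
      by (rule suminf_ennreal_eq[OF _ norm_sums]) simp
    then show ?thesis by simp
  qed
  also have "\<dots> = (\<Sum>n. \<Sum>k. ennreal ((cmod (coeff (l k) n))\<^sup>2))"
    by (rule suminf_commute_ennreal)
  also have "\<dots> = (\<Sum>n. ennreal (photon_prob \<rho> n))"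
  proof -
    have "(\<Sum>k. ennreal ((cmod (coeff (l k) n))\<^sup>2)) = ennreal (photon_prob \<rho> n)" for n
      by (rule suminf_ennreal_eq[OF _ D(3)]) simp
    then show ?thesis by simp
  qed
  also have "\<dots> = ennreal 1"
    using photon_prob_sums[OF assms(2)] by (intro suminf_ennreal_eq) auto
  finally have e: "(\<Sum>k. ennreal ((norm (l k))\<^sup>2)) = ennreal 1" .
  then have "summable (\<lambda>k. (norm (l k))\<^sup>2)"
    by (intro summable_suminf_not_top) auto
  with e show ?thesis
    by (subst (asm) suminf_ennreal2) (auto simp: sums_iff suminf_nonneg)
qed

lemma coeff_shifted_state:
  assumes "state_decomp \<rho> l" "density_operator \<rho>"
  shows "coeff (shifted_state \<rho> \<theta> y) n
    = (\<Sum>k\<le>n. coeff (phase_shift \<theta> (l k)) n * cinner (phase_shift \<theta> (l k)) y)"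
  by (simp add: shifted_state_def coeff_phase_shift state_decompD(2)[OF assms] cinner_phase_shift
      sum_distrib_left mult.assoc)

text \<open>The trace sums over n first and the claim over k first. The interchange rests on
  absolute summability of \<open>g\<close>: row k contributes at most C times the squared norm of
  l_k, and these squared norms sum to 1.\<close>

lemma state_decomp_trace:
  assumes "state_decomp \<rho> l" "density_operator \<rho>" "positive_operator A"
  shows "(\<lambda>k. Re (cinner (phase_shift \<theta> (l k)) (A (phase_shift \<theta> (l k))))) sums
    Re (op_trace (shifted_state \<rho> \<theta> \<circ> A))"
proof -
  note D = state_decompD[OF assms(1,2)] and F = positive_formD[OF positive_operator_form[OF assms(3)]]
  define a where "a k = phase_shift \<theta> (l k)" for k
  define g where "g = (\<lambda>(k, n). coeff (a k) n * cnj (coeff (A (a k)) n))"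
  have a0: "coeff (a k) n = 0" if "n < k" for n k
    using D(1)[OF that] by (simp add: a_def coeff_phase_shift)
  obtain C where C: "C > 0" "\<And>x. norm (A x) \<le> norm x * C"
    using bounded_linear.pos_bounded[of A] assms(3)
    unfolding positive_operator_def bounded_operator_def by auto
  have gsum: "((\<lambda>n. g (k, n)) has_sum cnj (cinner (a k) (A (a k)))) UNIV"
    and gnorm: "(\<lambda>n. norm (g (k, n))) summable_on UNIV"
      "(\<Sum>\<^sub>\<infinity>n. norm (g (k, n))) \<le> (norm (l k))\<^sup>2 * C" for k
  proof -
    have "summable (\<lambda>n. (cmod (coeff (a k) n))\<^sup>2 * C / 2 + (cmod (coeff (A (a k)) n))\<^sup>2 / C / 2)"
      by (intro summable_add summable_divide summable_mult2 summable_coeff)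
    \<comment> \<open>The weight C balances the two squares: since A has norm at most C, both halves
      sum to at most half of C times the squared norm of the vector.\<close>
    moreover have young: "norm (g (k, n)) \<le> (cmod (coeff (a k) n))\<^sup>2 * C / 2 + (cmod (coeff (A (a k)) n))\<^sup>2 / C / 2" for n
    proof -
      have "0 \<le> (cmod (coeff (a k) n) * C - cmod (coeff (A (a k)) n))\<^sup>2 / (2 * C)" using C by simp
      also have "\<dots> = (cmod (coeff (a k) n))\<^sup>2 * C / 2 + (cmod (coeff (A (a k)) n))\<^sup>2 / C / 2 - norm (g (k, n))"
        using C by (simp add: g_def norm_mult power2_eq_square field_simps)
      finally show ?thesis by simp
    qed
    ultimately have s: "summable (\<lambda>n. norm (g (k, n)))"
      by - (erule summable_comparison_test'[where N = 0], simp)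
    then show "(\<lambda>n. norm (g (k, n))) summable_on UNIV"
      by (intro summable_nonneg_imp_summable_on) auto
    have "(\<lambda>n. g (k, n)) sums cnj (cinner (a k) (A (a k)))"
    proof -
      have "(\<lambda>n. cnj (cnj (coeff (a k) n) * coeff (A (a k)) n)) sums cnj (cinner (a k) (A (a k)))"
        unfolding sums_cnj cinner_def by (rule summable_sums[OF summable_cinner])
      then show ?thesis by (simp add: g_def)
    qed
    then show "((\<lambda>n. g (k, n)) has_sum cnj (cinner (a k) (A (a k)))) UNIV"
      by (rule norm_summable_imp_has_sum[OF s])
    have "(\<Sum>\<^sub>\<infinity>n. norm (g (k, n))) = (\<Sum>n. norm (g (k, n)))"
      using s by (intro infsumI norm_summable_imp_has_sum summable_sums) auto
    also have "\<dots> \<le> (norm (a k))\<^sup>2 * C / 2 + (norm (A (a k)))\<^sup>2 / C / 2"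
      using young by (intro sums_le[OF _ summable_sums[OF s] sums_add[OF
          sums_divide[OF sums_mult2[OF norm_sums]] sums_divide[OF sums_divide[OF norm_sums]]]]) auto
    also have "(norm (A (a k)))\<^sup>2 \<le> (norm (a k) * C)\<^sup>2"
      using C by (intro power_mono) auto
    finally show "(\<Sum>\<^sub>\<infinity>n. norm (g (k, n))) \<le> (norm (l k))\<^sup>2 * C"
      using C by (simp add: a_def power2_eq_square field_simps)
  qed
  have "(\<lambda>x. norm (g x)) summable_on Sigma UNIV (\<lambda>_. UNIV)"
    unfolding Infinite_Sum.abs_summable_on_Sigma_iff
  proof (intro conjI ballI)
    show "(\<lambda>n. norm (g (k, n))) summable_on UNIV" for k by (rule gnorm)
    have "summable (\<lambda>k. norm ((norm (l k))\<^sup>2 * C))"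
      using sums_summable[OF state_decomp_norm_sums[OF assms(1,2)]] C by (auto intro: summable_mult2)
    then have "summable (\<lambda>k. norm (norm (\<Sum>\<^sub>\<infinity>n. norm (g (k, n)))))"
      by (rule summable_comparison_test'[where N = 0]) (use gnorm(2) C in \<open>auto simp: infsum_nonneg\<close>)
    then show "(\<lambda>k. norm (\<Sum>\<^sub>\<infinity>n. norm (g (k, n)))) summable_on UNIV"
      by (intro norm_summable_imp_summable_on)
  qed
  then have gs: "g summable_on UNIV \<times> UNIV"
    by (rule Infinite_Sum.abs_summable_summable)
  have diag: "cinner (ket n) ((shifted_state \<rho> \<theta> \<circ> A) (ket n)) = (\<Sum>\<^sub>\<infinity>k. g (k, n))" for n
  proof -
    have "cinner (ket n) ((shifted_state \<rho> \<theta> \<circ> A) (ket n))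
      = (\<Sum>k\<le>n. coeff (a k) n * cinner (a k) (A (ket n)))"
      by (simp add: cinner_ket coeff_shifted_state[OF assms(1,2)] a_def)
    also have "\<dots> = (\<Sum>k\<le>n. g (k, n))"
      using F(3)[of "a _" "ket n"] by (simp add: g_def cinner_ket)
    also have "\<dots> = (\<Sum>\<^sub>\<infinity>k. g (k, n))"
      by (rule infsumI[symmetric], rule has_sum_finite_neutralI) (auto simp: g_def a0)
    finally show ?thesis .
  qed
  have "op_trace (shifted_state \<rho> \<theta> \<circ> A) = (\<Sum>\<^sub>\<infinity>n. \<Sum>\<^sub>\<infinity>k. g (k, n))"
    unfolding op_trace_def diag ..
  also have "\<dots> = (\<Sum>\<^sub>\<infinity>k. \<Sum>\<^sub>\<infinity>n. g (k, n))"
    using infsum_swap_banach[of "\<lambda>k n. g (k, n)" UNIV UNIV] gs by simp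
  also have "\<dots> = (\<Sum>\<^sub>\<infinity>k. cnj (cinner (a k) (A (a k))))"
    by (simp only: infsumI[OF gsum])
  finally have tr: "op_trace (shifted_state \<rho> \<theta> \<circ> A) = \<dots>" .
  have "(\<lambda>k. \<Sum>\<^sub>\<infinity>n. g (k, n)) summable_on UNIV"
    using gs by (intro summable_on_Sigma_banach[of "\<lambda>k n. g (k, n)" UNIV "\<lambda>_. UNIV"]) (auto simp: case_prod_unfold)
  then have "(\<lambda>k. cnj (cinner (a k) (A (a k)))) summable_on UNIV"
    by (simp only: infsumI[OF gsum])
  then have "((\<lambda>k. cnj (cinner (a k) (A (a k)))) has_sum op_trace (shifted_state \<rho> \<theta> \<circ> A)) UNIV"
    unfolding tr by (rule has_sum_infsum)
  from sums_Re[OF has_sum_imp_sums[OF this]] show ?thesis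
    by (simp add: a_def)
qed

section \<open>The distribution of the error\<close>

lemma space_circle [simp]: "space circle = {-pi..<pi}"
  by (simp add: circle_def space_restrict_space)

lemma circle_in_sets [simp]: "{-pi..<pi} \<in> sets circle"
  using sets.top[of circle] by simp

lemma measurable_circle [measurable (raw)]:
  "f \<in> borel_measurable borel \<Longrightarrow> f \<in> borel_measurable circle"
  unfolding circle_def by (auto intro: measurable_restrict_space1)

lemma positive_operator_povm:
  assumes "circle_povm M" "B \<in> sets circle"
  shows "positive_operator (M B)"
  using assms unfolding circle_povm_def by blast

lemma povm_form:
  assumes "circle_povm M" "B \<in> sets circle"
  shows "positive_form (\<lambda>x y. cinner x (M B y))"
  using assms by (intro positive_operator_form positive_operator_povm)

lemma povm_space: "circle_povm M \<Longrightarrow> M {-pi..<pi} = id"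
  unfolding circle_povm_def by simp

lemma povm_sums:
  assumes "circle_povm M" "range B \<subseteq> sets circle" "disjoint_family B"
  shows "(\<lambda>i. cinner x (M (B i) y)) sums cinner x (M (\<Union>i. B i) y)"
  using assms unfolding circle_povm_def by blast

definition povm_dist :: "(real set \<Rightarrow> fock \<Rightarrow> fock) \<Rightarrow> fock \<Rightarrow> real measure" where
  "povm_dist M x = measure_of (space circle) (sets circle) (\<lambda>B. ennreal (Re (cinner x (M B x))))"

lemma sets_povm_dist [simp, measurable_cong]: "sets (povm_dist M x) = sets circle"
  unfolding povm_dist_def by (rule sigma_algebra.sets_measure_of_eq) (rule sets.sigma_algebra_axioms)

lemma space_povm_dist [simp]: "space (povm_dist M x) = {-pi..<pi}"
  using sets_eq_imp_space_eq[OF sets_povm_dist] by simp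

lemma povm_suminf:
  assumes "circle_povm M" "range B \<subseteq> sets circle" "disjoint_family B"
  shows "(\<Sum>i. ennreal (Re (cinner x (M (B i) x)))) = ennreal (Re (cinner x (M (\<Union>i. B i) x)))"
  using sums_Re[OF povm_sums[OF assms, of x x]] assms(2)
  by (intro suminf_ennreal_eq positive_formD(4)[OF povm_form[OF assms(1)]]) auto

text \<open>The constant sequence of empty sets is disjoint, and a constant series converges only if
  its terms vanish.\<close>

lemma povm_empty:
  assumes "circle_povm M"
  shows "cinner x (M {} y) = 0"
  using sums_summable[OF povm_sums[OF assms, of "\<lambda>_. {}" x y]]
  by (simp add: disjoint_family_on_def summable_const_iff)

lemma emeasure_povm_dist:
  assumes "circle_povm M" "B \<in> sets circle"
  shows "emeasure (povm_dist M x) B = ennreal (Re (cinner x (M B x)))"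
proof (rule emeasure_measure_of[OF povm_dist_def])
  show "positive (sets (povm_dist M x)) (\<lambda>B. ennreal (Re (cinner x (M B x))))"
    using povm_empty[OF assms(1)] by (simp add: positive_def)
  show "countably_additive (sets (povm_dist M x)) (\<lambda>B. ennreal (Re (cinner x (M B x))))"
    unfolding countably_additive_def using povm_suminf[OF assms(1)] by simp
  show "sets circle \<subseteq> Pow (space circle)" by (rule sets.space_closed)
qed (use assms in simp)

lemma emeasure_povm_dist_space:
  assumes "circle_povm M"
  shows "emeasure (povm_dist M x) {-pi..<pi} = ennreal ((norm x)\<^sup>2)"
  using emeasure_povm_dist[OF assms, of "space circle" x] povm_space[OF assms]
  by (simp add: cinner_self)

lemma finite_measure_povm_dist: "circle_povm M \<Longrightarrow> finite_measure (povm_dist M x)"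
  by (rule finite_measureI) (simp add: emeasure_povm_dist_space)

lemma sets_outcome_dist [simp, measurable_cong]: "sets (outcome_dist \<rho> M \<theta>) = sets circle"
  unfolding outcome_dist_def by (rule sigma_algebra.sets_measure_of_eq) (rule sets.sigma_algebra_axioms)

lemma space_outcome_dist [simp]: "space (outcome_dist \<rho> M \<theta>) = {-pi..<pi}"
  using sets_eq_imp_space_eq[OF sets_outcome_dist] by simp

lemma prob_space_uniform_prior: "prob_space uniform_prior"
proof
  have "emeasure uniform_prior (space uniform_prior) = (\<integral>\<^sup>+x. ennreal (1 / (2 * pi)) * indicator (space circle) x \<partial>circle)"
    unfolding uniform_prior_def by (subst emeasure_density) simp_all
  also have "\<dots> = ennreal (1 / (2 * pi)) * emeasure circle (space circle)"
    by (rule nn_integral_cmult_indicator) (rule sets.top)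
  also have "emeasure circle (space circle) = ennreal (2 * pi)"
    by (simp add: circle_def space_restrict_space emeasure_restrict_space)
  also have "ennreal (1 / (2 * pi)) * \<dots> = 1"
    by (simp add: ennreal_mult[symmetric])
  finally show "emeasure uniform_prior (space uniform_prior) = 1" .
qed

lemma sets_uniform_prior [simp, measurable_cong]: "sets uniform_prior = sets circle"
  by (simp add: uniform_prior_def)

lemma space_uniform_prior [simp]: "space uniform_prior = {-pi..<pi}"
  by (simp add: uniform_prior_def)

lemma nn_integral_uniform_prior:
  assumes "f \<in> borel_measurable borel"
  shows "(\<integral>\<^sup>+x. f x \<partial>uniform_prior) = ennreal (1 / (2 * pi)) * (\<integral>\<^sup>+x. f x * indicator {-pi..<pi} x \<partial>lborel)"
proof -
  have [measurable]: "f \<in> borel_measurable lborel" using assms by simp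
  have "f \<in> borel_measurable circle" using assms by (intro measurable_circle) simp
  then have "(\<integral>\<^sup>+x. f x \<partial>uniform_prior) = (\<integral>\<^sup>+x. ennreal (1 / (2 * pi)) * f x \<partial>circle)"
    unfolding uniform_prior_def by (intro nn_integral_density) simp_all
  also have "\<dots> = (\<integral>\<^sup>+x. ennreal (1 / (2 * pi)) * (f x * indicator {-pi..<pi} x) \<partial>lborel)"
    unfolding circle_def by (subst nn_integral_restrict_space) (simp_all add: mult.assoc)
  also have "\<dots> = ennreal (1 / (2 * pi)) * (\<integral>\<^sup>+x. f x * indicator {-pi..<pi} x \<partial>lborel)"
    by (intro nn_integral_cmult) simp
  finally show ?thesis .
qed

section \<open>Periodic integrals and the wrapped error\<close>

lemma nn_integral_shift:
  fixes f :: "real \<Rightarrow> ennreal"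
  assumes "f \<in> borel_measurable borel"
  shows "(\<integral>\<^sup>+x. f x \<partial>lborel) = (\<integral>\<^sup>+x. f (x + t) \<partial>lborel)"
  using nn_integral_real_affine[OF assms, of 1 t] by (simp add: add.commute)

text \<open>The interval is open on the left because the reflection of \<theta> to t - \<theta>
  swaps the closed end. The part of it before a point congruent to -\<pi> is moved up by one period,
  and the whole then shifts by a multiple of the period.\<close>

lemma nn_integral_period:
  fixes h :: "real \<Rightarrow> ennreal"
  assumes h [measurable]: "h \<in> borel_measurable borel" and per: "\<And>x. h (x + 2 * pi) = h x"
  shows "(\<integral>\<^sup>+x. h x * indicator {a<..a + 2 * pi} x \<partial>lborel) = (\<integral>\<^sup>+x. h x * indicator {-pi..<pi} x \<partial>lborel)"
proof -
  have per_nat: "h (x + 2 * pi * real n) = h x" for x n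
  proof (induction n)
    case (Suc n)
    have "x + 2 * pi * real (Suc n) = (x + 2 * pi * real n) + 2 * pi" by (simp add: algebra_simps)
    then show ?case using per Suc by metis
  qed simp
  have per_int: "h (x + 2 * pi * of_int k) = h x" for x k
  proof (cases "k \<ge> 0")
    case True
    then show ?thesis using per_nat[of x "nat k"] by simp
  next
    case False
    then show ?thesis using per_nat[of "x + 2 * pi * of_int k" "nat (- k)"] by simp
  qed
  \<comment> \<open>This k places b, which is congruent to -\<pi>, in the half-open interval (a, a +
    2 \<pi>].\<close>
  define k where "k = \<lfloor>(a + 3 * pi) / (2 * pi)\<rfloor>"
  define b where "b = -pi + 2 * pi * of_int k"
  have "of_int k \<le> (a + 3 * pi) / (2 * pi)" "(a + 3 * pi) / (2 * pi) < of_int k + 1"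
    unfolding k_def by linarith+
  then have "2 * pi * of_int k \<le> a + 3 * pi" "a + 3 * pi < 2 * pi * (of_int k + 1)"
    by (simp_all add: field_simps)
  then have b: "a < b" "b \<le> a + 2 * pi" unfolding b_def by (auto simp: algebra_simps)
  have "(\<integral>\<^sup>+x. h x * indicator {a<..a + 2 * pi} x \<partial>lborel)
      = (\<integral>\<^sup>+x. h x * indicator {a<..b} x + h x * indicator {b<..a + 2 * pi} x \<partial>lborel)"
    using b by (intro nn_integral_cong) (auto split: split_indicator)
  also have "\<dots> = (\<integral>\<^sup>+x. h x * indicator {a<..b} x \<partial>lborel) + (\<integral>\<^sup>+x. h x * indicator {b<..a + 2 * pi} x \<partial>lborel)"
    by (intro nn_integral_add) auto
  also have "(\<integral>\<^sup>+x. h x * indicator {a<..b} x \<partial>lborel) = (\<integral>\<^sup>+x. h x * indicator {a + 2 * pi<..b + 2 * pi} x \<partial>lborel)"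
    by (subst (2) nn_integral_shift[where t = "2 * pi"]) (auto simp: per intro!: nn_integral_cong split: split_indicator)
  also have "\<dots> + (\<integral>\<^sup>+x. h x * indicator {b<..a + 2 * pi} x \<partial>lborel)
      = (\<integral>\<^sup>+x. h x * indicator {a + 2 * pi<..b + 2 * pi} x + h x * indicator {b<..a + 2 * pi} x \<partial>lborel)"
    by (intro nn_integral_add[symmetric]) auto
  also have "\<dots> = (\<integral>\<^sup>+x. h x * indicator {b<..b + 2 * pi} x \<partial>lborel)"
    using b by (intro nn_integral_cong) (auto split: split_indicator)
  also have "\<dots> = (\<integral>\<^sup>+x. h x * indicator {-pi<..pi} x \<partial>lborel)"
    by (subst nn_integral_shift[where t = "2 * pi * of_int k"])
       (auto simp: per_int b_def intro!: nn_integral_cong split: split_indicator)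
  also have "\<dots> = (\<integral>\<^sup>+x. h x * indicator {-pi..<pi} x \<partial>lborel)"
  proof (rule nn_integral_cong_AE)
    have "AE x in lborel. x \<noteq> (-pi :: real) \<and> x \<noteq> pi"
      by (simp add: AE_lborel_singleton)
    then show "AE x in lborel. h x * indicator {-pi<..pi} x = h x * indicator {-pi..<pi} x"
      by eventually_elim (auto split: split_indicator)
  qed
  finally show ?thesis .
qed

lemma borel_measurable_wrap_angle [measurable]: "wrap_angle \<in> borel_measurable borel"
  unfolding wrap_angle_def[abs_def] rmod_def by measurable

lemma wrap_angle_range: "wrap_angle x \<in> {-pi..<pi}"
  using rmod_nonneg[of "2 * pi" "x + pi"] rmod_less[of "2 * pi" "x + pi"]
  unfolding wrap_angle_def by auto

lemma wrap_angle_eq: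
  obtains k :: int where "wrap_angle x = x - 2 * pi * of_int k"
  by (rule that[of "\<lfloor>(x + pi) / \<bar>2 * pi\<bar>\<rfloor>"]) (simp add: wrap_angle_def rmod_def)

lemma wrap_angle_id: "x \<in> {-pi..<pi} \<Longrightarrow> wrap_angle x = x"
  unfolding wrap_angle_def by (subst rmod_unique[where z = "x + pi" and n = 0]) auto

lemma wrap_angle_add_period: "wrap_angle (x + 2 * pi) = wrap_angle x"
proof -
  have "\<lfloor>(x + 2 * pi + pi) / \<bar>2 * pi\<bar>\<rfloor> = \<lfloor>(x + pi) / \<bar>2 * pi\<bar>\<rfloor> + 1"
  proof -
    have "(x + 2 * pi + pi) / \<bar>2 * pi\<bar> = (x + pi) / \<bar>2 * pi\<bar> + 1" by (simp add: field_simps)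
    then show ?thesis by simp
  qed
  then show ?thesis unfolding wrap_angle_def rmod_def by (simp add: algebra_simps)
qed

lemma cos_wrap_angle: "cos (wrap_angle x) = cos x"
proof -
  obtain k :: int where "wrap_angle x = x - 2 * pi * of_int k" by (rule wrap_angle_eq)
  then show ?thesis using cos_int_2pin[of k] sin_int_2pin[of k] by (simp add: cos_diff)
qed

text \<open>For each fixed outcome the wrapped error is uniform under the prior. All averages over
  the phase shift that concern \<theta>-independent measures reduce to this.\<close>

lemma nn_integral_uniform_prior_rotate:
  fixes g :: "real \<Rightarrow> ennreal"
  assumes [measurable]: "g \<in> borel_measurable borel"
  shows "(\<integral>\<^sup>+\<theta>. g (wrap_angle (t - \<theta>)) \<partial>uniform_prior) = (\<integral>\<^sup>+\<theta>. g \<theta> \<partial>uniform_prior)"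
proof -
  define h where "h x = g (wrap_angle x)" for x
  have [measurable]: "h \<in> borel_measurable borel" unfolding h_def by measurable
  have "(\<integral>\<^sup>+\<theta>. h (t - \<theta>) * indicator {-pi..<pi} \<theta> \<partial>lborel)
    = (\<integral>\<^sup>+u. h (t - (t + (-1) * u)) * indicator {-pi..<pi} (t + (-1) * u) \<partial>lborel)"
    by (subst nn_integral_real_affine[where c = "-1" and t = t]) auto
  also have "\<dots> = (\<integral>\<^sup>+u. h u * indicator {t - pi<..(t - pi) + 2 * pi} u \<partial>lborel)"
    by (auto intro!: nn_integral_cong split: split_indicator)
  also have "\<dots> = (\<integral>\<^sup>+u. h u * indicator {-pi..<pi} u \<partial>lborel)"
    by (intro nn_integral_period) (auto simp: h_def wrap_angle_add_period)
  also have "\<dots> = (\<integral>\<^sup>+u. g u * indicator {-pi..<pi} u \<partial>lborel)"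
    by (intro nn_integral_cong) (auto simp: h_def wrap_angle_id split: split_indicator)
  finally show ?thesis
    by (subst (1 2) nn_integral_uniform_prior) (auto simp: h_def)
qed

text \<open>Written out in matrix entries, the function is an iterated series of products of
  characters in \<theta>, hence a limit of measurable functions.\<close>

lemma borel_measurable_povm_phase:
  assumes "positive_operator A"
  shows "(\<lambda>\<theta>. Re (cinner (phase_shift \<theta> x) (A (phase_shift \<theta> x)))) \<in> borel_measurable borel"
proof -
  have "cinner (phase_shift \<theta> x) (A (phase_shift \<theta> x))
    = (\<Sum>m. cnj (cis (- (real m * \<theta>)) * coeff x m) *
        cnj (\<Sum>n. cnj (cis (- (real n * \<theta>)) * coeff x n) * coeff (A (ket m)) n))" for \<theta>
    unfolding cinner_def[of "phase_shift \<theta> x"] coeff_positive_operator[OF assms, of "phase_shift \<theta> x"] coeff_phase_shift ..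
  moreover have [measurable]: "(\<lambda>\<theta>. cis (- (real n * \<theta>))) \<in> borel_measurable borel" for n
    by (intro borel_measurable_continuous_onI continuous_intros)
  moreover have [measurable]: "cnj \<in> borel_measurable borel"
    by (intro borel_measurable_continuous_onI continuous_intros)
  ultimately show ?thesis
    by simp
qed

lemma measurable_error: "(\<lambda>(\<theta>, \<theta>_est). wrap_angle (\<theta>_est - \<theta>)) \<in> borel_measurable (circle \<Otimes>\<^sub>M circle)"
proof -
  have "(\<lambda>x :: real. x) \<in> measurable circle borel" by (intro measurable_circle) auto
  then have [measurable]: "fst \<in> borel_measurable (circle \<Otimes>\<^sub>M circle)" "snd \<in> borel_measurable (circle \<Otimes>\<^sub>M circle)"
    using measurable_compose[OF measurable_fst] measurable_compose[OF measurable_snd] by blast+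
  show ?thesis unfolding case_prod_unfold by measurable
qed

lemma sets_error_dist [simp, measurable_cong]: "sets (error_dist \<rho> M) = sets borel"
  by (simp add: error_dist_def)

section \<open>The outcome distribution as a probability kernel\<close>

context
  fixes \<rho> M l
  assumes rho: "density_operator \<rho>" and povm: "circle_povm M" and decomp: "state_decomp \<rho> l"
begin

lemma outcome_trace:
  assumes "B \<in> sets circle"
  shows "ennreal (Re (op_trace (shifted_state \<rho> \<theta> \<circ> M B)))
    = (\<Sum>k. emeasure (povm_dist M (phase_shift \<theta> (l k))) B)"
  unfolding emeasure_povm_dist[OF povm assms]
  by (rule suminf_ennreal_eq[symmetric, OF _ state_decomp_trace[OF decomp rho positive_operator_povm[OF povm assms]]])
     (rule positive_formD(4)[OF povm_form[OF povm assms]])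

text \<open>\<open>measure_of\<close> returns the Born probabilities only if they are countably
  additive. This holds because they form a sum of the measures \<open>povm_dist\<close>, and
  nonnegative double sums commute.\<close>

lemma emeasure_outcome_dist:
  assumes "B \<in> sets circle"
  shows "emeasure (outcome_dist \<rho> M \<theta>) B = (\<Sum>k. emeasure (povm_dist M (phase_shift \<theta> (l k))) B)"
  unfolding outcome_trace[OF assms, symmetric]
proof (rule emeasure_measure_of[OF outcome_dist_def])
  show "positive (sets (outcome_dist \<rho> M \<theta>)) (\<lambda>B. ennreal (Re (op_trace (shifted_state \<rho> \<theta> \<circ> M B))))"
    using outcome_trace[of "{}"] by (simp add: positive_def)
  show "countably_additive (sets (outcome_dist \<rho> M \<theta>)) (\<lambda>B. ennreal (Re (op_trace (shifted_state \<rho> \<theta> \<circ> M B))))"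
    unfolding countably_additive_def
  proof (intro allI impI)
    fix B :: "nat \<Rightarrow> real set"
    assume B: "range B \<subseteq> sets (outcome_dist \<rho> M \<theta>)" "disjoint_family B"
    then have sets: "B i \<in> sets circle" "(\<Union>i. B i) \<in> sets circle" for i by auto
    have "(\<Sum>i. \<Sum>k. emeasure (povm_dist M (phase_shift \<theta> (l k))) (B i))
      = (\<Sum>k. \<Sum>i. emeasure (povm_dist M (phase_shift \<theta> (l k))) (B i))"
      by (rule suminf_commute_ennreal)
    also have "\<dots> = (\<Sum>k. emeasure (povm_dist M (phase_shift \<theta> (l k))) (\<Union>i. B i))"
      using B by (simp add: suminf_emeasure)
    finally show "(\<Sum>i. ennreal (Re (op_trace (shifted_state \<rho> \<theta> \<circ> M (B i)))))
      = ennreal (Re (op_trace (shifted_state \<rho> \<theta> \<circ> M (\<Union>i. B i))))"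
      by (simp only: outcome_trace[OF sets(1)] outcome_trace[OF sets(2)])
  qed
  show "sets circle \<subseteq> Pow (space circle)" by (rule sets.space_closed)
qed (use assms in simp)

lemma prob_space_outcome_dist: "prob_space (outcome_dist \<rho> M \<theta>)"
proof
  have "emeasure (outcome_dist \<rho> M \<theta>) (space circle) = (\<Sum>k. ennreal ((norm (l k))\<^sup>2))"
    by (subst emeasure_outcome_dist[OF sets.top]) (simp add: emeasure_povm_dist_space[OF povm])
  also have "\<dots> = ennreal 1"
    by (rule suminf_ennreal_eq[OF _ state_decomp_norm_sums[OF decomp rho]]) simp
  finally show "emeasure (outcome_dist \<rho> M \<theta>) (space (outcome_dist \<rho> M \<theta>)) = 1" by simp
qed

lemma outcome_dist_kernel [measurable]: "outcome_dist \<rho> M \<in> measurable uniform_prior (subprob_algebra circle)"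
proof (rule measurable_subprob_algebra)
  show "subprob_space (outcome_dist \<rho> M \<theta>)" for \<theta>
    by (rule prob_space_imp_subprob_space) (rule prob_space_outcome_dist)
  fix B assume B: "B \<in> sets circle"
  have "(\<lambda>\<theta>. emeasure (outcome_dist \<rho> M \<theta>) B) \<in> borel_measurable borel"
    unfolding emeasure_outcome_dist[OF B] emeasure_povm_dist[OF povm B]
    by (intro borel_measurable_suminf_order measurable_compose[OF _ measurable_ennreal]
        borel_measurable_povm_phase positive_operator_povm[OF povm B])
  then show "(\<lambda>\<theta>. emeasure (outcome_dist \<rho> M \<theta>) B) \<in> borel_measurable uniform_prior"
    unfolding uniform_prior_def by (simp add: measurable_circle)
qed simp

lemma joint_kernel: "(\<lambda>\<theta>. distr (outcome_dist \<rho> M \<theta>) (circle \<Otimes>\<^sub>M circle) (Pair \<theta>))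
    \<in> measurable uniform_prior (subprob_algebra (circle \<Otimes>\<^sub>M circle))"
proof (rule measurable_distr2[where M = circle])
  show "outcome_dist \<rho> M \<in> measurable uniform_prior (subprob_algebra circle)"
    by (rule outcome_dist_kernel)
qed (simp add: measurable_cong_sets[OF sets_pair_measure_cong[OF sets_uniform_prior refl] refl])

lemma sets_joint_dist: "sets (joint_dist \<rho> M) = sets (circle \<Otimes>\<^sub>M circle)"
  unfolding joint_dist_def by (subst sets_bind) auto

lemma nn_integral_error_dist:
  fixes g :: "real \<Rightarrow> ennreal"
  assumes [measurable]: "g \<in> borel_measurable borel"
  shows "(\<integral>\<^sup>+e. g e \<partial>error_dist \<rho> M)
    = (\<integral>\<^sup>+\<theta>. \<integral>\<^sup>+t. g (wrap_angle (t - \<theta>)) \<partial>outcome_dist \<rho> M \<theta> \<partial>uniform_prior)"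
proof -
  note [measurable] = measurable_error
  have "(\<integral>\<^sup>+e. g e \<partial>error_dist \<rho> M) = (\<integral>\<^sup>+z. g (case z of (\<theta>, t) \<Rightarrow> wrap_angle (t - \<theta>)) \<partial>joint_dist \<rho> M)"
    unfolding error_dist_def
    by (intro nn_integral_distr) (auto intro: measurable_error simp: measurable_cong_sets[OF sets_joint_dist refl])
  also have "\<dots> = (\<integral>\<^sup>+\<theta>. \<integral>\<^sup>+z. g (case z of (\<theta>, t) \<Rightarrow> wrap_angle (t - \<theta>))
      \<partial>distr (outcome_dist \<rho> M \<theta>) (circle \<Otimes>\<^sub>M circle) (Pair \<theta>) \<partial>uniform_prior)"
    unfolding joint_dist_def by (intro nn_integral_bind[OF _ joint_kernel]) measurable
  also have "\<dots> = (\<integral>\<^sup>+\<theta>. \<integral>\<^sup>+t. g (wrap_angle (t - \<theta>)) \<partial>outcome_dist \<rho> M \<theta> \<partial>uniform_prior)"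
    by (intro nn_integral_cong, subst nn_integral_distr) (auto intro!: measurable_Pair1')
  finally show ?thesis .
qed

end

section \<open>The bound by the Renyi length\<close>

text \<open>Domination on sets extends to integrals by the standard induction over measurable
  functions. The coefficients may be infinite, as they are for a state of infinite
  \<open>L_half\<close>.\<close>

lemma nn_integral_le_suminf:
  fixes M :: "nat \<Rightarrow> 'a measure"
  assumes sets: "\<And>n. sets (M n) = sets N"
    and le: "\<And>B. B \<in> sets N \<Longrightarrow> emeasure N B \<le> (\<Sum>n. c n * emeasure (M n) B)"
    and f: "f \<in> borel_measurable N"
  shows "(\<integral>\<^sup>+x. f x \<partial>N) \<le> (\<Sum>n. c n * (\<integral>\<^sup>+x. f x \<partial>M n))"
  using f
proof (induction rule: borel_measurable_induct)
  case (cong f g)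
  have "(\<integral>\<^sup>+x. f x \<partial>N) = (\<integral>\<^sup>+x. g x \<partial>N)" "\<And>n. (\<integral>\<^sup>+x. f x \<partial>M n) = (\<integral>\<^sup>+x. g x \<partial>M n)"
    using cong(3) sets_eq_imp_space_eq[OF sets] by (auto intro!: nn_integral_cong)
  with cong(4) show ?case by simp
next
  case (set A)
  then show ?case using le[of A] sets by simp
next
  case (mult u a)
  have "(\<integral>\<^sup>+x. a * u x \<partial>N) = a * (\<integral>\<^sup>+x. u x \<partial>N)"
    using mult by (intro nn_integral_cmult) auto
  also have "\<dots> \<le> a * (\<Sum>n. c n * (\<integral>\<^sup>+x. u x \<partial>M n))"
    using mult by (intro mult_left_mono) auto
  also have "\<dots> = (\<Sum>n. a * (c n * (\<integral>\<^sup>+x. u x \<partial>M n)))"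
    by simp
  also have "\<dots> = (\<Sum>n. c n * (\<integral>\<^sup>+x. a * u x \<partial>M n))"
    using mult sets by (intro arg_cong[where f = suminf] ext)
      (subst nn_integral_cmult, simp_all add: mult_ac measurable_cong_sets[OF sets refl])
  finally show ?case .
next
  case (add u v)
  have "(\<integral>\<^sup>+x. v x + u x \<partial>N) = (\<integral>\<^sup>+x. v x \<partial>N) + (\<integral>\<^sup>+x. u x \<partial>N)"
    using add by (intro nn_integral_add) auto
  also have "\<dots> \<le> (\<Sum>n. c n * (\<integral>\<^sup>+x. v x \<partial>M n)) + (\<Sum>n. c n * (\<integral>\<^sup>+x. u x \<partial>M n))"
    using add by (intro add_mono) auto
  also have "\<dots> = (\<Sum>n. c n * (\<integral>\<^sup>+x. v x \<partial>M n) + c n * (\<integral>\<^sup>+x. u x \<partial>M n))"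
    by (intro suminf_add) auto
  also have "\<dots> = (\<Sum>n. c n * (\<integral>\<^sup>+x. v x + u x \<partial>M n))"
    using add sets by (intro arg_cong[where f = suminf] ext)
      (subst nn_integral_add, simp_all add: distrib_left measurable_cong_sets[OF sets refl])
  finally show ?case .
next
  case (seq U)
  have "(\<integral>\<^sup>+x. (SUP i. U i) x \<partial>N) = (SUP i. \<integral>\<^sup>+x. U i x \<partial>N)"
  proof -
    have eq: "(SUP i. U i) x = (SUP i. U i x)" for x by (simp add: image_comp)
    show ?thesis unfolding eq using seq by (intro nn_integral_monotone_convergence_SUP) auto
  qed
  also have "\<dots> \<le> (SUP i. \<Sum>n. c n * (\<integral>\<^sup>+x. U i x \<partial>M n))"
    using seq by (intro SUP_mono') auto
  also have "\<dots> \<le> (\<Sum>n. c n * (\<integral>\<^sup>+x. (SUP i. U i) x \<partial>M n))"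
    by (intro SUP_least suminf_le mult_left_mono nn_integral_mono) (auto intro: SUP_upper)
  finally show ?case .
qed

text \<open>After Fubini the inner average over \<theta> is the same for every outcome, so only the
  total mass of \<open>povm_dist\<close> remains of the measurement.\<close>

lemma nn_integral_povm_dist_rotate:
  fixes g :: "real \<Rightarrow> ennreal"
  assumes [measurable]: "g \<in> borel_measurable borel" and povm: "circle_povm M"
  shows measurable_povm_dist_rotate:
      "(\<lambda>\<theta>. \<integral>\<^sup>+t. g (wrap_angle (t - \<theta>)) \<partial>povm_dist M x) \<in> borel_measurable uniform_prior"
    and "(\<integral>\<^sup>+\<theta>. \<integral>\<^sup>+t. g (wrap_angle (t - \<theta>)) \<partial>povm_dist M x \<partial>uniform_prior)
    = ennreal ((norm x)\<^sup>2) * (\<integral>\<^sup>+\<theta>. g \<theta> \<partial>uniform_prior)"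
proof -
  interpret U: prob_space uniform_prior by (rule prob_space_uniform_prior)
  interpret P: finite_measure "povm_dist M x" by (rule finite_measure_povm_dist[OF povm])
  interpret UP: pair_sigma_finite uniform_prior "povm_dist M x" ..
  have "sets (uniform_prior \<Otimes>\<^sub>M povm_dist M x) = sets (circle \<Otimes>\<^sub>M circle)"
    by (intro sets_pair_measure_cong) simp_all
  then have [measurable]: "(\<lambda>(\<theta>, t). g (wrap_angle (t - \<theta>))) \<in> borel_measurable (uniform_prior \<Otimes>\<^sub>M povm_dist M x)"
    using measurable_compose[OF measurable_error assms(1)]
    unfolding case_prod_unfold by (subst measurable_cong_sets[OF _ refl])
  show "(\<lambda>\<theta>. \<integral>\<^sup>+t. g (wrap_angle (t - \<theta>)) \<partial>povm_dist M x) \<in> borel_measurable uniform_prior"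
    by measurable
  have "(\<integral>\<^sup>+\<theta>. \<integral>\<^sup>+t. g (wrap_angle (t - \<theta>)) \<partial>povm_dist M x \<partial>uniform_prior)
    = (\<integral>\<^sup>+t. \<integral>\<^sup>+\<theta>. g (wrap_angle (t - \<theta>)) \<partial>uniform_prior \<partial>povm_dist M x)"
    by (rule UP.Fubini'[symmetric]) measurable
  also have "\<dots> = (\<integral>\<^sup>+t. (\<integral>\<^sup>+\<theta>. g \<theta> \<partial>uniform_prior) \<partial>povm_dist M x)"
    by (simp add: nn_integral_uniform_prior_rotate)
  also have "\<dots> = ennreal ((norm x)\<^sup>2) * (\<integral>\<^sup>+\<theta>. g \<theta> \<partial>uniform_prior)"
    using emeasure_povm_dist_space[OF povm, of x] by (simp add: mult.commute)
  finally show "(\<integral>\<^sup>+\<theta>. \<integral>\<^sup>+t. g (wrap_angle (t - \<theta>)) \<partial>povm_dist M x \<partial>uniform_prior)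
    = ennreal ((norm x)\<^sup>2) * (\<integral>\<^sup>+\<theta>. g \<theta> \<partial>uniform_prior)" .
qed

lemma norm_ket [simp]: "norm (ket n) = 1"
proof -
  have "(norm (ket n))\<^sup>2 = 1"
    using cinner_self[of "ket n"] by (simp add: cinner_ket coeff_ket flip: of_real_power)
  then show ?thesis using norm_ge_zero[of "ket n"] by (simp add: power2_eq_1_iff)
qed

text \<open>An off-diagonal entry is bounded by the arithmetic mean of two diagonal ones, which
  keeps the bound additive in A and hence in the outcome set. In \<open>ennreal\<close> the double
  series needs no convergence proof.\<close>

lemma positive_form_ket_ennreal:
  assumes "positive_operator A"
  shows "ennreal (Re (cinner x (A x))) \<le> (\<Sum>m. \<Sum>n. ennreal (cmod (coeff x m) * cmod (coeff x n)) *
      (ennreal (Re (cinner (ket m) (A (ket m))) / 2) + ennreal (Re (cinner (ket n) (A (ket n))) / 2)))"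
proof -
  note F = positive_operator_form[OF assms]
  note D = positive_formD[OF F]
  let ?q = "\<lambda>m. Re (cinner (ket m) (A (ket m)))"
  have entry: "cmod (coeff (A (ket m)) n) \<le> (?q m + ?q n) / 2" for m n
    using positive_form_young[OF F, of 1 "ket n" "ket m"] by (simp add: cinner_ket)
  have norm_suminf: "ennreal (norm (suminf f)) \<le> (\<Sum>n. ennreal (norm (f n)))" if "summable f" for f :: "nat \<Rightarrow> complex"
  proof -
    have "(\<lambda>K. norm (\<Sum>n<K. f n)) \<longlonglongrightarrow> norm (suminf f)"
      using that by (intro tendsto_norm summable_LIMSEQ)
    then have "(\<lambda>K. ennreal (norm (\<Sum>n<K. f n))) \<longlonglongrightarrow> ennreal (norm (suminf f))"
      by (rule tendsto_ennrealI)
    then show ?thesis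
    proof (rule LIMSEQ_le_const2)
      show "\<exists>N. \<forall>K\<ge>N. ennreal (norm (\<Sum>n<K. f n)) \<le> (\<Sum>n. ennreal (norm (f n)))"
      proof (intro exI allI impI)
        fix K
        have "ennreal (norm (\<Sum>n<K. f n)) \<le> ennreal (\<Sum>n<K. norm (f n))"
          by (intro ennreal_leI norm_sum)
        also have "\<dots> = (\<Sum>n<K. ennreal (norm (f n)))" by simp
        also have "\<dots> \<le> (\<Sum>n. ennreal (norm (f n)))" by (rule sum_le_suminf) auto
        finally show "ennreal (norm (\<Sum>n<K. f n)) \<le> (\<Sum>n. ennreal (norm (f n)))" .
      qed
    qed
  qed
  have "ennreal (Re (cinner x (A x))) \<le> ennreal (cmod (cinner x (A x)))"
    by (intro ennreal_leI complex_Re_le_cmod)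
  also have "\<dots> \<le> (\<Sum>m. ennreal (cmod (cnj (coeff x m) * coeff (A x) m)))"
    unfolding cinner_def by (rule norm_suminf[OF summable_cinner])
  also have "\<dots> = (\<Sum>m. ennreal (cmod (coeff x m)) * ennreal (cmod (\<Sum>n. cnj (coeff x n) * coeff (A (ket m)) n)))"
    unfolding coeff_positive_operator[OF assms, of x] by (simp add: norm_mult ennreal_mult)
  also have "\<dots> \<le> (\<Sum>m. ennreal (cmod (coeff x m)) * (\<Sum>n. ennreal (cmod (cnj (coeff x n) * coeff (A (ket m)) n))))"
    by (intro suminf_le mult_left_mono norm_suminf summable_cinner) auto
  also have "\<dots> \<le> (\<Sum>m. ennreal (cmod (coeff x m)) * (\<Sum>n. ennreal (cmod (coeff x n)) * (ennreal (?q m / 2) + ennreal (?q n / 2))))"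
  proof (intro suminf_le mult_left_mono)
    fix m n
    have "cmod (cnj (coeff x n) * coeff (A (ket m)) n) \<le> cmod (coeff x n) * (?q m / 2 + ?q n / 2)"
      using mult_left_mono[OF entry[of m n], of "cmod (coeff x n)"] by (simp add: norm_mult add_divide_distrib)
    then have "ennreal (cmod (cnj (coeff x n) * coeff (A (ket m)) n)) \<le> ennreal (cmod (coeff x n) * (?q m / 2 + ?q n / 2))"
      by (rule ennreal_leI)
    also have "\<dots> = ennreal (cmod (coeff x n)) * (ennreal (?q m / 2) + ennreal (?q n / 2))"
      using D(4)[of "ket m"] D(4)[of "ket n"] by (simp add: ennreal_mult)
    finally show "ennreal (cmod (cnj (coeff x n) * coeff (A (ket m)) n))
      \<le> ennreal (cmod (coeff x n)) * (ennreal (?q m / 2) + ennreal (?q n / 2))" .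
  qed auto
  also have "\<dots> = (\<Sum>m. \<Sum>n. ennreal (cmod (coeff x m) * cmod (coeff x n)) * (ennreal (?q m / 2) + ennreal (?q n / 2)))"
    by (simp add: ennreal_mult mult.assoc)
  finally show ?thesis .
qed

context
  fixes \<rho> M l
  assumes rho: "density_operator \<rho>" and povm: "circle_povm M" and decomp: "state_decomp \<rho> l"
begin

text \<open>By triangularity all three sums end at k = m + n, so the finite Cauchy-Schwarz
  inequality applies.\<close>

lemma state_decomp_cauchy_schwarz:
  "(\<Sum>k. ennreal (cmod (coeff (l k) m) * cmod (coeff (l k) n)))
    \<le> ennreal (sqrt (photon_prob \<rho> m)) * ennreal (sqrt (photon_prob \<rho> n))"
proof -
  note D = state_decompD[OF decomp rho]
  have fin: "photon_prob \<rho> j = (\<Sum>k<Suc (m + n). (cmod (coeff (l k) j))\<^sup>2)" if "j \<le> m + n" for j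
    using sums_unique2[OF D(3)[of j] sums_finite[of "{..<Suc (m + n)}"]] that by (auto simp: D(1))
  have "(\<Sum>k. ennreal (cmod (coeff (l k) m) * cmod (coeff (l k) n)))
    = (\<Sum>k<Suc (m + n). ennreal (cmod (coeff (l k) m) * cmod (coeff (l k) n)))"
    by (rule suminf_finite) (auto simp: D(1))
  also have "\<dots> = ennreal (\<Sum>k<Suc (m + n). cmod (coeff (l k) m) * cmod (coeff (l k) n))"
    by (intro sum_ennreal) auto
  also have "\<dots> \<le> ennreal (sqrt (photon_prob \<rho> m) * sqrt (photon_prob \<rho> n))"
  proof (intro ennreal_leI)
    have "(\<Sum>k<Suc (m + n). cmod (coeff (l k) m) * cmod (coeff (l k) n))\<^sup>2 \<le> photon_prob \<rho> m * photon_prob \<rho> n"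
      using Cauchy_Schwarz_ineq_sum[of "\<lambda>k. cmod (coeff (l k) m)" "\<lambda>k. cmod (coeff (l k) n)" "{..<Suc (m + n)}"]
      by (simp only: fin[of m] fin[of n])
    from real_sqrt_le_mono[OF this]
    show "(\<Sum>k<Suc (m + n). cmod (coeff (l k) m) * cmod (coeff (l k) n)) \<le> sqrt (photon_prob \<rho> m) * sqrt (photon_prob \<rho> n)"
      by (simp add: real_sqrt_mult sum_nonneg)
  qed
  also have "\<dots> = ennreal (sqrt (photon_prob \<rho> m)) * ennreal (sqrt (photon_prob \<rho> n))"
    using photon_prob_sums(2)[OF rho] by (simp add: ennreal_mult)
  finally show ?thesis .
qed

text \<open>Taking moduli removes the phases, so the dominating measure does not depend on \<theta>;
  the later average relies on this. By symmetry in m and n, the double sum with the mean of two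
  diagonal terms factors.\<close>

lemma emeasure_outcome_dist_le:
  assumes B: "B \<in> sets circle"
  shows "emeasure (outcome_dist \<rho> M \<theta>) B
    \<le> (\<Sum>n. ennreal (sqrt (photon_prob \<rho> n))) * (\<Sum>n. ennreal (sqrt (photon_prob \<rho> n)) * emeasure (povm_dist M (ket n)) B)"
proof -
  note A = positive_operator_povm[OF povm B]
  define q where "q m = Re (cinner (ket m) (M B (ket m)))" for m
  have q: "q m \<ge> 0" for m unfolding q_def by (rule positive_formD(4)[OF povm_form[OF povm B]])
  define s where "s m = ennreal (sqrt (photon_prob \<rho> m))" for m
  define h where "h m = ennreal (q m / 2)" for m
  have h: "h m + h m = ennreal (q m)" for m
    using q[of m] unfolding h_def by (subst ennreal_plus[symmetric]) auto
  have "emeasure (outcome_dist \<rho> M \<theta>) B \<le> (\<Sum>k. \<Sum>m. \<Sum>n. ennreal (cmod (coeff (l k) m) * cmod (coeff (l k) n)) * (h m + h n))"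
    unfolding emeasure_outcome_dist[OF rho povm decomp B] emeasure_povm_dist[OF povm B]
  proof (rule suminf_le)
    show "ennreal (Re (cinner (phase_shift \<theta> (l k)) (M B (phase_shift \<theta> (l k)))))
      \<le> (\<Sum>m. \<Sum>n. ennreal (cmod (coeff (l k) m) * cmod (coeff (l k) n)) * (h m + h n))" for k
      using positive_form_ket_ennreal[OF A, of "phase_shift \<theta> (l k)"]
      by (simp add: coeff_phase_shift norm_mult h_def q_def)
  qed auto
  also have "\<dots> = (\<Sum>m. \<Sum>k. \<Sum>n. ennreal (cmod (coeff (l k) m) * cmod (coeff (l k) n)) * (h m + h n))"
    by (rule suminf_commute_ennreal)
  also have "\<dots> = (\<Sum>m. \<Sum>n. \<Sum>k. ennreal (cmod (coeff (l k) m) * cmod (coeff (l k) n)) * (h m + h n))"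
    by (intro arg_cong[where f = suminf] ext suminf_commute_ennreal)
  also have "\<dots> \<le> (\<Sum>m. \<Sum>n. s m * s n * (h m + h n))"
    unfolding s_def using state_decomp_cauchy_schwarz
    by (intro suminf_le) (auto intro!: mult_right_mono)
  also have "\<dots> = (\<Sum>m. \<Sum>n. s m * (s n * h n) + (s m * h m) * s n)"
  proof -
    have "s m * s n * (h m + h n) = s m * (s n * h n) + (s m * h m) * s n" for m n
      unfolding distrib_left by (simp only: ac_simps)
    then show ?thesis by simp
  qed
  also have "\<dots> = (\<Sum>m. s m * (\<Sum>n. s n * h n) + (s m * h m) * (\<Sum>n. s n))"
    by (simp add: suminf_add[symmetric])
  also have "\<dots> = (\<Sum>m. s m) * (\<Sum>n. s n * h n) + (\<Sum>m. s m * h m) * (\<Sum>n. s n)"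
    by (simp add: suminf_add[symmetric])
  also have "\<dots> = (\<Sum>m. s m) * (\<Sum>n. s n * (h n + h n))"
    by (simp add: suminf_add[symmetric] distrib_left mult.commute)
  also have "\<dots> = (\<Sum>n. ennreal (sqrt (photon_prob \<rho> n))) * (\<Sum>n. s n * emeasure (povm_dist M (ket n)) B)"
    unfolding emeasure_povm_dist[OF povm B] h q_def s_def ..
  finally show ?thesis by (simp add: s_def)
qed

lemma error_dist_le_L_half:
  fixes g :: "real \<Rightarrow> ennreal"
  assumes [measurable]: "g \<in> borel_measurable borel"
  shows "(\<integral>\<^sup>+e. g e \<partial>error_dist \<rho> M) \<le> L_half \<rho> * (\<integral>\<^sup>+e. g e \<partial>uniform_prior)"
proof -
  define s where "s n = ennreal (sqrt (photon_prob \<rho> n))" for n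
  have "(\<integral>\<^sup>+t. g (wrap_angle (t - \<theta>)) \<partial>outcome_dist \<rho> M \<theta>)
      \<le> (\<Sum>n. (\<Sum>n. s n) * s n * (\<integral>\<^sup>+t. g (wrap_angle (t - \<theta>)) \<partial>povm_dist M (ket n)))" for \<theta>
  proof (rule nn_integral_le_suminf)
    show "emeasure (outcome_dist \<rho> M \<theta>) B \<le> (\<Sum>n. (\<Sum>n. s n) * s n * emeasure (povm_dist M (ket n)) B)"
      if "B \<in> sets (outcome_dist \<rho> M \<theta>)" for B
      using emeasure_outcome_dist_le[of B \<theta>] that by (simp add: s_def mult.assoc)
    show "(\<lambda>t. g (wrap_angle (t - \<theta>))) \<in> borel_measurable (outcome_dist \<rho> M \<theta>)"
      by (simp add: measurable_cong_sets[OF sets_outcome_dist refl] measurable_circle)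
  qed simp
  then have "(\<integral>\<^sup>+e. g e \<partial>error_dist \<rho> M)
      \<le> (\<integral>\<^sup>+\<theta>. (\<Sum>n. (\<Sum>n. s n) * s n * (\<integral>\<^sup>+t. g (wrap_angle (t - \<theta>)) \<partial>povm_dist M (ket n))) \<partial>uniform_prior)"
    unfolding nn_integral_error_dist[OF rho povm decomp assms] by (intro nn_integral_mono)
  also have "\<dots> = (\<Sum>n. (\<Sum>n. s n) * s n * (\<integral>\<^sup>+\<theta>. \<integral>\<^sup>+t. g (wrap_angle (t - \<theta>)) \<partial>povm_dist M (ket n) \<partial>uniform_prior))"
  proof -
    note [measurable] = measurable_povm_dist_rotate[OF assms povm]
    show ?thesis by (subst nn_integral_suminf) (simp_all add: nn_integral_cmult)
  qed
  also have "\<dots> = (\<Sum>n. (\<Sum>n. s n) * s n * (\<integral>\<^sup>+e. g e \<partial>uniform_prior))"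
    by (simp add: nn_integral_povm_dist_rotate[OF assms povm])
  also have "\<dots> = L_half \<rho> * (\<integral>\<^sup>+e. g e \<partial>uniform_prior)"
    by (simp add: L_half_def s_def[symmetric] power2_eq_square)
  finally show ?thesis .
qed

end

context
  fixes \<rho> M l
  assumes rho: "density_operator \<rho>" and povm: "circle_povm M" and decomp: "state_decomp \<rho> l"
begin

lemma nn_integral_error_dist_const: "(\<integral>\<^sup>+e. c \<partial>error_dist \<rho> M) = c"
proof -
  interpret prob_space uniform_prior by (rule prob_space_uniform_prior)
  have "(\<integral>\<^sup>+e. c \<partial>error_dist \<rho> M) = (\<integral>\<^sup>+\<theta>. c \<partial>uniform_prior)"
    using prob_space.emeasure_space_1[OF prob_space_outcome_dist[OF rho povm decomp]]
    by (subst nn_integral_error_dist[OF rho povm decomp, of "\<lambda>_. c"]) simp_all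
  also have "\<dots> = c" using emeasure_space_1 by simp
  finally show ?thesis .
qed

text \<open>The wrapped error is bounded by \<pi>, so the nonnegative integral is finite. The real
  integral in the definition of \<open>RMSE\<close> then has its true value rather than the default
  0.\<close>

lemma RMSE_square: "ennreal ((RMSE \<rho> M)\<^sup>2) = (\<integral>\<^sup>+e. ennreal (e\<^sup>2) \<partial>error_dist \<rho> M)"
proof -
  have "(\<integral>\<^sup>+e. ennreal (e\<^sup>2) \<partial>error_dist \<rho> M)
      \<le> (\<integral>\<^sup>+\<theta>. \<integral>\<^sup>+t. ennreal (pi\<^sup>2) \<partial>outcome_dist \<rho> M \<theta> \<partial>uniform_prior)"
    unfolding nn_integral_error_dist[OF rho povm decomp, of "\<lambda>e. ennreal (e\<^sup>2)", simplified]
  proof (intro nn_integral_mono ennreal_leI)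
    show "(wrap_angle (t - \<theta>))\<^sup>2 \<le> pi\<^sup>2" for t \<theta>
      using wrap_angle_range[of "t - \<theta>"] by (subst abs_le_square_iff[symmetric]) auto
  qed
  also have "\<dots> = (\<integral>\<^sup>+e. ennreal (pi\<^sup>2) \<partial>error_dist \<rho> M)"
    by (rule nn_integral_error_dist[OF rho povm decomp, symmetric]) simp
  also have "\<dots> = ennreal (pi\<^sup>2)"
    by (rule nn_integral_error_dist_const)
  finally have "(\<integral>\<^sup>+e. ennreal (e\<^sup>2) \<partial>error_dist \<rho> M) < \<top>"
    by (rule order_le_less_trans) simp
  moreover have "(\<integral>e. e\<^sup>2 \<partial>error_dist \<rho> M) = enn2real (\<integral>\<^sup>+e. ennreal (e\<^sup>2) \<partial>error_dist \<rho> M)"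
    by (intro integral_eq_nn_integral) (auto simp: measurable_cong_sets[OF sets_error_dist refl])
  ultimately show ?thesis
    by (simp add: RMSE_def)
qed

lemma RMSE_nonneg: "RMSE \<rho> M \<ge> 0"
  unfolding RMSE_def by (intro real_sqrt_ge_zero integral_nonneg) simp

lemma nn_integral_parabola:
  assumes "R \<ge> 0"
  shows "(\<integral>\<^sup>+e. ennreal (R\<^sup>2 - e\<^sup>2) \<partial>lborel) = ennreal (4 / 3 * R ^ 3)"
proof -
  have "(\<integral>\<^sup>+e. ennreal (R\<^sup>2 - e\<^sup>2) \<partial>lborel) = (\<integral>\<^sup>+e. ennreal (R\<^sup>2 - e\<^sup>2) * indicator {-R..R} e \<partial>lborel)"
  proof (intro nn_integral_cong)
    fix e :: real
    have "R\<^sup>2 - e\<^sup>2 \<le> 0" if "e \<notin> {-R..R}"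
      using that assms abs_le_square_iff[of R e] by auto
    then show "ennreal (R\<^sup>2 - e\<^sup>2) = ennreal (R\<^sup>2 - e\<^sup>2) * indicator {-R..R} e"
      by (auto split: split_indicator simp: ennreal_neg)
  qed
  also have "\<dots> = ennreal ((R\<^sup>2 * R - R ^ 3 / 3) - (R\<^sup>2 * (-R) - (-R) ^ 3 / 3))"
  proof (rule nn_integral_FTC_Icc)
    fix x assume x: "x \<in> {-R..R}"
    show "((\<lambda>e. R\<^sup>2 * e - e ^ 3 / 3) has_real_derivative R\<^sup>2 - x\<^sup>2) (at x)"
      by (auto intro!: derivative_eq_intros)
    show "0 \<le> R\<^sup>2 - x\<^sup>2"
      using x abs_le_square_iff[of x R] by auto
  qed (use assms in auto)
  also have "(R\<^sup>2 * R - R ^ 3 / 3) - (R\<^sup>2 * (-R) - (-R) ^ 3 / 3) = 4 / 3 * R ^ 3"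
    by (simp add: power2_eq_square power3_eq_cube)
  finally show ?thesis .
qed

lemma L_half_pos: "L_half \<rho> \<noteq> 0"
proof
  assume "L_half \<rho> = 0"
  then have "photon_prob \<rho> n = 0" for n
    using photon_prob_sums(2)[OF rho, of n]
    by (intro antisym) (simp_all add: L_half_def suminf_eq_zero_iff ennreal_eq_0_iff)
  with photon_prob_sums(1)[OF rho] have "(\<lambda>n. 0 :: real) sums 1" by (simp add: sums_def)
  then show False using sums_unique2[OF sums_zero] by fastforce
qed

text \<open>
  Among the densities bounded by \<open>L / 2\<pi>\<close> the uniform density on \<open>[-\<pi>/L, \<pi>/L]\<close> minimises the variance;
  \<open>R\<^sup>2 - e\<^sup>2\<close>, which \<^const>\<open>ennreal\<close> truncates at \<open>0\<close>, is the dual certificate.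
\<close>

lemma RMSE_ge_L_half: "ennreal (pi / sqrt 3) / L_half \<rho> \<le> ennreal (RMSE \<rho> M)"
proof (cases "L_half \<rho>")
  case (real L)
  with L_half_pos have L: "L > 0" by (cases "L = 0") auto
  define R where "R = pi / L"
  have R: "R > 0" using L by (simp add: R_def)
  have "(\<integral>\<^sup>+e. ennreal (R\<^sup>2 - e\<^sup>2) \<partial>uniform_prior)
      = ennreal (1 / (2 * pi)) * (\<integral>\<^sup>+e. ennreal (R\<^sup>2 - e\<^sup>2) * indicator {-pi..<pi} e \<partial>lborel)"
    by (rule nn_integral_uniform_prior) simp
  also have "\<dots> \<le> ennreal (1 / (2 * pi)) * (\<integral>\<^sup>+e. ennreal (R\<^sup>2 - e\<^sup>2) \<partial>lborel)"
    by (intro mult_left_mono nn_integral_mono) (auto split: split_indicator)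
  also have "\<dots> = ennreal (1 / (2 * pi) * (4 / 3 * R ^ 3))"
    unfolding nn_integral_parabola[OF less_imp_le[OF R]] using R by (intro ennreal_mult[symmetric]) auto
  finally have U: "(\<integral>\<^sup>+e. ennreal (R\<^sup>2 - e\<^sup>2) \<partial>uniform_prior) \<le> ennreal (1 / (2 * pi) * (4 / 3 * R ^ 3))" .
  have "(\<integral>\<^sup>+e. ennreal (R\<^sup>2 - e\<^sup>2) \<partial>error_dist \<rho> M) \<le> L_half \<rho> * (\<integral>\<^sup>+e. ennreal (R\<^sup>2 - e\<^sup>2) \<partial>uniform_prior)"
    by (intro error_dist_le_L_half[OF rho povm decomp]) simp
  also have "\<dots> \<le> L_half \<rho> * ennreal (1 / (2 * pi) * (4 / 3 * R ^ 3))"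
    using U by (rule mult_left_mono) simp
  also have "\<dots> = ennreal (L * (1 / (2 * pi) * (4 / 3 * R ^ 3)))"
    unfolding real(2) using R L by (intro ennreal_mult[symmetric]) auto
  also have "L * (1 / (2 * pi) * (4 / 3 * R ^ 3)) = 2 / 3 * R\<^sup>2"
    using L by (simp add: R_def power2_eq_square power3_eq_cube)
  finally have G: "(\<integral>\<^sup>+e. ennreal (R\<^sup>2 - e\<^sup>2) \<partial>error_dist \<rho> M) \<le> ennreal (2 / 3 * R\<^sup>2)" .
  have "ennreal (R\<^sup>2) = (\<integral>\<^sup>+e. ennreal (R\<^sup>2) \<partial>error_dist \<rho> M)"
    by (simp only: nn_integral_error_dist_const)
  also have "\<dots> \<le> (\<integral>\<^sup>+e. ennreal (e\<^sup>2) + ennreal (R\<^sup>2 - e\<^sup>2) \<partial>error_dist \<rho> M)"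
  proof (intro nn_integral_mono)
    show "ennreal (R\<^sup>2) \<le> ennreal (e\<^sup>2) + ennreal (R\<^sup>2 - e\<^sup>2)" for e
      by (cases "e\<^sup>2 \<le> R\<^sup>2") (auto simp: ennreal_neg intro: ennreal_leI simp flip: ennreal_plus)
  qed
  also have "\<dots> = ennreal ((RMSE \<rho> M)\<^sup>2) + (\<integral>\<^sup>+e. ennreal (R\<^sup>2 - e\<^sup>2) \<partial>error_dist \<rho> M)"
    unfolding RMSE_square by (intro nn_integral_add) (auto simp: measurable_cong_sets[OF sets_error_dist refl])
  also have "\<dots> \<le> ennreal ((RMSE \<rho> M)\<^sup>2) + ennreal (2 / 3 * R\<^sup>2)"
    using G by (rule add_left_mono)
  also have "ennreal ((RMSE \<rho> M)\<^sup>2) + ennreal (2 / 3 * R\<^sup>2) = ennreal ((RMSE \<rho> M)\<^sup>2 + 2 / 3 * R\<^sup>2)"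
    by simp
  finally have "R\<^sup>2 \<le> (RMSE \<rho> M)\<^sup>2 + 2 / 3 * R\<^sup>2"
    by (subst (asm) ennreal_le_iff) auto
  then have "(R / sqrt 3)\<^sup>2 \<le> (RMSE \<rho> M)\<^sup>2"
    by (simp add: power_divide)
  then have "R / sqrt 3 \<le> RMSE \<rho> M"
    using RMSE_nonneg by (rule power2_le_imp_le)
  moreover have "ennreal (pi / sqrt 3) / L_half \<rho> = ennreal (R / sqrt 3)"
    unfolding real(2) using L by (simp add: divide_ennreal R_def)
  ultimately show ?thesis by (simp add: ennreal_leI)
qed simp

end

section \<open>The dual inequality and the largest photon probability\<close>

text \<open>The summands may be negative and are truncated by \<open>ennreal\<close>; the set
  function \<open>D\<close> of the next estimate has no fixed sign.\<close>

lemma ennreal_sum_le: "ennreal (sum f A) \<le> (\<Sum>x\<in>A. ennreal (f x))"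
proof (induction A rule: infinite_finite_induct)
  case (insert x A)
  have "ennreal (f x + sum f A) \<le> ennreal (f x) + ennreal (sum f A)"
    by (cases "f x \<ge> 0"; cases "sum f A \<ge> 0") (auto simp: ennreal_neg intro: ennreal_leI simp flip: ennreal_plus)
  also have "\<dots> \<le> ennreal (f x) + (\<Sum>x\<in>A. ennreal (f x))"
    using insert by (intro add_left_mono)
  finally show ?case using insert by simp
qed simp_all

lemma geometric_level:
  fixes q w :: real
  assumes "q > 1" "w \<ge> 1"
  defines "i \<equiv> nat \<lfloor>log q w\<rfloor>"
  shows "q ^ i \<le> w" "w < q * q ^ i"
proof -
  have "log q w \<ge> 0" using assms by simp
  then have i: "real i \<le> log q w" "log q w < real i + 1" unfolding i_def by linarith+
  have "q powr real i \<le> w" using i(1) assms(1,2) by (subst (asm) le_log_iff) auto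
  then show "q ^ i \<le> w" using assms(1,2) by (simp only: powr_realpow)
  have "w < q powr (real i + 1)" using i(2) assms(1,2) by (subst (asm) log_less_iff) auto
  moreover have "q powr (real i + 1) = q * q ^ i" using assms(1,2) by (simp only: powr_realpow powr_add powr_one mult.commute)
  ultimately show "w < q * q ^ i" by simp
qed

text \<open>
  A quadratic inequality between set functions holds with the constant \<open>c\<close> replaced by a function \<open>1 / w\<close>:
  the space is cut into sets on which \<open>w\<close> varies by at most a factor \<open>q\<close>, and \<open>q\<close> tends to \<open>1\<close>.
\<close>

lemma nn_integral_quadratic_bound:
  fixes K N :: "'a measure" and w :: "'a \<Rightarrow> real"
  assumes "finite_measure K" "finite_measure N" and sets: "sets N = sets K"
    and w [measurable]: "w \<in> borel_measurable K" and w1: "\<And>x. w x \<ge> 1" and v: "v \<ge> 0"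
    and D: "\<And>B :: nat \<Rightarrow> 'a set. range B \<subseteq> sets K \<Longrightarrow> disjoint_family B \<Longrightarrow> (\<lambda>i. D (B i)) sums D (\<Union>i. B i)"
    and quad: "\<And>c B. c > 0 \<Longrightarrow> B \<in> sets K \<Longrightarrow> 2 * c * D B \<le> measure K B + c\<^sup>2 * v * measure N B"
  shows "ennreal (2 * D (space K)) \<le> (\<integral>\<^sup>+x. ennreal (w x) \<partial>K) + ennreal v * (\<integral>\<^sup>+x. ennreal (1 / w x) \<partial>N)"
proof -
  interpret K: finite_measure K by fact
  interpret N: finite_measure N by fact
  have spaces: "space N = space K" by (rule sets_eq_imp_space_eq[OF sets])
  have wN [measurable]: "w \<in> borel_measurable N" using w by (simp add: measurable_cong_sets[OF sets refl])
  define I where "I = (\<integral>\<^sup>+x. ennreal (w x) \<partial>K)"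
  define J where "J = (\<integral>\<^sup>+x. ennreal (1 / w x) \<partial>N)"
  have bound: "ennreal (2 * D (space K)) \<le> I + ennreal v * (ennreal q * J)" if q: "q > 1" for q :: real
  proof -
    define B where "B i = {x \<in> space K. nat \<lfloor>log q (w x)\<rfloor> = i}" for i
    have [measurable]: "B i \<in> sets K" for i unfolding B_def by measurable
    then have [measurable]: "B i \<in> sets N" for i using sets by simp
    have dis: "disjoint_family B" by (auto simp: disjoint_family_on_def B_def)
    have un: "(\<Union>i. B i) = space K" by (auto simp: B_def)
    have qi: "q ^ i > 0" for i using q by simp
    have piece: "ennreal (2 * D (B i)) \<le> (\<integral>\<^sup>+x\<in>B i. ennreal (w x) \<partial>K) + ennreal v * (ennreal q * (\<integral>\<^sup>+x\<in>B i. ennreal (1 / w x) \<partial>N))" for i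
    proof -
      \<comment> \<open>On \<open>B i\<close> the function 1 / w is within a factor q of this
        constant c. Multiplication by \<open>q ^ i\<close> turns the two measures into lower Riemann
        pieces of w and, up to the factor q, of 1 / w.\<close>
      have "2 * (1 / q ^ i) * D (B i) \<le> measure K (B i) + (1 / q ^ i)\<^sup>2 * v * measure N (B i)"
        using qi by (intro quad) auto
      from mult_left_mono[OF this less_imp_le[OF qi[of i]]]
      have "2 * D (B i) \<le> q ^ i * measure K (B i) + v * (1 / q ^ i * measure N (B i))"
      proof -
        define Q where "Q = q ^ i"
        have "Q > 0" unfolding Q_def by (rule qi)
        then have "Q * (2 * (1 / Q) * D (B i)) = 2 * D (B i)"
          "Q * (measure K (B i) + (1 / Q)\<^sup>2 * v * measure N (B i)) = Q * measure K (B i) + v * (1 / Q * measure N (B i))"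
          by (simp_all add: distrib_left power2_eq_square)
        then show ?thesis
          using \<open>q ^ i * (2 * (1 / q ^ i) * D (B i)) \<le> _\<close> unfolding Q_def[symmetric] by (simp only:)
      qed
      then have "ennreal (2 * D (B i)) \<le> ennreal (q ^ i * measure K (B i) + v * (1 / q ^ i * measure N (B i)))"
        by (rule ennreal_leI)
      also have "\<dots> = ennreal (q ^ i) * emeasure K (B i) + ennreal v * (ennreal (1 / q ^ i) * emeasure N (B i))"
        unfolding K.emeasure_eq_measure N.emeasure_eq_measure
        using q v by (simp add: ennreal_mult[symmetric])
      finally have "ennreal (2 * D (B i))
        \<le> ennreal (q ^ i) * emeasure K (B i) + ennreal v * (ennreal (1 / q ^ i) * emeasure N (B i))" .
      moreover have "ennreal (q ^ i) * emeasure K (B i) \<le> (\<integral>\<^sup>+x\<in>B i. ennreal (w x) \<partial>K)"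
      proof -
      have "ennreal (q ^ i) * emeasure K (B i) = (\<integral>\<^sup>+x\<in>B i. ennreal (q ^ i) \<partial>K)"
        by (simp add: nn_integral_cmult_indicator)
      also have "\<dots> \<le> (\<integral>\<^sup>+x\<in>B i. ennreal (w x) \<partial>K)"
        using geometric_level(1)[OF q w1]
        by (intro nn_integral_mono) (auto split: split_indicator simp: B_def intro!: ennreal_leI)
      finally show ?thesis .
      qed
      moreover have "ennreal (1 / q ^ i) * emeasure N (B i) \<le> ennreal q * (\<integral>\<^sup>+x\<in>B i. ennreal (1 / w x) \<partial>N)"
      proof -
      have "ennreal (1 / q ^ i) * emeasure N (B i) = (\<integral>\<^sup>+x\<in>B i. ennreal (1 / q ^ i) \<partial>N)"
        by (simp add: nn_integral_cmult_indicator)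
      also have "\<dots> \<le> (\<integral>\<^sup>+x. ennreal q * (ennreal (1 / w x) * indicator (B i) x) \<partial>N)"
      proof (intro nn_integral_mono)
        fix x
        have "1 / q ^ i \<le> q * (1 / w x)" if "x \<in> B i"
        proof -
          have "w x < q * q ^ i" using geometric_level(2)[OF q w1, of x] that by (auto simp: B_def)
          moreover have "w x > 0" using w1[of x] by linarith
          ultimately show ?thesis using qi[of i] by (simp add: divide_simps)
        qed
        then show "ennreal (1 / q ^ i) * indicator (B i) x \<le> ennreal q * (ennreal (1 / w x) * indicator (B i) x)"
          using q w1[of x] by (auto split: split_indicator simp: ennreal_mult[symmetric] intro!: ennreal_leI)
      qed
      also have "\<dots> = ennreal q * (\<integral>\<^sup>+x\<in>B i. ennreal (1 / w x) \<partial>N)"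
        by (intro nn_integral_cmult) measurable
      finally show ?thesis .
      qed
      ultimately show ?thesis
        by (meson add_mono mult_left_mono order_trans zero_le)
    qed
    have "range B \<subseteq> sets K" by auto
    then have "(\<lambda>n. \<Sum>i<n. 2 * D (B i)) \<longlonglongrightarrow> 2 * D (space K)"
      using sums_mult[OF D[of B], of 2] dis un unfolding sums_def by auto
    then have "(\<lambda>n. ennreal (\<Sum>i<n. 2 * D (B i))) \<longlonglongrightarrow> ennreal (2 * D (space K))"
      by (rule tendsto_ennrealI)
    then show ?thesis
    proof (rule LIMSEQ_le_const2)
      show "\<exists>n0. \<forall>n\<ge>n0. ennreal (\<Sum>i<n. 2 * D (B i)) \<le> I + ennreal v * (ennreal q * J)"
      proof (intro exI allI impI)
        fix n
        have "ennreal (\<Sum>i<n. 2 * D (B i)) \<le> (\<Sum>i<n. ennreal (2 * D (B i)))"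
          by (rule ennreal_sum_le)
        also have "\<dots> \<le> (\<Sum>i<n. (\<integral>\<^sup>+x\<in>B i. ennreal (w x) \<partial>K) + ennreal v * (ennreal q * (\<integral>\<^sup>+x\<in>B i. ennreal (1 / w x) \<partial>N)))"
          by (intro sum_mono piece)
        also have "\<dots> \<le> (\<Sum>i. (\<integral>\<^sup>+x\<in>B i. ennreal (w x) \<partial>K) + ennreal v * (ennreal q * (\<integral>\<^sup>+x\<in>B i. ennreal (1 / w x) \<partial>N)))"
          by (rule sum_le_suminf) auto
        also have "\<dots> = (\<Sum>i. \<integral>\<^sup>+x\<in>B i. ennreal (w x) \<partial>K) + ennreal v * (ennreal q * (\<Sum>i. \<integral>\<^sup>+x\<in>B i. ennreal (1 / w x) \<partial>N))"
          by (simp add: suminf_add[symmetric])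
        also have "(\<Sum>i. \<integral>\<^sup>+x\<in>B i. ennreal (w x) \<partial>K) = (\<integral>\<^sup>+x\<in>(\<Union>i. B i). ennreal (w x) \<partial>K)"
          using dis by (intro nn_integral_disjoint_family[symmetric]) auto
        also have "\<dots> = I" unfolding un I_def by (intro nn_integral_cong) auto
        also have "(\<Sum>i. \<integral>\<^sup>+x\<in>B i. ennreal (1 / w x) \<partial>N) = (\<integral>\<^sup>+x\<in>(\<Union>i. B i). ennreal (1 / w x) \<partial>N)"
          using dis by (intro nn_integral_disjoint_family[symmetric]) auto
        also have "\<dots> = J" unfolding un J_def by (intro nn_integral_cong) (auto simp: spaces)
        finally show "ennreal (\<Sum>i<n. 2 * D (B i)) \<le> I + ennreal v * (ennreal q * J)" .
      qed
    qed
  qed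
  \<comment> \<open>J is finite because w \<ge> 1 and N is finite; this allows the limit q = 1 + 1 /
    (n + 1) \<rightarrow> 1 in the product with J.\<close>
  have "J \<le> (\<integral>\<^sup>+x. 1 \<partial>N)"
  proof -
    have "1 / w x \<le> 1" for x using w1[of x] by simp
    then show ?thesis unfolding J_def by (intro nn_integral_mono) (simp add: ennreal_le_1)
  qed
  also have "\<dots> < \<top>" using N.emeasure_finite[of "space N"] by (simp add: less_top[symmetric])
  finally obtain j where j: "J = ennreal j" "j \<ge> 0" by (cases J) auto
  have "(\<lambda>n. I + ennreal (v * ((1 + 1 / real (Suc n)) * j))) \<longlonglongrightarrow> I + ennreal (v * (1 * j))"
    by (intro tendsto_add tendsto_ennrealI tendsto_mult tendsto_const) (real_asymp)
  then have "ennreal (2 * D (space K)) \<le> I + ennreal (v * (1 * j))"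
  proof (rule LIMSEQ_le_const)
    show "\<exists>n0. \<forall>n\<ge>n0. ennreal (2 * D (space K)) \<le> I + ennreal (v * ((1 + 1 / real (Suc n)) * j))"
    proof (intro exI allI impI)
      fix n
      show "ennreal (2 * D (space K)) \<le> I + ennreal (v * ((1 + 1 / real (Suc n)) * j))"
        using bound[of "1 + 1 / real (Suc n)"] j v by (simp add: ennreal_mult del: ennreal_plus)
    qed
  qed
  then show ?thesis using v j by (simp add: I_def[symmetric] J_def[symmetric] ennreal_mult)
qed

text \<open>The bound is 1 / (2 \<pi>) times the integral over the whole line, which is \<pi>
  p.\<close>

lemma nn_integral_lorentzian:
  assumes p: "p > 0"
  shows "(\<integral>\<^sup>+e. ennreal (1 / (1 + e\<^sup>2 / p\<^sup>2)) \<partial>uniform_prior) \<le> ennreal (p / 2)"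
proof -
  have pos: "1 + e\<^sup>2 / p\<^sup>2 > 0" for e by (intro add_pos_nonneg) auto
  have "(\<integral>\<^sup>+e. ennreal (1 / (1 + e\<^sup>2 / p\<^sup>2)) \<partial>uniform_prior)
    = ennreal (1 / (2 * pi)) * (\<integral>\<^sup>+e. ennreal (1 / (1 + e\<^sup>2 / p\<^sup>2)) * indicator {-pi..<pi} e \<partial>lborel)"
    by (rule nn_integral_uniform_prior) simp
  also have "\<dots> \<le> ennreal (1 / (2 * pi)) * (\<integral>\<^sup>+e. ennreal (1 / (1 + e\<^sup>2 / p\<^sup>2)) * indicator {-pi..pi} e \<partial>lborel)"
    by (intro mult_left_mono nn_integral_mono) (auto split: split_indicator)
  also have "(\<integral>\<^sup>+e. ennreal (1 / (1 + e\<^sup>2 / p\<^sup>2)) * indicator {-pi..pi} e \<partial>lborel)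
    = ennreal (p * arctan (pi / p) - p * arctan (- pi / p))"
  proof (rule nn_integral_FTC_Icc)
    fix e :: real
    have "p\<^sup>2 + e\<^sup>2 > 0" using p by (intro add_pos_nonneg) auto
    then show "((\<lambda>e. p * arctan (e / p)) has_real_derivative 1 / (1 + e\<^sup>2 / p\<^sup>2)) (at e)"
      using p by (auto intro!: derivative_eq_intros simp: divide_simps power2_eq_square)
    show "0 \<le> 1 / (1 + e\<^sup>2 / p\<^sup>2)" using pos[of e] by simp
  qed auto
  also have "ennreal (1 / (2 * pi)) * \<dots> = ennreal (1 / (2 * pi) * (2 * p * arctan (pi / p)))"
    using p by (subst ennreal_mult) (auto simp: arctan_minus mult.assoc)
  also have "\<dots> \<le> ennreal (p / 2)"
  proof (rule ennreal_leI)
    have "2 * p * arctan (pi / p) \<le> 2 * p * (pi / 2)"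
      using p arctan_ubound[of "pi / p"] by (intro mult_left_mono) auto
    then show "1 / (2 * pi) * (2 * p * arctan (pi / p)) \<le> p / 2"
      by (simp add: field_simps)
  qed
  finally show ?thesis .
qed

context
  fixes \<rho> M l
  assumes rho: "density_operator \<rho>" and povm: "circle_povm M" and decomp: "state_decomp \<rho> l"
begin

lemma coeff_shifted_state_ket: "coeff (shifted_state \<rho> \<theta> (ket n)) n = of_real (photon_prob \<rho> n)"
proof -
  note D = state_decompD[OF decomp rho]
  have "photon_prob \<rho> n = (\<Sum>k\<le>n. (cmod (coeff (l k) n))\<^sup>2)"
    by (rule sums_unique2[OF D(3) sums_finite]) (auto simp: D(1))
  moreover have "coeff (phase_shift \<theta> (l k)) n * cinner (phase_shift \<theta> (l k)) (ket n)
      = of_real ((cmod (coeff (l k) n))\<^sup>2)" for k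
  proof -
    have "cinner (phase_shift \<theta> (l k)) (ket n) = cnj (coeff (phase_shift \<theta> (l k)) n)"
      by (subst cinner_commute) (simp add: cinner_ket)
    then show ?thesis
      by (simp only: complex_norm_square[symmetric]) (simp add: coeff_phase_shift norm_mult)
  qed
  ultimately show ?thesis by (simp add: coeff_shifted_state[OF decomp rho])
qed

lemma measure_outcome_dist:
  assumes "B \<in> sets circle"
  shows "(\<lambda>k. Re (cinner (phase_shift \<theta> (l k)) (M B (phase_shift \<theta> (l k))))) sums measure (outcome_dist \<rho> M \<theta>) B"
proof -
  note sums = state_decomp_trace[OF decomp rho positive_operator_povm[OF povm assms], of \<theta>]
  have "0 \<le> Re (op_trace (shifted_state \<rho> \<theta> \<circ> M B))"
    by (rule sums_le[OF _ sums_zero sums]) (rule positive_formD(4)[OF povm_form[OF povm assms]])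
  moreover have "emeasure (outcome_dist \<rho> M \<theta>) B = ennreal (Re (op_trace (shifted_state \<rho> \<theta> \<circ> M B)))"
    by (simp only: emeasure_outcome_dist[OF rho povm decomp assms] outcome_trace[OF rho povm decomp assms])
  ultimately have "measure (outcome_dist \<rho> M \<theta>) B = Re (op_trace (shifted_state \<rho> \<theta> \<circ> M B))"
    by (simp add: measure_def)
  with sums show ?thesis by simp
qed

lemma measure_povm_dist:
  assumes "B \<in> sets circle"
  shows "measure (povm_dist M x) B = Re (cinner x (M B x))"
  using emeasure_povm_dist[OF povm assms, of x] positive_formD(4)[OF povm_form[OF povm assms], of x]
  by (simp add: measure_def)

text \<open>Positivity of \<open>M B\<close> at the vectors \<open>a - c \<langle>n|a\<rangle> |n\<rangle>\<close>, for the vectors \<open>a\<close> in the decomposition of the shifted state.\<close>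

lemma outcome_dist_quadratic:
  assumes B: "B \<in> sets circle"
  shows "2 * c * Re (coeff (shifted_state \<rho> \<theta> (M B (ket n))) n)
    \<le> measure (outcome_dist \<rho> M \<theta>) B + c\<^sup>2 * photon_prob \<rho> n * measure (povm_dist M (ket n)) B"
proof -
  note D = state_decompD[OF decomp rho] and F = povm_form[OF povm B]
  define a where "a k = phase_shift \<theta> (l k)" for k
  have a: "cmod (coeff (a k) n) = cmod (coeff (l k) n)" for k
    by (simp add: a_def coeff_phase_shift norm_mult)
  define r where "r k = Re (coeff (a k) n * cinner (a k) (M B (ket n)))" for k
  have "(\<lambda>k. r k) sums (\<Sum>k\<le>n. r k)"
    by (rule sums_finite) (auto simp: r_def a_def coeff_phase_shift D(1))
  moreover have "(\<Sum>k\<le>n. r k) = Re (coeff (shifted_state \<rho> \<theta> (M B (ket n))) n)"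
    by (simp add: coeff_shifted_state[OF decomp rho] r_def a_def)
  ultimately have r: "r sums Re (coeff (shifted_state \<rho> \<theta> (M B (ket n))) n)" by simp
  have "0 \<le> Re (cinner (a k) (M B (a k))) - 2 * c * r k
      + c\<^sup>2 * (cmod (coeff (l k) n))\<^sup>2 * measure (povm_dist M (ket n)) B" for k
  proof -
    let ?z = "of_real (- c) * coeff (a k) n"
    have "0 \<le> Re (cinner (a k + scaleC ?z (ket n)) (M B (a k + scaleC ?z (ket n))))"
      by (rule positive_formD(4)[OF F])
    also have "\<dots> = Re (cinner (a k) (M B (a k))) + 2 * Re (?z * cinner (a k) (M B (ket n)))
        + (cmod ?z)\<^sup>2 * measure (povm_dist M (ket n)) B"
      unfolding measure_povm_dist[OF B] by (rule positive_form_expand[OF F])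
    also have "Re (?z * cinner (a k) (M B (ket n))) = - c * r k"
      by (simp add: r_def algebra_simps)
    also have "(cmod ?z)\<^sup>2 = c\<^sup>2 * (cmod (coeff (l k) n))\<^sup>2"
      by (simp add: norm_mult a power_mult_distrib)
    finally show ?thesis by simp
  qed
  then have "0 \<le> measure (outcome_dist \<rho> M \<theta>) B - 2 * c * Re (coeff (shifted_state \<rho> \<theta> (M B (ket n))) n)
      + c\<^sup>2 * photon_prob \<rho> n * measure (povm_dist M (ket n)) B"
    by (rule sums_le[OF _ sums_zero sums_add[OF sums_diff[OF measure_outcome_dist[OF B, of \<theta>, folded a_def]
            sums_mult[OF r, of "2 * c"]] sums_mult2[OF sums_mult[OF D(3)[of n], of "c\<^sup>2"]]]])
  then show ?thesis by simp
qed

lemma measurable_error_integral: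
  fixes g :: "real \<Rightarrow> ennreal"
  assumes "g \<in> borel_measurable borel"
  shows "(\<lambda>\<theta>. \<integral>\<^sup>+t. g (wrap_angle (t - \<theta>)) \<partial>outcome_dist \<rho> M \<theta>) \<in> borel_measurable uniform_prior"
proof (rule nn_integral_measurable_subprob_algebra2[OF _ outcome_dist_kernel[OF rho povm decomp]])
  have "sets (uniform_prior \<Otimes>\<^sub>M circle) = sets (circle \<Otimes>\<^sub>M circle)"
    by (intro sets_pair_measure_cong) simp_all
  then show "(\<lambda>(\<theta>, t). g (wrap_angle (t - \<theta>))) \<in> borel_measurable (uniform_prior \<Otimes>\<^sub>M circle)"
    using measurable_compose[OF measurable_error assms]
    unfolding case_prod_unfold by (subst measurable_cong_sets[OF _ refl])
qed

text \<open>The set function of the quadratic bound has total value \<kappa> p_n, because the POVM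
  sums to the identity and a phase shift leaves the diagonal alone. The choice of \<kappa> as the
  reciprocal of the average of 1 / w gives the product inequality between the two averages.\<close>

lemma error_dist_dual:
  fixes w :: "real \<Rightarrow> real"
  assumes w [measurable]: "w \<in> borel_measurable borel" and w1: "\<And>e. w e \<ge> 1" and \<kappa>: "\<kappa> > 0"
  shows "ennreal (2 * \<kappa> * photon_prob \<rho> n)
    \<le> (\<integral>\<^sup>+e. ennreal (w e) \<partial>error_dist \<rho> M)
      + ennreal (\<kappa>\<^sup>2 * photon_prob \<rho> n) * (\<integral>\<^sup>+e. ennreal (1 / w e) \<partial>uniform_prior)"
proof -
  interpret U: prob_space uniform_prior by (rule prob_space_uniform_prior)
  note p0 = photon_prob_sums(2)[OF rho]
  define E where "E \<theta> = (\<integral>\<^sup>+t. ennreal (w (wrap_angle (t - \<theta>))) \<partial>outcome_dist \<rho> M \<theta>)" for \<theta>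
  define F where "F \<theta> = (\<integral>\<^sup>+t. ennreal (1 / w (wrap_angle (t - \<theta>))) \<partial>povm_dist M (ket n))" for \<theta>
  have pointwise: "ennreal (2 * \<kappa> * photon_prob \<rho> n) \<le> E \<theta> + ennreal (\<kappa>\<^sup>2 * photon_prob \<rho> n) * F \<theta>" for \<theta>
  proof -
    define D where "D B = \<kappa> * Re (coeff (shifted_state \<rho> \<theta> (M B (ket n))) n)" for B
    have "ennreal (2 * D (space (outcome_dist \<rho> M \<theta>))) \<le> E \<theta> + ennreal (\<kappa>\<^sup>2 * photon_prob \<rho> n) * F \<theta>"
      unfolding E_def F_def
    proof (rule nn_integral_quadratic_bound)
      show "finite_measure (outcome_dist \<rho> M \<theta>)"
        using prob_space_outcome_dist[OF rho povm decomp] by (rule prob_space.finite_measure)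
      show "finite_measure (povm_dist M (ket n))" by (rule finite_measure_povm_dist[OF povm])
      show "(\<lambda>t. w (wrap_angle (t - \<theta>))) \<in> borel_measurable (outcome_dist \<rho> M \<theta>)"
        by (simp add: measurable_cong_sets[OF sets_outcome_dist refl] measurable_circle)
      show "(\<lambda>i. D (B i)) sums D (\<Union>i. B i)"
        if B: "range B \<subseteq> sets (outcome_dist \<rho> M \<theta>)" "disjoint_family B" for B :: "nat \<Rightarrow> real set"
      proof -
        have "(\<lambda>i. cinner y (M (B i) (ket n))) sums cinner y (M (\<Union>i. B i) (ket n))" for y
          using B by (intro povm_sums[OF povm]) simp_all
        then show ?thesis
          unfolding D_def coeff_shifted_state[OF decomp rho] by (intro sums_mult sums_Re sums_sum)
      qed
      show "2 * c * D B \<le> measure (outcome_dist \<rho> M \<theta>) B + c\<^sup>2 * (\<kappa>\<^sup>2 * photon_prob \<rho> n) * measure (povm_dist M (ket n)) B"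
        if "B \<in> sets (outcome_dist \<rho> M \<theta>)" for c B
        using outcome_dist_quadratic[of B "c * \<kappa>" \<theta> n] that
        by (simp add: D_def power_mult_distrib mult_ac)
    qed (use w1 p0 in auto)
    moreover have "D (space (outcome_dist \<rho> M \<theta>)) = \<kappa> * photon_prob \<rho> n"
      by (simp add: D_def povm_space[OF povm] coeff_shifted_state_ket)
    ultimately show ?thesis by (simp add: mult.assoc)
  qed
  have mF [measurable]: "F \<in> borel_measurable uniform_prior"
    unfolding F_def by (rule measurable_povm_dist_rotate[OF _ povm]) measurable
  have mE [measurable]: "E \<in> borel_measurable uniform_prior"
    unfolding E_def by (rule measurable_error_integral) measurable
  have "ennreal (2 * \<kappa> * photon_prob \<rho> n) = (\<integral>\<^sup>+\<theta>. ennreal (2 * \<kappa> * photon_prob \<rho> n) \<partial>uniform_prior)"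
    using U.emeasure_space_1 by simp
  also have "\<dots> \<le> (\<integral>\<^sup>+\<theta>. E \<theta> + ennreal (\<kappa>\<^sup>2 * photon_prob \<rho> n) * F \<theta> \<partial>uniform_prior)"
    by (intro nn_integral_mono pointwise)
  also have "\<dots> = (\<integral>\<^sup>+\<theta>. E \<theta> \<partial>uniform_prior) + ennreal (\<kappa>\<^sup>2 * photon_prob \<rho> n) * (\<integral>\<^sup>+\<theta>. F \<theta> \<partial>uniform_prior)"
    by (simp add: nn_integral_add nn_integral_cmult)
  also have "(\<integral>\<^sup>+\<theta>. E \<theta> \<partial>uniform_prior) = (\<integral>\<^sup>+e. ennreal (w e) \<partial>error_dist \<rho> M)"
    unfolding E_def by (rule nn_integral_error_dist[OF rho povm decomp, symmetric]) measurable
  also have "(\<integral>\<^sup>+\<theta>. F \<theta> \<partial>uniform_prior) = (\<integral>\<^sup>+e. ennreal (1 / w e) \<partial>uniform_prior)"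
    unfolding F_def by (subst nn_integral_povm_dist_rotate[OF _ povm]) auto
  finally show ?thesis .
qed

lemma RMSE_ge_photon_prob: "photon_prob \<rho> n \<le> RMSE \<rho> M"
proof (cases "photon_prob \<rho> n = 0")
  case True
  then show ?thesis using RMSE_nonneg[OF rho povm decomp] by simp
next
  case False
  define p where "p = photon_prob \<rho> n"
  have p: "p > 0" using False photon_prob_sums(2)[OF rho, of n] by (simp add: p_def)
  \<comment> \<open>\<kappa> = 2 / p is the reciprocal of the bound p / 2 for the Lorentzian
    average. The inequality then reads 4 \<le> (1 + RMSE^2 / p^2) + 2.\<close>
  have "ennreal (2 * (2 / p) * p) \<le> (\<integral>\<^sup>+e. ennreal (1 + e\<^sup>2 / p\<^sup>2) \<partial>error_dist \<rho> M)
      + ennreal ((2 / p)\<^sup>2 * p) * (\<integral>\<^sup>+e. ennreal (1 / (1 + e\<^sup>2 / p\<^sup>2)) \<partial>uniform_prior)"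
    unfolding p_def[symmetric]
    using error_dist_dual[of "\<lambda>e. 1 + e\<^sup>2 / p\<^sup>2" "2 / p" n] p by (simp add: p_def[symmetric])
  also have "\<dots> \<le> (\<integral>\<^sup>+e. ennreal (1 + e\<^sup>2 / p\<^sup>2) \<partial>error_dist \<rho> M) + ennreal ((2 / p)\<^sup>2 * p) * ennreal (p / 2)"
    by (intro add_left_mono mult_left_mono nn_integral_lorentzian[OF p]) simp
  also have "ennreal ((2 / p)\<^sup>2 * p) * ennreal (p / 2) = ennreal 2"
    using p by (subst ennreal_mult[symmetric]) (auto simp: power2_eq_square)
  also have "(\<integral>\<^sup>+e. ennreal (1 + e\<^sup>2 / p\<^sup>2) \<partial>error_dist \<rho> M)
      = (\<integral>\<^sup>+e. 1 + ennreal (1 / p\<^sup>2) * ennreal (e\<^sup>2) \<partial>error_dist \<rho> M)"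
    by (intro nn_integral_cong) (simp add: ennreal_mult[symmetric])
  also have "\<dots> = (\<integral>\<^sup>+e. 1 \<partial>error_dist \<rho> M) + ennreal (1 / p\<^sup>2) * (\<integral>\<^sup>+e. ennreal (e\<^sup>2) \<partial>error_dist \<rho> M)"
    by (subst nn_integral_add, simp_all add: measurable_cong_sets[OF sets_error_dist refl] del: nn_integral_const)
       (subst nn_integral_cmult, simp_all add: measurable_cong_sets[OF sets_error_dist refl])
  also have "\<dots> = ennreal (1 + (RMSE \<rho> M)\<^sup>2 / p\<^sup>2)"
    unfolding nn_integral_error_dist_const[OF rho povm decomp] RMSE_square[OF rho povm decomp, symmetric]
    by (simp add: ennreal_mult[symmetric])
  also have "ennreal (1 + (RMSE \<rho> M)\<^sup>2 / p\<^sup>2) + ennreal 2 = ennreal (1 + (RMSE \<rho> M)\<^sup>2 / p\<^sup>2 + 2)"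
    by (rule ennreal_plus[symmetric]) auto
  finally have "4 \<le> 1 + (RMSE \<rho> M)\<^sup>2 / p\<^sup>2 + 2"
    using p by (subst (asm) ennreal_le_iff) auto
  then have "p\<^sup>2 \<le> (RMSE \<rho> M)\<^sup>2" using p by (simp add: field_simps)
  then have "p \<le> RMSE \<rho> M" using RMSE_nonneg[OF rho povm decomp] by (rule power2_le_imp_le)
  then show ?thesis by (simp add: p_def)
qed

text \<open>The probabilities tend to 0 and one of them is positive, so a largest one exists and
  \<open>GREATEST\<close> denotes it.\<close>

lemma RMSE_ge_max_photon_prob: "(GREATEST p. p \<in> range (photon_prob \<rho>)) \<le> RMSE \<rho> M"
proof -
  note p = photon_prob_sums[OF rho]
  have lim: "photon_prob \<rho> \<longlonglongrightarrow> 0" using p(1) by (intro summable_LIMSEQ_zero) (rule sums_summable)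
  obtain m where m: "photon_prob \<rho> m > 0"
  proof (rule ccontr)
    assume "\<not> thesis"
    then have "photon_prob \<rho> = (\<lambda>n. 0)" using p(2) that by (force simp: less_le)
    with p(1) show False using sums_unique2[OF sums_zero] by fastforce
  qed
  from order_tendstoD(2)[OF lim m] obtain N where N: "\<And>n. n \<ge> N \<Longrightarrow> photon_prob \<rho> n < photon_prob \<rho> m"
    unfolding eventually_sequentially by auto
  have "Max (photon_prob \<rho> ` {..N + m}) \<in> photon_prob \<rho> ` {..N + m}"
    by (intro Max_in) auto
  then obtain k where "photon_prob \<rho> k = Max (photon_prob \<rho> ` {..N + m})"
    unfolding image_iff by metis
  then have k: "photon_prob \<rho> n \<le> photon_prob \<rho> k" if "n \<le> N + m" for n
    using that by auto
  have "photon_prob \<rho> n \<le> photon_prob \<rho> k" for n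
    using k[of n] k[of m] N[of n] by (cases "n \<le> N + m") auto
  then have "(GREATEST p. p \<in> range (photon_prob \<rho>)) = photon_prob \<rho> k"
    by (intro Greatest_equality) auto
  then show ?thesis using RMSE_ge_photon_prob[of k] by simp
qed

end

section \<open>The bound in terms of the mean photon number\<close>

lemma integral_cis_uniform_prior:
  "integrable uniform_prior (\<lambda>\<theta>. cis (of_int j * \<theta>))"
  "(\<integral>\<theta>. cis (of_int j * \<theta>) \<partial>uniform_prior) = (if j = 0 then 1 else 0)"
proof -
  interpret U: prob_space uniform_prior by (rule prob_space_uniform_prior)
  have meas: "(\<lambda>\<theta>. cis (of_int j * \<theta>)) \<in> borel_measurable borel"
    by (intro borel_measurable_continuous_onI continuous_intros)
  then have measc: "(\<lambda>\<theta>. cis (of_int j * \<theta>)) \<in> borel_measurable circle"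
    by (intro measurable_circle) simp_all
  then show "integrable uniform_prior (\<lambda>\<theta>. cis (of_int j * \<theta>))"
    by (intro U.integrable_const_bound[where B = 1])
       (auto simp: measurable_cong_sets[OF sets_uniform_prior refl])
  show "(\<integral>\<theta>. cis (of_int j * \<theta>) \<partial>uniform_prior) = (if j = 0 then 1 else 0)"
  proof (cases "j = 0")
    case True
    then show ?thesis using U.prob_space by simp
  next
    case False
    have "(\<integral>\<theta>. cis (of_int j * \<theta>) \<partial>uniform_prior) = (\<integral>\<theta>. (1 / (2 * pi)) *\<^sub>R cis (of_int j * \<theta>) \<partial>circle)"
      unfolding uniform_prior_def by (intro integral_density measc) auto
    also have "\<dots> = (\<integral>\<theta>. indicator {-pi..<pi} \<theta> *\<^sub>R ((1 / (2 * pi)) *\<^sub>R cis (of_int j * \<theta>)) \<partial>lborel)"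
      unfolding circle_def by (subst integral_restrict_space) auto
    also have "\<dots> = (\<integral>\<theta>. indicator {-pi..pi} \<theta> *\<^sub>R ((1 / (2 * pi)) *\<^sub>R cis (of_int j * \<theta>)) \<partial>lborel)"
    proof (rule integral_cong_AE)
      have "AE x in lborel. x \<noteq> (pi :: real)" by (rule AE_lborel_singleton)
      then show "AE \<theta> in lborel. indicator {-pi..<pi} \<theta> *\<^sub>R ((1 / (2 * pi)) *\<^sub>R cis (of_int j * \<theta>)) =
          indicator {-pi..pi} \<theta> *\<^sub>R ((1 / (2 * pi)) *\<^sub>R cis (of_int j * \<theta>))"
        by eventually_elim (auto split: split_indicator)
    qed (use meas in \<open>simp_all add: borel_measurable_scaleR\<close>)
    also have "\<dots> = (1 / (2 * pi)) *\<^sub>R (cis (of_int j * pi) / (\<i> * of_int j)) - (1 / (2 * pi)) *\<^sub>R (cis (of_int j * (-pi)) / (\<i> * of_int j))"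
    proof (rule has_bochner_integral_integral_eq[OF has_bochner_integral_FTC_Icc])
      show "((\<lambda>\<theta>. (1 / (2 * pi)) *\<^sub>R (cis (of_int j * \<theta>) / (\<i> * of_int j))) has_vector_derivative
          (1 / (2 * pi)) *\<^sub>R cis (of_int j * x)) (at x within {-pi..pi})" for x
      proof -
        have "((\<lambda>z. exp (\<i> * of_int j * z) / (2 * of_real pi * (\<i> * of_int j))) has_field_derivative
            exp (\<i> * of_int j * of_real x) / (2 * of_real pi)) (at (of_real x))"
          using False by (auto intro!: derivative_eq_intros)
        from has_vector_derivative_real_field[OF this] show ?thesis
          by (simp add: cis_conv_exp scaleR_conv_of_real mult.assoc)
      qed
      show "continuous_on {-pi..pi} (\<lambda>\<theta>. (1 / (2 * pi)) *\<^sub>R cis (of_int j * \<theta>))"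
        by (intro continuous_intros)
    qed simp
    also have "\<dots> = 0"
    proof -
      have "cis (of_int j * pi) = cis (of_int j * (-pi))"
        using sin_npi_int[of j] by (simp add: complex_eq_iff mult.commute)
      then show ?thesis by simp
    qed
    finally show ?thesis using False by simp
  qed
qed

text \<open>The kernel has the Fourier modes 0 and \<plusminus>1 only. The summand 1 makes it
  nonnegative, so the later integrals can be taken in \<open>ennreal\<close>.\<close>

lemma cos_kernel_integral:
  fixes \<tau> :: real and j :: int
  shows "integrable uniform_prior (\<lambda>\<theta>. of_real (1 + cos (\<tau> - \<theta>)) * cis (of_int j * \<theta>))"
    and "cmod (\<integral>\<theta>. of_real (1 + cos (\<tau> - \<theta>)) * cis (of_int j * \<theta>) \<partial>uniform_prior)
      \<le> (if j = 0 then 1 else 0) + (if j = 1 then 1 / 2 else 0) + (if j = - 1 then 1 / 2 else 0)"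
proof -
  have eq: "of_real (1 + cos (\<tau> - \<theta>)) * cis (of_int j * \<theta>)
    = cis (of_int j * \<theta>) + (cis \<tau> / 2) * cis (of_int (j - 1) * \<theta>) + (cis (- \<tau>) / 2) * cis (of_int (j + 1) * \<theta>)" for \<theta>
  proof -
    have "of_real (cos (\<tau> - \<theta>)) = (cis (\<tau> - \<theta>) + cis (\<theta> - \<tau>)) / 2"
      by (simp add: complex_eq_iff cos_diff sin_diff)
    moreover have "cis (\<tau> - \<theta>) * cis (of_int j * \<theta>) = cis \<tau> * cis (of_int (j - 1) * \<theta>)"
      "cis (\<theta> - \<tau>) * cis (of_int j * \<theta>) = cis (- \<tau>) * cis (of_int (j + 1) * \<theta>)"
      by (simp_all add: cis_mult algebra_simps)
    ultimately show ?thesis by (simp add: distrib_right add_divide_distrib)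
  qed
  note I = integral_cis_uniform_prior
  show "integrable uniform_prior (\<lambda>\<theta>. of_real (1 + cos (\<tau> - \<theta>)) * cis (of_int j * \<theta>))"
    unfolding eq by (intro Bochner_Integration.integrable_add integrable_mult_right I)
  have "(\<integral>\<theta>. of_real (1 + cos (\<tau> - \<theta>)) * cis (of_int j * \<theta>) \<partial>uniform_prior)
    = (if j = 0 then 1 else 0) + (cis \<tau> / 2) * (if j - 1 = 0 then 1 else 0) + (cis (- \<tau>) / 2) * (if j + 1 = 0 then 1 else 0)"
    unfolding eq
    by (subst Bochner_Integration.integral_add Bochner_Integration.integral_mult_right_zero I(2);
        (intro Bochner_Integration.integrable_add integrable_mult_right I)?)+ (rule refl)
  also have "cmod \<dots> \<le> (if j = 0 then 1 else 0) + (if j = 1 then 1 / 2 else 0) + (if j = - 1 then 1 / 2 else 0)"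
    by (auto simp: norm_divide)
  finally show "cmod (\<integral>\<theta>. of_real (1 + cos (\<tau> - \<theta>)) * cis (of_int j * \<theta>) \<partial>uniform_prior)
      \<le> (if j = 0 then 1 else 0) + (if j = 1 then 1 / 2 else 0) + (if j = - 1 then 1 / 2 else 0)" .
qed

section \<open>Phase averages of quadratic forms\<close>

definition truncate_fock :: "nat \<Rightarrow> fock \<Rightarrow> fock" where
  "truncate_fock K x = (\<Sum>n<K. scaleC (coeff x n) (ket n))"

lemma coeff_sum: "coeff (sum f A) n = (\<Sum>x\<in>A. coeff (f x) n)"
  by (induction A rule: infinite_finite_induct) (simp_all add: zero_fock.rep_eq)

lemma coeff_truncate: "coeff (truncate_fock K x) n = (if n < K then coeff x n else 0)"
  unfolding truncate_fock_def coeff_sum by (simp add: coeff_ket if_distrib cong: if_cong)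

lemma truncate_tendsto: "(\<lambda>K. truncate_fock K x) \<longlonglongrightarrow> x"
proof (rule Lim_null[THEN iffD2], rule tendsto_norm_zero_cancel)
  have sq: "(norm (truncate_fock K x - x))\<^sup>2 = (norm x)\<^sup>2 - (\<Sum>n<K. (cmod (coeff x n))\<^sup>2)" for K
  proof -
    have "(\<lambda>n. (cmod (coeff x n))\<^sup>2 - (if n < K then (cmod (coeff x n))\<^sup>2 else 0)) sums
        ((norm x)\<^sup>2 - (\<Sum>n<K. (cmod (coeff x n))\<^sup>2))"
      using sums_If_finite_set[of "{..<K}" "\<lambda>n. (cmod (coeff x n))\<^sup>2"] by (intro sums_diff norm_sums) simp
    moreover have "(cmod (coeff x n))\<^sup>2 - (if n < K then (cmod (coeff x n))\<^sup>2 else 0)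
        = (cmod (coeff (truncate_fock K x - x) n))\<^sup>2" for n
      by (simp add: minus_fock.rep_eq coeff_truncate)
    ultimately show ?thesis using norm_sums[of "truncate_fock K x - x"] by (simp add: sums_unique2)
  qed
  have "(\<lambda>K. (norm x)\<^sup>2 - (\<Sum>n<K. (cmod (coeff x n))\<^sup>2)) \<longlonglongrightarrow> (norm x)\<^sup>2 - (norm x)\<^sup>2"
    using norm_sums[of x] unfolding sums_def by (intro tendsto_diff tendsto_const)
  then have "(\<lambda>K. (norm (truncate_fock K x - x))\<^sup>2) \<longlonglongrightarrow> 0" unfolding sq by simp
  from tendsto_real_sqrt[OF this] show "(\<lambda>K. norm (truncate_fock K x - x)) \<longlonglongrightarrow> 0" by simp
qed

lemma positive_form_sum:
  assumes "positive_form f"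
  shows "f (sum g A) (sum h B) = (\<Sum>a\<in>A. \<Sum>b\<in>B. f (g a) (h b))"
proof -
  note D = positive_formD[OF assms]
  have zero: "f x 0 = 0" "f 0 x = 0" for x
    using D(1)[of x 0 0] D(6)[of 0 0 x] by simp_all
  have "f x (sum h B) = (\<Sum>b\<in>B. f x (h b))" for x
    by (induction B rule: infinite_finite_induct) (simp_all add: zero D(1))
  then have "(\<Sum>a\<in>A. f (g a) (sum h B)) = (\<Sum>a\<in>A. \<Sum>b\<in>B. f (g a) (h b))"
    by simp
  moreover have "f (sum g A) y = (\<Sum>a\<in>A. f (g a) y)" for y
    by (induction A rule: infinite_finite_induct) (simp_all add: zero D(6))
  ultimately show ?thesis by simp
qed

text \<open>
  Averaging \<open>1 + cos (\<tau> - \<theta>)\<close> over the phase shifts leaves only the matrix elements next to the diagonal,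
  which the weights \<open>s\<close> bound by diagonal ones.
\<close>

definition weight :: "(nat \<Rightarrow> real) \<Rightarrow> nat \<Rightarrow> real" where
  "weight s n = 1 + (s n + (if n = 0 then 0 else 1 / s (n - 1))) / 2"

lemma nn_integral_cos_truncate:
  assumes A: "positive_operator A" and s: "\<And>n. s n > 0"
  shows "(\<integral>\<^sup>+\<theta>. ennreal ((1 + cos (\<tau> - \<theta>)) *
      Re (cinner (truncate_fock K (phase_shift \<theta> x)) (A (truncate_fock K (phase_shift \<theta> x))))) \<partial>uniform_prior)
    \<le> (\<Sum>n. ennreal (weight s n * (cmod (coeff x n))\<^sup>2 * Re (cinner (ket n) (A (ket n)))))"
proof -
  interpret U: prob_space uniform_prior by (rule prob_space_uniform_prior)
  note F = positive_operator_form[OF A] and D = positive_formD[OF positive_operator_form[OF A]]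
  define y where "y n = scaleC (coeff x n) (ket n)" for n
  define z where "z m n = cinner (y m) (A (y n))" for m n
  define g where "g n = (cmod (coeff x n))\<^sup>2 * Re (cinner (ket n) (A (ket n)))" for n
  define \<kappa> where "\<kappa> j = (\<integral>\<theta>. of_real (1 + cos (\<tau> - \<theta>)) * cis (of_int j * \<theta>) \<partial>uniform_prior)" for j :: int
  have g: "g n \<ge> 0" for n unfolding g_def using D(4) by simp
  have zg: "z n n = of_real (g n)" for n
  proof -
    have "z n n = (coeff x n * cnj (coeff x n)) * cinner (ket n) (A (ket n))"
      unfolding z_def y_def D(2) D(7) by (simp only: mult_ac)
    also have "cinner (ket n) (A (ket n)) = of_real (Re (cinner (ket n) (A (ket n))))"
      by (rule complex_eqI) (simp_all add: D(5))
    finally show ?thesis by (simp only: complex_norm_square[symmetric] g_def of_real_mult)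
  qed
  have young: "2 * cmod (z n (Suc n)) \<le> s n * g n + g (Suc n) / s n" for n
    using positive_form_young[OF F s[of n], of "y n" "y (Suc n)"]
    by (simp add: z_def[symmetric] zg)
  have zsym: "cmod (z (Suc n) n) = cmod (z n (Suc n))" for n
    unfolding z_def by (subst D(3)) (simp only: complex_mod_cnj)
  have expand: "cinner (truncate_fock K (phase_shift \<theta> x)) (A (truncate_fock K (phase_shift \<theta> x)))
      = (\<Sum>m<K. \<Sum>n<K. z m n * cis (of_int (int m - int n) * \<theta>))" for \<theta>
  proof -
    have "cinner (scaleC (coeff (phase_shift \<theta> x) m) (ket m)) (A (scaleC (coeff (phase_shift \<theta> x) n) (ket n)))
        = z m n * cis (of_int (int m - int n) * \<theta>)" for m n
    proof -
      have "cnj (cis (- (real m * \<theta>))) * cis (- (real n * \<theta>)) = cis (of_int (int m - int n) * \<theta>)"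
        by (simp add: cis_cnj cis_mult algebra_simps)
      then show ?thesis
        unfolding z_def y_def D(2) D(7) coeff_phase_shift by (simp add: mult_ac)
    qed
    then show ?thesis unfolding truncate_fock_def positive_form_sum[OF F] by simp
  qed
  have int: "integrable uniform_prior (\<lambda>\<theta>. of_real (1 + cos (\<tau> - \<theta>)) *
      cinner (truncate_fock K (phase_shift \<theta> x)) (A (truncate_fock K (phase_shift \<theta> x))))"
    and val: "(\<integral>\<theta>. of_real (1 + cos (\<tau> - \<theta>)) *
      cinner (truncate_fock K (phase_shift \<theta> x)) (A (truncate_fock K (phase_shift \<theta> x))) \<partial>uniform_prior)
      = (\<Sum>m<K. \<Sum>n<K. z m n * \<kappa> (int m - int n))"
  proof -
    have eq: "of_real (1 + cos (\<tau> - \<theta>)) * cinner (truncate_fock K (phase_shift \<theta> x)) (A (truncate_fock K (phase_shift \<theta> x)))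
      = (\<Sum>m<K. \<Sum>n<K. z m n * (of_real (1 + cos (\<tau> - \<theta>)) * cis (of_int (int m - int n) * \<theta>)))" for \<theta>
      unfolding expand sum_distrib_left by (simp only: mult_ac)
    have i: "integrable uniform_prior (\<lambda>\<theta>. z m n * (of_real (1 + cos (\<tau> - \<theta>)) * cis (of_int (int m - int n) * \<theta>)))" for m n
      by (intro integrable_mult_right cos_kernel_integral)
    show "integrable uniform_prior (\<lambda>\<theta>. of_real (1 + cos (\<tau> - \<theta>)) *
        cinner (truncate_fock K (phase_shift \<theta> x)) (A (truncate_fock K (phase_shift \<theta> x))))"
      unfolding eq by (intro Bochner_Integration.integrable_sum i)
    show "(\<integral>\<theta>. of_real (1 + cos (\<tau> - \<theta>)) *
      cinner (truncate_fock K (phase_shift \<theta> x)) (A (truncate_fock K (phase_shift \<theta> x))) \<partial>uniform_prior)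
      = (\<Sum>m<K. \<Sum>n<K. z m n * \<kappa> (int m - int n))"
      unfolding eq \<kappa>_def
      by (simp only: Bochner_Integration.integral_sum[OF Bochner_Integration.integrable_sum[OF i]]
          Bochner_Integration.integral_sum[OF i] Bochner_Integration.integral_mult_right_zero)
  qed
  have "cmod (\<Sum>m<K. \<Sum>n<K. z m n * \<kappa> (int m - int n))
      \<le> (\<Sum>m<K. \<Sum>n<K. cmod (z m n) * cmod (\<kappa> (int m - int n)))"
    by (intro sum_norm_le) (auto intro!: sum_norm_le simp: norm_mult)
  also have "\<dots> \<le> (\<Sum>m<K. \<Sum>n<K. cmod (z m n) * ((if m = n then 1 else 0) + (if m = Suc n then 1 / 2 else 0) + (if n = Suc m then 1 / 2 else 0)))"
  proof (intro sum_mono mult_left_mono)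
    fix m n :: nat
    have "int m - int n = 0 \<longleftrightarrow> m = n" "int m - int n = 1 \<longleftrightarrow> m = Suc n" "int m - int n = - 1 \<longleftrightarrow> n = Suc m"
      by auto
    then show "cmod (\<kappa> (int m - int n)) \<le> (if m = n then 1 else 0) + (if m = Suc n then 1 / 2 else 0) + (if n = Suc m then 1 / 2 else 0)"
      using cos_kernel_integral(2)[of \<tau> "int m - int n"] unfolding \<kappa>_def by (simp only:)
  qed auto
  also have "\<dots> = (\<Sum>n<K. cmod (z n n)) + (\<Sum>n<K. if Suc n < K then cmod (z (Suc n) n) / 2 else 0)
      + (\<Sum>n<K. if Suc n < K then cmod (z n (Suc n)) / 2 else 0)"
  proof -
    have "(\<Sum>m<K. \<Sum>n<K. cmod (z m n) * (if m = n then 1 else 0)) = (\<Sum>n<K. cmod (z n n))"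
      by (simp add: if_distrib sum.delta cong: if_cong)
    moreover have "(\<Sum>m<K. \<Sum>n<K. cmod (z m n) * (if n = Suc m then 1 / 2 else 0)) = (\<Sum>n<K. if Suc n < K then cmod (z n (Suc n)) / 2 else 0)"
      by (simp add: if_distrib sum.delta cong: if_cong)
    moreover have "(\<Sum>m<K. \<Sum>n<K. cmod (z m n) * (if m = Suc n then 1 / 2 else 0)) = (\<Sum>n<K. if Suc n < K then cmod (z (Suc n) n) / 2 else 0)"
      by (subst sum.swap) (simp add: if_distrib sum.delta cong: if_cong)
    ultimately show ?thesis by (simp only: distrib_left sum.distrib)
  qed
  also have "\<dots> = (\<Sum>n<K. g n) + (\<Sum>n<K. if Suc n < K then cmod (z n (Suc n)) else 0)"
    using g unfolding zsym add.assoc sum.distrib[symmetric]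
    by (intro arg_cong2[where f = "(+)"] sum.cong) (auto simp: zg)
  also have "\<dots> \<le> (\<Sum>n<K. g n) + (\<Sum>n<K. s n * g n / 2 + (if Suc n < K then g (Suc n) / s n / 2 else 0))"
  proof (intro add_left_mono sum_mono)
    fix n
    show "(if Suc n < K then cmod (z n (Suc n)) else 0) \<le> s n * g n / 2 + (if Suc n < K then g (Suc n) / s n / 2 else 0)"
      using young[of n] mult_nonneg_nonneg[OF less_imp_le[OF s[of n]] g[of n]] by simp
  qed
  also have "\<dots> = (\<Sum>n<K. g n + s n * g n / 2) + (\<Sum>n<K. if Suc n < K then g (Suc n) / s n / 2 else 0)"
    by (simp add: sum.distrib)
  \<comment> \<open>The pair (n, n + 1) charges 1 / s n to its upper index. Reindexed by that index
    this is \<open>1 / s (n - 1)\<close>, with nothing for index 0.\<close>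
  also have "(\<Sum>n<K. if Suc n < K then g (Suc n) / s n / 2 else 0) = (\<Sum>n<K. if n = 0 then 0 else g n / s (n - 1) / 2)"
  proof (cases K)
    case (Suc K')
    then show ?thesis by (subst (2) Suc, subst sum.lessThan_Suc_shift) simp
  qed simp
  also have "(\<Sum>n<K. g n + s n * g n / 2) + \<dots> = (\<Sum>n<K. weight s n * g n)"
    unfolding sum.distrib[symmetric] by (intro sum.cong) (auto simp: weight_def field_simps)
  finally have bound: "cmod (\<Sum>m<K. \<Sum>n<K. z m n * \<kappa> (int m - int n)) \<le> (\<Sum>n<K. weight s n * g n)" .
  have eqRe: "(1 + cos (\<tau> - \<theta>)) * Re (cinner (truncate_fock K (phase_shift \<theta> x)) (A (truncate_fock K (phase_shift \<theta> x))))
    = Re (of_real (1 + cos (\<tau> - \<theta>)) * cinner (truncate_fock K (phase_shift \<theta> x)) (A (truncate_fock K (phase_shift \<theta> x))))" for \<theta>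
    by simp
  have cos: "1 + cos t \<ge> 0" for t :: real using cos_ge_minus_one[of t] by linarith
  have "(\<integral>\<^sup>+\<theta>. ennreal ((1 + cos (\<tau> - \<theta>)) *
      Re (cinner (truncate_fock K (phase_shift \<theta> x)) (A (truncate_fock K (phase_shift \<theta> x))))) \<partial>uniform_prior)
    = ennreal (\<integral>\<theta>. (1 + cos (\<tau> - \<theta>)) *
      Re (cinner (truncate_fock K (phase_shift \<theta> x)) (A (truncate_fock K (phase_shift \<theta> x)))) \<partial>uniform_prior)"
  proof (rule nn_integral_eq_integral)
    show "integrable uniform_prior (\<lambda>\<theta>. (1 + cos (\<tau> - \<theta>)) *
        Re (cinner (truncate_fock K (phase_shift \<theta> x)) (A (truncate_fock K (phase_shift \<theta> x)))))"
      unfolding eqRe by (rule integrable_Re[OF int])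
    show "AE \<theta> in uniform_prior. 0 \<le> (1 + cos (\<tau> - \<theta>)) *
        Re (cinner (truncate_fock K (phase_shift \<theta> x)) (A (truncate_fock K (phase_shift \<theta> x))))"
      by (intro AE_I2 mult_nonneg_nonneg D(4) cos)
  qed
  also have "(\<integral>\<theta>. (1 + cos (\<tau> - \<theta>)) *
      Re (cinner (truncate_fock K (phase_shift \<theta> x)) (A (truncate_fock K (phase_shift \<theta> x)))) \<partial>uniform_prior)
    = Re (\<Sum>m<K. \<Sum>n<K. z m n * \<kappa> (int m - int n))"
    unfolding eqRe integral_Re[OF int] val ..
  also have "ennreal \<dots> \<le> ennreal (\<Sum>n<K. weight s n * g n)"
    by (intro ennreal_leI order_trans[OF complex_Re_le_cmod bound])
  also have "\<dots> \<le> (\<Sum>n<K. ennreal (weight s n * g n))"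
    by (rule ennreal_sum_le)
  also have "\<dots> \<le> (\<Sum>n. ennreal (weight s n * g n))"
    by (rule sum_le_suminf) auto
  finally show ?thesis by (simp add: g_def mult.assoc)
qed

text \<open>Truncations converge in norm and A is bounded, so the integrands converge pointwise. The
  bound for truncations does not depend on K, and Fatou passes it to the limit.\<close>

lemma nn_integral_cos_phase_shift:
  assumes A: "positive_operator A" and s: "\<And>n. s n > 0"
  shows "(\<integral>\<^sup>+\<theta>. ennreal ((1 + cos (\<tau> - \<theta>)) * Re (cinner (phase_shift \<theta> x) (A (phase_shift \<theta> x)))) \<partial>uniform_prior)
    \<le> (\<Sum>n. ennreal (weight s n * (cmod (coeff x n))\<^sup>2 * Re (cinner (ket n) (A (ket n)))))" (is "_ \<le> ?C")
proof -
  have lin: "bounded_linear A" using A unfolding positive_operator_def bounded_operator_def by auto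
  define u where "u K \<theta> = ennreal ((1 + cos (\<tau> - \<theta>)) *
      Re (cinner (truncate_fock K (phase_shift \<theta> x)) (A (truncate_fock K (phase_shift \<theta> x)))))" for K \<theta>
  have lim: "(\<lambda>K. u K \<theta>) \<longlonglongrightarrow> ennreal ((1 + cos (\<tau> - \<theta>)) * Re (cinner (phase_shift \<theta> x) (A (phase_shift \<theta> x))))" for \<theta>
    unfolding u_def inner_fock_def[symmetric]
    by (intro tendsto_ennrealI tendsto_mult tendsto_const tendsto_inner truncate_tendsto
        bounded_linear.tendsto[OF lin])
  have meas: "u K \<in> borel_measurable uniform_prior" for K
  proof -
    have "truncate_fock K (phase_shift \<theta> x) = phase_shift \<theta> (truncate_fock K x)" for \<theta>
      by (simp add: coeff_inject[symmetric] fun_eq_iff coeff_truncate coeff_phase_shift)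
    then have "u K = (\<lambda>\<theta>. ennreal ((1 + cos (\<tau> - \<theta>)) *
        Re (cinner (phase_shift \<theta> (truncate_fock K x)) (A (phase_shift \<theta> (truncate_fock K x))))))"
      by (simp add: u_def fun_eq_iff)
    then have "u K \<in> borel_measurable borel"
      using borel_measurable_povm_phase[OF A, of "truncate_fock K x", measurable] by simp
    then show ?thesis by (simp add: measurable_cong_sets[OF sets_uniform_prior refl] measurable_circle)
  qed
  have "(\<integral>\<^sup>+\<theta>. ennreal ((1 + cos (\<tau> - \<theta>)) * Re (cinner (phase_shift \<theta> x) (A (phase_shift \<theta> x)))) \<partial>uniform_prior)
    = (\<integral>\<^sup>+\<theta>. liminf (\<lambda>K. u K \<theta>) \<partial>uniform_prior)"
    using lim_imp_Liminf[OF _ lim] by simp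
  also have "\<dots> \<le> liminf (\<lambda>K. \<integral>\<^sup>+\<theta>. u K \<theta> \<partial>uniform_prior)"
    by (rule nn_integral_liminf) (rule meas)
  also have "\<dots> \<le> limsup (\<lambda>K. \<integral>\<^sup>+\<theta>. u K \<theta> \<partial>uniform_prior)"
    by (rule Liminf_le_Limsup) simp
  also have "\<dots> \<le> ?C"
    unfolding u_def by (intro Limsup_bounded always_eventually allI nn_integral_cos_truncate A s)
  finally show ?thesis .
qed

lemma cos_lipschitz: "cos x \<le> cos y + \<bar>x - y\<bar>" for x y :: real
proof -
  have "\<bar>cos x - cos y\<bar> = 2 * \<bar>sin ((x + y) / 2)\<bar> * \<bar>sin ((y - x) / 2)\<bar>"
    unfolding cos_diff_cos by (simp add: abs_mult)
  also have "\<dots> \<le> 2 * 1 * \<bar>(y - x) / 2\<bar>"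
    by (intro mult_mono abs_sin_x_le_abs_x) auto
  also have "\<dots> = \<bar>x - y\<bar>" by (simp add: abs_minus_commute)
  finally show ?thesis by linarith
qed

lemma one_minus_cos_le: "2 - 2 * cos e \<le> e\<^sup>2" for e :: real
proof -
  have "2 - 2 * cos e = 4 * (sin (e / 2))\<^sup>2"
    using cos_double_sin[of "e / 2"] by simp
  also have "(sin (e / 2))\<^sup>2 \<le> (e / 2)\<^sup>2"
    using abs_sin_x_le_abs_x[of "e / 2"] by (simp only: abs_le_square_iff)
  also have "4 * (e / 2)\<^sup>2 = e\<^sup>2" by (simp add: power2_eq_square)
  finally show ?thesis by simp
qed

section \<open>From the expected cosine to the mean photon number\<close>

context
  fixes \<rho> M l
  assumes rho: "density_operator \<rho>" and povm: "circle_povm M" and decomp: "state_decomp \<rho> l"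
begin

lemma weight_nonneg: "(\<And>n. s n > 0) \<Longrightarrow> weight s n \<ge> 0"
  unfolding weight_def by (auto simp: less_imp_le)

lemma nn_integral_cos_outcome_dist:
  assumes B: "B \<in> sets circle" and s: "\<And>n. s n > 0"
  shows "(\<integral>\<^sup>+\<theta>. ennreal (1 + cos (\<tau> - \<theta>)) * emeasure (outcome_dist \<rho> M \<theta>) B \<partial>uniform_prior)
    \<le> (\<Sum>n. ennreal (weight s n * photon_prob \<rho> n) * emeasure (povm_dist M (ket n)) B)"
proof -
  note A = positive_operator_povm[OF povm B] and D = positive_formD[OF povm_form[OF povm B]]
  have cos: "1 + cos t \<ge> 0" for t :: real using cos_ge_minus_one[of t] by linarith
  have meas: "(\<lambda>\<theta>. ennreal ((1 + cos (\<tau> - \<theta>)) * Re (cinner (phase_shift \<theta> (l k)) (M B (phase_shift \<theta> (l k))))))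
      \<in> borel_measurable uniform_prior" for k
  proof -
    have "(\<lambda>\<theta>. ennreal ((1 + cos (\<tau> - \<theta>)) * Re (cinner (phase_shift \<theta> (l k)) (M B (phase_shift \<theta> (l k))))))
      \<in> borel_measurable borel"
      using borel_measurable_povm_phase[OF A, of "l k", measurable] by measurable
    then show ?thesis by (simp add: measurable_cong_sets[OF sets_uniform_prior refl] measurable_circle)
  qed
  have "(\<integral>\<^sup>+\<theta>. ennreal (1 + cos (\<tau> - \<theta>)) * emeasure (outcome_dist \<rho> M \<theta>) B \<partial>uniform_prior)
    = (\<integral>\<^sup>+\<theta>. (\<Sum>k. ennreal ((1 + cos (\<tau> - \<theta>)) * Re (cinner (phase_shift \<theta> (l k)) (M B (phase_shift \<theta> (l k)))))) \<partial>uniform_prior)"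
    unfolding emeasure_outcome_dist[OF rho povm decomp B] emeasure_povm_dist[OF povm B] ennreal_suminf_cmult[symmetric]
    by (simp only: ennreal_mult[OF cos D(4)])
  also have "\<dots> = (\<Sum>k. \<integral>\<^sup>+\<theta>. ennreal ((1 + cos (\<tau> - \<theta>)) * Re (cinner (phase_shift \<theta> (l k)) (M B (phase_shift \<theta> (l k))))) \<partial>uniform_prior)"
    by (intro nn_integral_suminf meas)
  also have "\<dots> \<le> (\<Sum>k. \<Sum>n. ennreal (weight s n * (cmod (coeff (l k) n))\<^sup>2 * Re (cinner (ket n) (M B (ket n)))))"
    by (intro suminf_le nn_integral_cos_phase_shift A s) auto
  also have "\<dots> = (\<Sum>n. \<Sum>k. ennreal (weight s n * (cmod (coeff (l k) n))\<^sup>2 * Re (cinner (ket n) (M B (ket n)))))"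
    by (rule suminf_commute_ennreal)
  also have "\<dots> = (\<Sum>n. ennreal (weight s n * photon_prob \<rho> n * Re (cinner (ket n) (M B (ket n)))))"
  proof (intro arg_cong[where f = suminf] ext suminf_ennreal_eq)
    show "0 \<le> weight s n * (cmod (coeff (l k) n))\<^sup>2 * Re (cinner (ket n) (M B (ket n)))" for n k
      by (intro mult_nonneg_nonneg weight_nonneg s D(4)) simp
    show "(\<lambda>k. weight s n * (cmod (coeff (l k) n))\<^sup>2 * Re (cinner (ket n) (M B (ket n)))) sums
        (weight s n * photon_prob \<rho> n * Re (cinner (ket n) (M B (ket n))))" for n
      by (intro sums_mult sums_mult2 state_decompD(3)[OF decomp rho])
  qed
  also have "\<dots> = (\<Sum>n. ennreal (weight s n * photon_prob \<rho> n) * emeasure (povm_dist M (ket n)) B)"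
    unfolding emeasure_povm_dist[OF povm B]
    by (simp only: ennreal_mult[OF mult_nonneg_nonneg[OF weight_nonneg[OF s] photon_prob_sums(2)[OF rho]] D(4)])
  finally show ?thesis .
qed

text \<open>The phase average is available for a fixed angle \<tau>, whereas the cosine involves the
  outcome. The circle is therefore cut into arcs of length at most \<epsilon> and the outcome is
  replaced by the start of its arc, which costs at most \<epsilon> by the Lipschitz bound.\<close>

lemma nn_integral_cos_error_dist:
  assumes s: "\<And>n. s n > 0"
  shows "(\<integral>\<^sup>+e. ennreal (1 + cos e) \<partial>error_dist \<rho> M) \<le> (\<Sum>n. ennreal (weight s n * photon_prob \<rho> n))"
proof (rule ennreal_le_epsilon)
  fix \<epsilon> :: real
  assume \<epsilon>: "\<epsilon> > 0"
  interpret U: prob_space uniform_prior by (rule prob_space_uniform_prior)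
  have cos: "1 + cos t \<ge> 0" for t :: real using cos_ge_minus_one[of t] by linarith
  define B where "B i = {t \<in> {-pi..<pi}. nat \<lfloor>(t + pi) / \<epsilon>\<rfloor> = i}" for i
  define \<tau> where "\<tau> i = real i * \<epsilon> - pi" for i
  have B: "B i \<in> sets circle" for i
  proof -
    have "(\<lambda>t. nat \<lfloor>(t + pi) / \<epsilon>\<rfloor>) \<in> measurable borel (count_space UNIV)" by measurable
    then have "(\<lambda>t. nat \<lfloor>(t + pi) / \<epsilon>\<rfloor>) \<in> measurable circle (count_space UNIV)"
      unfolding circle_def by (intro measurable_restrict_space1) simp
    from measurable_sets[OF this, of "{i}"] show ?thesis
      by (simp add: B_def vimage_def Int_def conj_commute)
  qed
  have dis: "disjoint_family B" by (auto simp: disjoint_family_on_def B_def)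
  have un: "(\<Union>i. B i) = {-pi..<pi}" by (auto simp: B_def)
  have near: "1 + cos (t - \<theta>) \<le> 1 + cos (\<tau> i - \<theta>) + \<epsilon>" if "t \<in> B i" for t i \<theta>
  proof -
    have "(t + pi) / \<epsilon> \<ge> 0" using that \<epsilon> by (auto simp: B_def)
    moreover have "nat \<lfloor>(t + pi) / \<epsilon>\<rfloor> = i" using that by (simp add: B_def)
    ultimately have "real i \<le> (t + pi) / \<epsilon>" "(t + pi) / \<epsilon> < real i + 1" by linarith+
    then have "real i * \<epsilon> \<le> t + pi" "t + pi < real i * \<epsilon> + \<epsilon>"
      using \<epsilon> by (simp_all add: field_simps)
    then have "\<bar>(t - \<theta>) - (\<tau> i - \<theta>)\<bar> \<le> \<epsilon>" unfolding \<tau>_def by linarith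
    with cos_lipschitz[of "t - \<theta>" "\<tau> i - \<theta>"] show ?thesis by linarith
  qed
  have pointwise: "(\<integral>\<^sup>+t. ennreal (1 + cos (t - \<theta>)) \<partial>outcome_dist \<rho> M \<theta>)
      \<le> (\<Sum>i. ennreal (1 + cos (\<tau> i - \<theta>)) * emeasure (outcome_dist \<rho> M \<theta>) (B i)) + ennreal \<epsilon>" for \<theta>
  proof -
    interpret P: prob_space "outcome_dist \<rho> M \<theta>" by (rule prob_space_outcome_dist[OF rho povm decomp])
    have meas: "(\<lambda>t. ennreal (1 + cos (t - \<theta>))) \<in> borel_measurable (outcome_dist \<rho> M \<theta>)"
      by (simp add: measurable_cong_sets[OF sets_outcome_dist refl] measurable_circle)
    have "(\<integral>\<^sup>+t. ennreal (1 + cos (t - \<theta>)) \<partial>outcome_dist \<rho> M \<theta>)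
        = (\<integral>\<^sup>+t\<in>(\<Union>i. B i). ennreal (1 + cos (t - \<theta>)) \<partial>outcome_dist \<rho> M \<theta>)"
      unfolding un by (intro nn_integral_cong) simp
    also have "\<dots> = (\<Sum>i. \<integral>\<^sup>+t\<in>B i. ennreal (1 + cos (t - \<theta>)) \<partial>outcome_dist \<rho> M \<theta>)"
      using B dis by (intro nn_integral_disjoint_family meas) auto
    also have "\<dots> \<le> (\<Sum>i. (ennreal (1 + cos (\<tau> i - \<theta>)) + ennreal \<epsilon>) * emeasure (outcome_dist \<rho> M \<theta>) (B i))"
    proof (intro suminf_le)
      fix i
      have "(\<integral>\<^sup>+t\<in>B i. ennreal (1 + cos (t - \<theta>)) \<partial>outcome_dist \<rho> M \<theta>)
          \<le> (\<integral>\<^sup>+t. (ennreal (1 + cos (\<tau> i - \<theta>)) + ennreal \<epsilon>) * indicator (B i) t \<partial>outcome_dist \<rho> M \<theta>)"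
        using near[of _ i \<theta>] \<epsilon> cos
        by (intro nn_integral_mono) (auto split: split_indicator simp flip: ennreal_plus intro!: ennreal_leI)
      also have "\<dots> = (ennreal (1 + cos (\<tau> i - \<theta>)) + ennreal \<epsilon>) * emeasure (outcome_dist \<rho> M \<theta>) (B i)"
        using B by (intro nn_integral_cmult_indicator) simp
      finally show "(\<integral>\<^sup>+t\<in>B i. ennreal (1 + cos (t - \<theta>)) \<partial>outcome_dist \<rho> M \<theta>)
          \<le> (ennreal (1 + cos (\<tau> i - \<theta>)) + ennreal \<epsilon>) * emeasure (outcome_dist \<rho> M \<theta>) (B i)" .
    qed auto
    also have "\<dots> = (\<Sum>i. ennreal (1 + cos (\<tau> i - \<theta>)) * emeasure (outcome_dist \<rho> M \<theta>) (B i))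
        + ennreal \<epsilon> * (\<Sum>i. emeasure (outcome_dist \<rho> M \<theta>) (B i))"
      unfolding distrib_right by (simp only: suminf_add[symmetric, OF summableI summableI] ennreal_suminf_cmult)
    also have "(\<Sum>i. emeasure (outcome_dist \<rho> M \<theta>) (B i)) = emeasure (outcome_dist \<rho> M \<theta>) (\<Union>i. B i)"
      using B dis by (intro suminf_emeasure) auto
    also have "\<dots> = 1" unfolding un using P.emeasure_space_1 by simp
    finally show ?thesis by simp
  qed
  have meas: "(\<lambda>\<theta>. ennreal (1 + cos (\<tau> i - \<theta>)) * emeasure (outcome_dist \<rho> M \<theta>) (B i)) \<in> borel_measurable uniform_prior" for i
  proof (rule borel_measurable_times_ennreal)
    show "(\<lambda>\<theta>. emeasure (outcome_dist \<rho> M \<theta>) (B i)) \<in> borel_measurable uniform_prior"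
      by (rule measurable_emeasure_kernel[OF outcome_dist_kernel[OF rho povm decomp] B])
    show "(\<lambda>\<theta>. ennreal (1 + cos (\<tau> i - \<theta>))) \<in> borel_measurable uniform_prior"
      by (simp add: measurable_cong_sets[OF sets_uniform_prior refl] measurable_circle)
  qed
  have "(\<integral>\<^sup>+e. ennreal (1 + cos e) \<partial>error_dist \<rho> M)
      = (\<integral>\<^sup>+\<theta>. \<integral>\<^sup>+t. ennreal (1 + cos (t - \<theta>)) \<partial>outcome_dist \<rho> M \<theta> \<partial>uniform_prior)"
    by (subst nn_integral_error_dist[OF rho povm decomp]) (simp_all add: cos_wrap_angle)
  also have "\<dots> \<le> (\<integral>\<^sup>+\<theta>. (\<Sum>i. ennreal (1 + cos (\<tau> i - \<theta>)) * emeasure (outcome_dist \<rho> M \<theta>) (B i)) + ennreal \<epsilon> \<partial>uniform_prior)"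
    by (intro nn_integral_mono pointwise)
  also have "\<dots> = (\<integral>\<^sup>+\<theta>. (\<Sum>i. ennreal (1 + cos (\<tau> i - \<theta>)) * emeasure (outcome_dist \<rho> M \<theta>) (B i)) \<partial>uniform_prior) + ennreal \<epsilon>"
    using U.emeasure_space_1 by (subst nn_integral_add) (auto intro!: borel_measurable_suminf_order meas)
  also have "(\<integral>\<^sup>+\<theta>. (\<Sum>i. ennreal (1 + cos (\<tau> i - \<theta>)) * emeasure (outcome_dist \<rho> M \<theta>) (B i)) \<partial>uniform_prior)
      = (\<Sum>i. \<integral>\<^sup>+\<theta>. ennreal (1 + cos (\<tau> i - \<theta>)) * emeasure (outcome_dist \<rho> M \<theta>) (B i) \<partial>uniform_prior)"
    by (intro nn_integral_suminf meas)
  also have "\<dots> + ennreal \<epsilon> \<le> (\<Sum>i. \<Sum>n. ennreal (weight s n * photon_prob \<rho> n) * emeasure (povm_dist M (ket n)) (B i)) + ennreal \<epsilon>"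
    by (intro add_right_mono suminf_le nn_integral_cos_outcome_dist B s) auto
  also have "(\<Sum>i. \<Sum>n. ennreal (weight s n * photon_prob \<rho> n) * emeasure (povm_dist M (ket n)) (B i))
      = (\<Sum>n. \<Sum>i. ennreal (weight s n * photon_prob \<rho> n) * emeasure (povm_dist M (ket n)) (B i))"
    by (rule suminf_commute_ennreal)
  also have "\<dots> = (\<Sum>n. ennreal (weight s n * photon_prob \<rho> n))"
  proof -
    have "(\<Sum>i. emeasure (povm_dist M (ket n)) (B i)) = 1" for n
    proof -
      have "(\<Sum>i. emeasure (povm_dist M (ket n)) (B i)) = emeasure (povm_dist M (ket n)) (\<Union>i. B i)"
        using B dis by (intro suminf_emeasure) auto
      then show ?thesis unfolding un by (simp add: emeasure_povm_dist_space[OF povm])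
    qed
    then show ?thesis by (simp only: ennreal_suminf_cmult mult_1_right)
  qed
  finally show "(\<integral>\<^sup>+e. ennreal (1 + cos e) \<partial>error_dist \<rho> M) \<le> (\<Sum>n. ennreal (weight s n * photon_prob \<rho> n)) + ennreal \<epsilon>" .
qed

text \<open>Integration of 4 \<le> e^2 + 2 (1 + cos e) over the error; in this arrangement all terms
  are nonnegative.\<close>

lemma RMSE_square_ge_weight:
  assumes s: "\<And>n. s n > 0" and sums: "(\<lambda>n. weight s n * photon_prob \<rho> n) sums W"
  shows "4 - 2 * W \<le> (RMSE \<rho> M)\<^sup>2"
proof -
  have cos: "1 + cos t \<ge> 0" for t :: real using cos_ge_minus_one[of t] by linarith
  note p0 = photon_prob_sums(2)[OF rho]
  have W: "W \<ge> 0"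
    by (rule sums_le[OF _ sums_zero sums]) (intro mult_nonneg_nonneg weight_nonneg s p0)
  have "ennreal 4 = (\<integral>\<^sup>+e. ennreal 4 \<partial>error_dist \<rho> M)"
    by (simp only: nn_integral_error_dist_const[OF rho povm decomp])
  also have "\<dots> \<le> (\<integral>\<^sup>+e. ennreal (e\<^sup>2) + ennreal 2 * ennreal (1 + cos e) \<partial>error_dist \<rho> M)"
  proof (rule nn_integral_mono)
    fix e :: real
    have "4 \<le> e\<^sup>2 + 2 * (1 + cos e)" using one_minus_cos_le[of e] by simp
    then have "ennreal 4 \<le> ennreal (e\<^sup>2 + 2 * (1 + cos e))" by (rule ennreal_leI)
    also have "\<dots> = ennreal (e\<^sup>2) + ennreal (2 * (1 + cos e))"
      by (rule ennreal_plus) (use cos[of e] in auto)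
    also have "ennreal (2 * (1 + cos e)) = ennreal 2 * ennreal (1 + cos e)"
      by (rule ennreal_mult) (use cos[of e] in auto)
    finally show "ennreal 4 \<le> ennreal (e\<^sup>2) + ennreal 2 * ennreal (1 + cos e)" .
  qed
  also have "\<dots> = ennreal ((RMSE \<rho> M)\<^sup>2) + ennreal 2 * (\<integral>\<^sup>+e. ennreal (1 + cos e) \<partial>error_dist \<rho> M)"
    unfolding RMSE_square[OF rho povm decomp]
    by (subst nn_integral_add, simp_all add: measurable_cong_sets[OF sets_error_dist refl])
       (subst nn_integral_cmult, simp_all add: measurable_cong_sets[OF sets_error_dist refl])
  also have "\<dots> \<le> ennreal ((RMSE \<rho> M)\<^sup>2) + ennreal 2 * (\<Sum>n. ennreal (weight s n * photon_prob \<rho> n))"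
    by (intro add_left_mono mult_left_mono nn_integral_cos_error_dist s) simp
  also have "(\<Sum>n. ennreal (weight s n * photon_prob \<rho> n)) = ennreal W"
    by (intro suminf_ennreal_eq sums mult_nonneg_nonneg weight_nonneg s p0)
  also have "ennreal ((RMSE \<rho> M)\<^sup>2) + ennreal 2 * ennreal W = ennreal ((RMSE \<rho> M)\<^sup>2 + 2 * W)"
    using W by (simp add: ennreal_mult)
  finally have "4 \<le> (RMSE \<rho> M)\<^sup>2 + 2 * W"
    using W by (subst (asm) ennreal_le_iff) auto
  then show ?thesis by simp
qed

text \<open>The weights come from the trial sequence \<open>(n + 1) q\<^sup>n\<close>, the ground state of a discrete Coulomb problem.\<close>

lemma RMSE_square_ge_mean:
  assumes \<mu>: "(\<lambda>n. real n * photon_prob \<rho> n) sums \<mu>" and q: "0 < q" "q < 1"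
  shows "2 - q - 1 / q + (1 / q - q) / (\<mu> + 1) \<le> (RMSE \<rho> M)\<^sup>2"
proof -
  note p = photon_prob_sums[OF rho]
  have \<mu>0: "\<mu> \<ge> 0" by (rule sums_le[OF _ sums_zero \<mu>]) (use p(2) in simp)
  define y where "y = \<mu> + 1"
  have y: "y > 0" using \<mu>0 by (simp add: y_def)
  \<comment> \<open>The ratio of consecutive entries of the trial sequence. It makes the weight
    affine in 1 / (n + 1); the formula also fits n = 0, where the term of the missing neighbour
    would vanish anyway.\<close>
  define s where "s n = q * (real n + 2) / (real n + 1)" for n
  have s: "s n > 0" for n using q by (simp add: s_def add_pos_nonneg)
  have w: "weight s n = 1 + (q + 1 / q) / 2 - (1 / q - q) / 2 * (1 / (real n + 1))" for n
  proof (cases n)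
    case 0
    then show ?thesis by (simp add: weight_def s_def field_simps)
  next
    case (Suc m)
    define r where "r = real m + 2"
    have r: "r > 0" "real n + 1 = r" by (simp_all add: r_def Suc)
    have "s n = q * (r + 1) / r" "1 / s (n - 1) = (r - 1) / (q * r)"
      by (simp_all add: s_def r_def Suc add.commute)
    moreover have "q * (r + 1) / r = q + q * (1 / r)" "(r - 1) / (q * r) = 1 / q - 1 / q * (1 / r)"
      using q r(1) by (simp_all add: field_simps)
    ultimately have "weight s n = 1 + (q + q * (1 / r) + (1 / q - 1 / q * (1 / r))) / 2"
      using Suc by (simp add: weight_def)
    then show ?thesis unfolding r(2) by (simp add: algebra_simps add_divide_distrib diff_divide_distrib)
  qed
  have "summable (\<lambda>n. 1 / (real n + 1) * photon_prob \<rho> n)"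
  proof (rule summable_comparison_test'[OF sums_summable[OF p(1)], of 0])
    fix n
    have "1 / (real n + 1) * photon_prob \<rho> n \<le> 1 * photon_prob \<rho> n"
      by (intro mult_right_mono p(2)) simp
    then show "norm (1 / (real n + 1) * photon_prob \<rho> n) \<le> photon_prob \<rho> n"
      using p(2)[of n] by simp
  qed
  then obtain h where h: "(\<lambda>n. 1 / (real n + 1) * photon_prob \<rho> n) sums h"
    by (auto simp: summable_def)
  \<comment> \<open>Jensen's inequality for the convex function 1 / (n + 1), through its tangent at
    the mean y = \<mu> + 1.\<close>
  have tangent: "(\<lambda>n. 2 / y * photon_prob \<rho> n - (1 / y\<^sup>2) * (real n * photon_prob \<rho> n + photon_prob \<rho> n)) sums
      (2 / y * 1 - 1 / y\<^sup>2 * (\<mu> + 1))"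
    by (intro sums_diff sums_mult sums_add p(1) \<mu>)
  have "2 / y * 1 - 1 / y\<^sup>2 * (\<mu> + 1) \<le> h"
  proof (rule sums_le[OF _ tangent h])
    fix n
    have "0 \<le> (1 / (real n + 1)) * (1 - (real n + 1) / y)\<^sup>2" by simp
    also have "\<dots> = 1 / (real n + 1) - 2 / y + (real n + 1) / y\<^sup>2"
      using y by (simp add: power2_eq_square divide_simps add_pos_nonneg less_imp_neq[THEN not_sym]) algebra
    finally have "2 / y - (1 / y\<^sup>2) * (real n + 1) \<le> 1 / (real n + 1)" by simp
    from mult_right_mono[OF this p(2)[of n]]
    show "2 / y * photon_prob \<rho> n - (1 / y\<^sup>2) * (real n * photon_prob \<rho> n + photon_prob \<rho> n)
        \<le> 1 / (real n + 1) * photon_prob \<rho> n"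
      by (simp add: algebra_simps add_divide_distrib)
  qed
  moreover have "2 / y * 1 - 1 / y\<^sup>2 * (\<mu> + 1) = 1 / y"
    unfolding y_def[symmetric] using y by (simp add: power2_eq_square field_simps)
  ultimately have hy: "1 / y \<le> h" by simp
  have "(\<lambda>n. (1 + (q + 1 / q) / 2) * photon_prob \<rho> n - (1 / q - q) / 2 * (1 / (real n + 1) * photon_prob \<rho> n)) sums
      ((1 + (q + 1 / q) / 2) * 1 - (1 / q - q) / 2 * h)"
    by (intro sums_diff sums_mult p(1) h)
  then have "(\<lambda>n. weight s n * photon_prob \<rho> n) sums ((1 + (q + 1 / q) / 2) * 1 - (1 / q - q) / 2 * h)"
    unfolding w by (simp add: algebra_simps)
  from RMSE_square_ge_weight[OF s this]
  have "4 - 2 * ((1 + (q + 1 / q) / 2) * 1 - (1 / q - q) / 2 * h) \<le> (RMSE \<rho> M)\<^sup>2" .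
  also have "4 - 2 * ((1 + (q + 1 / q) / 2) * 1 - (1 / q - q) / 2 * h) = 2 - q - 1 / q + (1 / q - q) * h"
    by (simp add: algebra_simps diff_divide_distrib)
  finally have "2 - q - 1 / q + (1 / q - q) * h \<le> (RMSE \<rho> M)\<^sup>2" .
  moreover have "(1 / q - q) * (1 / y) \<le> (1 / q - q) * h"
  proof (rule mult_left_mono[OF hy])
    have "q \<le> 1" "1 \<le> 1 / q" using q by auto
    then show "0 \<le> 1 / q - q" by linarith
  qed
  ultimately show ?thesis by (simp add: y_def)
qed

text \<open>Two choices of q cover all means. For y = \<mu> + 1 above 6/5, q = 1 - 1/y makes the
  lower bound exactly 1 / y^2, and c y \<le> y - 1/2 holds since c \<le> 0.58235. Near the vacuum
  this fails, and the fixed value q = 1/4 gives 15 / (4 y) - 9/4. For an infinite mean the left side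
  is 0.\<close>

lemma RMSE_ge_mean_photon_number:
  assumes c: "0 \<le> c" "c \<le> 0.58235"
  shows "ennreal c / (mean_photon_number \<rho> + 1 / 2) \<le> ennreal (RMSE \<rho> M)"
proof (cases "mean_photon_number \<rho>")
  case (real \<mu>)
  note p = photon_prob_sums[OF rho]
  have "\<rho> (scaleC z x) = scaleC z (\<rho> x)" for z x
    using rho unfolding density_operator_def positive_operator_def bounded_operator_def by auto
  then have eq: "Re (cinner (ket n) (\<rho> (number_operator (ket n)))) = real n * photon_prob \<rho> n" for n
    by (simp add: number_operator_def number_fun_ket cinner_scaleC_right photon_prob_def)
  then have mean: "(\<Sum>n. ennreal (real n * photon_prob \<rho> n)) = ennreal \<mu>"
    using real by (simp add: mean_photon_number_def)
  then have sum: "summable (\<lambda>n. real n * photon_prob \<rho> n)"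
    using p(2) by (intro summable_suminf_not_top) auto
  then have \<mu>: "(\<lambda>n. real n * photon_prob \<rho> n) sums \<mu>"
    using mean real p(2) by (subst (asm) suminf_ennreal2) (auto simp: sums_iff suminf_nonneg)
  define y where "y = \<mu> + 1"
  have y: "y \<ge> 1" using real by (simp add: y_def)
  have "c / (\<mu> + 1 / 2) \<le> RMSE \<rho> M"
  proof (rule power2_le_imp_le[OF _ RMSE_nonneg[OF rho povm decomp]])
    have c2: "c\<^sup>2 \<le> 0.58235\<^sup>2" using c by (intro power_mono) auto
    show "(c / (\<mu> + 1 / 2))\<^sup>2 \<le> (RMSE \<rho> M)\<^sup>2"
    proof (cases "y \<le> 6 / 5")
      case True
      have "c\<^sup>2 \<le> (15 / 4 / y - 9 / 4) * (y - 1 / 2)\<^sup>2"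
      proof -
        \<comment> \<open>0.33914 is an upper bound for 0.58235^2. In t = y - 1 the inequality
          starts with a margin at t = 0, where the right side is 3/8, and the linear term outweighs
          the negative higher ones up to t = 1/5.\<close>
        have "0.33914 * y \<le> (15 / 4 - 9 / 4 * y) * (y - 1 / 2)\<^sup>2"
        proof -
          define t where "t = y - 1"
          have t: "0 \<le> t" "t \<le> 1 / 5" "y = t + 1" using y True by (simp_all add: t_def)
          have t2: "t\<^sup>2 \<le> 1 / 5 * t"
            using mult_right_mono[OF t(2,1)] by (simp add: power2_eq_square)
          moreover have "t ^ 3 \<le> 1 / 25 * t"
            using mult_right_mono[OF t2 t(1)] t2 by (simp add: power2_eq_square power3_eq_cube)
          moreover have "(15 / 4 - 9 / 4 * y) * (y - 1 / 2)\<^sup>2 = 3 / 8 + 15 / 16 * t - 3 / 4 * t\<^sup>2 - 9 / 4 * t ^ 3"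
            unfolding t(3) by (simp add: power2_eq_square power3_eq_cube field_simps)
          ultimately show ?thesis using t by simp
        qed
        then have "0.33914 \<le> (15 / 4 - 9 / 4 * y) * (y - 1 / 2)\<^sup>2 / y" using y by (simp add: field_simps)
        also have "\<dots> = (15 / 4 / y - 9 / 4) * (y - 1 / 2)\<^sup>2" using y by (simp add: field_simps)
        finally show ?thesis using c2 by (simp add: power2_eq_square)
      qed
      then have "(c / (\<mu> + 1 / 2))\<^sup>2 \<le> 15 / 4 / y - 9 / 4"
        using y by (simp add: power_divide y_def divide_le_eq add.commute)
      also have "\<dots> \<le> (RMSE \<rho> M)\<^sup>2"
        using RMSE_square_ge_mean[OF \<mu>, of "1 / 4"] by (simp add: y_def)
      finally show ?thesis .
    next
      case False
      have "c / (\<mu> + 1 / 2) \<le> 1 / y"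
      proof -
        have "c * y \<le> 0.58235 * y" using c y by (intro mult_right_mono) auto
        also have "\<dots> \<le> y - 1 / 2" using False by simp
        finally show ?thesis using real by (simp add: y_def field_simps)
      qed
      then have "(c / (\<mu> + 1 / 2))\<^sup>2 \<le> (1 / y)\<^sup>2"
        using c real by (intro power_mono) auto
      also have "\<dots> = 2 - (1 - 1 / y) - 1 / (1 - 1 / y) + (1 / (1 - 1 / y) - (1 - 1 / y)) / y"
        using False by (simp add: divide_simps power2_eq_square) algebra
      also have "\<dots> \<le> (RMSE \<rho> M)\<^sup>2"
        using RMSE_square_ge_mean[OF \<mu>, of "1 - 1 / y"] False by (simp add: y_def)
      finally show ?thesis .
    qed
  qed
  moreover have "ennreal c / (mean_photon_number \<rho> + 1 / 2) = ennreal (c / (\<mu> + 1 / 2))"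
  proof -
    have "(1 / 2 :: ennreal) = ennreal (1 / 2)"
      using divide_ennreal[of 1 2] by simp
    then have "mean_photon_number \<rho> + 1 / 2 = ennreal (\<mu> + 1 / 2)"
      using real by (simp add: ennreal_plus)
    then show ?thesis using c real by (simp only:) (rule divide_ennreal, simp_all)
  qed
  ultimately show ?thesis by (simp add: ennreal_leI)
qed simp

end

theorem theorem2:
  fixes \<rho> :: "fock \<Rightarrow> fock" and M :: "real set \<Rightarrow> fock \<Rightarrow> fock"
  assumes "density_operator \<rho>" and "circle_povm M"
  shows "ennreal (RMSE \<rho> M) \<ge> ennreal (pi / sqrt 3) / L_half \<rho> \<and>
         RMSE \<rho> M \<ge> (GREATEST p. p \<in> range (photon_prob \<rho>)) \<and>
         ennreal (RMSE \<rho> M) \<ge> ennreal f_max / (mean_photon_number \<rho> + 1 / 2) \<and>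
         (\<forall>\<beta>\<ge>1/2. bound_fun \<beta> \<le> f_max) \<and>
         \<bar>f_max - 0.5823\<bar> \<le> 0.00005 \<and>
         (\<exists>\<alpha>\<ge>1/2. bound_fun \<alpha> = f_max \<and> \<bar>\<alpha> - 0.7471\<bar> \<le> 0.00005)"
proof -
  obtain l where l: "state_decomp \<rho> l" using state_decomp_exists[OF assms(1)] .
  note ctxt = assms l
  obtain \<alpha> where \<alpha>: "0.74705 \<le> \<alpha>" "\<alpha> \<le> 0.74715" "bound_fun \<alpha> = f_max"
    "\<And>\<beta>. \<beta> \<ge> 1 / 2 \<Longrightarrow> bound_fun \<beta> \<le> f_max" "0.5823 \<le> f_max" "f_max \<le> 0.58235"
    using f_max_facts by metis
  have "\<bar>f_max - 0.5823\<bar> \<le> 0.00005" using \<alpha>(5,6) by (simp add: abs_le_iff)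
  moreover have "\<exists>\<alpha>\<ge>1/2. bound_fun \<alpha> = f_max \<and> \<bar>\<alpha> - 0.7471\<bar> \<le> 0.00005"
  proof (intro exI conjI)
    show "1 / 2 \<le> \<alpha>" using \<alpha>(1) by simp
    show "\<bar>\<alpha> - 0.7471\<bar> \<le> 0.00005" by (rule abs_leI) (use \<alpha>(1,2) in simp_all)
  qed (rule \<alpha>(3))
  moreover have "ennreal f_max / (mean_photon_number \<rho> + 1 / 2) \<le> ennreal (RMSE \<rho> M)"
    by (rule RMSE_ge_mean_photon_number[OF ctxt]) (use \<alpha>(5,6) in simp_all)
  ultimately show ?thesis
    using RMSE_ge_L_half[OF ctxt] RMSE_ge_max_photon_prob[OF ctxt] \<alpha>(4) by blast
qed

end
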